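(* Let $U$ be a strongly continuous, or weak$^*$ continuous, representation of $\mathbf{R}^d$ by bounded operators on a Banach space $\chi$. Let $c_\alpha\in\mathbf{C}$, $|\alpha|\leq m$, be the coefficients of a strongly elliptic operator $H=\sum_{|\alpha|\leq m}c_\alpha(-\partial)^\alpha$ of even order $m$ and $K_t$ $(t>0)$ the kernel on $\mathbf{R}^d$ of the semigroup generated by $H$. Then the operators $$S^{(U)}_t=U(K_t)=\int_{\mathbf{R}^d}dy\,K_t(y)\,U(y)$$ are well-defined as strong, or weak$^*$, integrals on $\chi$. They form a strongly, or weakly$^*$, continuous holomorphic semigroup whose generator is the strong, or weak$^*$, closure of the operator $H^{(U)}=\sum_{|\alpha|\leq m}c_\alpha X^\alpha$ on $\chi_m$. Moreover, there are $a,b>0$ and $\omega\geq 0$ such that $$N_k(S^{(U)}_t\varphi)\leq a\,b^k\,t^{-k/m}\,(k!)^{1/m}\,e^{\omega t}\,\|\varphi\|$$ for all $k\geq 1$, $t>0$ and $\varphi\in\chi$. Hence $S^{(U)}_t$ $(t>0)$ maps $\chi$ into the subspace of entire analytic functions for $U$. Therefore the latter subspace is strongly, or weakly$^*$, dense in $\chi$.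
   Context: Multi-indices are finite sequences $\alpha=(k_1,\ldots,k_n)$ with $k_j\in\{1,\ldots,d\}$; $|\alpha|=n$, and $\xi^\alpha=\xi_{k_1}\cdots\xi_{k_n}$, $X^\alpha=X_{k_1}\cdots X_{k_n}$, etc. The integer $m\ge2$ is even. $H=\sum_{|\alpha|\leq m}c_\alpha(-\partial)^\alpha$ is strongly elliptic if there is a $\mu>0$ such that $\mathrm{Re}\big((-1)^{m/2}\sum_{|\alpha|=m}c_\alpha\xi^\alpha\big)\geq\mu|\xi|^m$ for all $\xi\in\mathbf{R}^d$. With $h(\xi)=\sum_{|\alpha|\leq m}c_\alpha(-i\xi)^\alpha$ the kernel is $K_t(x)=(2\pi)^{-d}\int_{\mathbf{R}^d}d\xi\,e^{ix\cdot\xi}e^{-th(\xi)}$, so $e^{-tH}\varphi=K_t*\varphi$ on $L_2(\mathbf{R}^d)$. "Generator of a semigroup $S$" is understood with the convention $S_t=e^{-tA}$ ($A$ is the generator). Continuity of the representation: strong continuity means $\|(U(x)-I)\varphi\|\to0$ as $|x|\to0$ for all $\varphi\in\chi$. If $\chi$ is the dual of a Banach space $\chi_*$, then $U$ is weak$^*$ continuous if $f\circ U(x)\in\chi_*$ for all $f\in\chi_*$ and $x\in\mathbf{R}^d$, and $\lim_{|x|\to0}(f,U(x)\varphi)=(f,\varphi)$ for all $\varphi\in\chi$, $f\in\chi_*$. In the first alternative all topological notions refer to the strong topology, in the second to the weak$^*$ topology. Let $x_1,\ldots,x_d$ be the coordinate basis of $\mathbf{R}^d$ and $X_k=\lim_{t\to0}(U(tx_k)-I)/t$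 the infinitesimal generators of the one-parameter groups $t\mapsto U(tx_k)$ (strong, respectively weak$^*$, limit). Set $\chi_n=\bigcap_{|\alpha|=n}D(X^\alpha)$, $\chi_\infty=\bigcap_{n\geq1}\chi_n$ and $N_k(\varphi)=\sup_{|\alpha|=k}\|X^\alpha\varphi\|$ for $\varphi\in\chi_k$. An element $\varphi\in\chi_\infty$ is an entire analytic function for $U$ if $\sum_{k\geq1}(s^k/k!)N_k(\varphi)<\infty$ for all $s>0$. *)

theory Defs
  imports "HOL-Analysis.Analysis"
begin

class scaleC =
  fixes scaleC :: "complex \<Rightarrow> 'a \<Rightarrow> 'a" (infixr \<open>*\<^sub>C\<close> 75)

class complex_normed_vector = real_normed_vector + scaleC +
  assumes scaleC_add_right: "a *\<^sub>C (x + y) = a *\<^sub>C x + a *\<^sub>C y"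
    and scaleC_add_left: "(a + b) *\<^sub>C x = a *\<^sub>C x + b *\<^sub>C x"
    and scaleC_scaleC: "a *\<^sub>C (b *\<^sub>C x) = (a * b) *\<^sub>C x"
    and scaleR_scaleC: "r *\<^sub>R x = complex_of_real r *\<^sub>C x"
    and norm_scaleC: "norm (a *\<^sub>C x) = cmod a * norm x"

class complex_banach = complex_normed_vector + banach

instantiation complex :: complex_banach
begin

definition scaleC_complex :: "complex \<Rightarrow> complex \<Rightarrow> complex"
  where "scaleC_complex a x = a * x"

instance
  by standard
    (auto simp: scaleC_complex_def algebra_simps norm_mult scaleR_conv_of_real)

end

definition bounded_clinear ::
    "('a::complex_normed_vector \<Rightarrow> 'b::complex_normed_vector) \<Rightarrow> bool"
  where "bounded_clinear A \<longleftrightarrow> bounded_linear A \<and> (\<forall>a x. A (a *\<^sub>C x) = a *\<^sub>C A x)"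

text \<open>
  \<open>is_dual_pairing B\<close>: the bilinear form \<open>B f \<phi> = (f, \<phi>)\<close> identifies \<open>'a\<close>, isometrically, with
  the dual space of \<open>'p\<close>.
\<close>

definition is_dual_pairing ::
    "('p::complex_banach \<Rightarrow> 'a::complex_banach \<Rightarrow> complex) \<Rightarrow> bool"
  where "is_dual_pairing B \<longleftrightarrow>
    (\<forall>\<phi>. bounded_clinear (\<lambda>f. B f \<phi>)) \<and>
    (\<forall>f. bounded_clinear (B f)) \<and>
    (\<forall>\<phi>. norm \<phi> = onorm (\<lambda>f. B f \<phi>)) \<and>
    (\<forall>L. bounded_clinear L \<longrightarrow> (\<exists>\<phi>. \<forall>f. L f = B f \<phi>))"

definition weak_star_topology :: "('p \<Rightarrow> 'a \<Rightarrow> complex) \<Rightarrow> 'a topology"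
  where "weak_star_topology B =
    pullback_topology UNIV (\<lambda>\<phi> f. B f \<phi>) (product_topology (\<lambda>_. euclidean) UNIV)"

lemma topspace_weak_star_topology [simp]: "topspace (weak_star_topology B) = UNIV"
  by (simp add: weak_star_topology_def topspace_pullback_topology)

lemma limitin_weak_star_topology:
  fixes B :: "'p \<Rightarrow> 'a \<Rightarrow> complex"
  shows "limitin (weak_star_topology B) g l F \<longleftrightarrow> (\<forall>f. ((\<lambda>x. B f (g x)) \<longlongrightarrow> B f l) F)"
proof -
  define e where "e = (\<lambda>\<phi> f. B f \<phi>)"
  define P where "P = (product_topology (\<lambda>_. euclidean) UNIV :: ('p \<Rightarrow> complex) topology)"
  have top: "topspace P = UNIV"
    by (simp add: P_def)
  have op: "openin (weak_star_topology B) V \<longleftrightarrow> (\<exists>W. openin P W \<and> V = e -` W)" for V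
    by (simp add: weak_star_topology_def openin_pullback_topology e_def P_def)
  have "limitin (weak_star_topology B) g l F \<longleftrightarrow>
      (\<forall>V. openin (weak_star_topology B) V \<and> l \<in> V \<longrightarrow> (\<forall>\<^sub>F x in F. g x \<in> V))"
    by (simp add: limitin_def)
  also have "\<dots> \<longleftrightarrow> (\<forall>W. openin P W \<and> e l \<in> W \<longrightarrow> (\<forall>\<^sub>F x in F. e (g x) \<in> W))"
  proof (intro iffI allI impI)
    fix W assume *: "\<forall>V. openin (weak_star_topology B) V \<and> l \<in> V \<longrightarrow> (\<forall>\<^sub>F x in F. g x \<in> V)"
      and W: "openin P W \<and> e l \<in> W"
    have "openin (weak_star_topology B) (e -` W) \<and> l \<in> e -` W"
      unfolding op using W by blast
    then have "\<forall>\<^sub>F x in F. g x \<in> e -` W"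
      using * by blast
    then show "\<forall>\<^sub>F x in F. e (g x) \<in> W"
      by simp
  next
    fix V assume *: "\<forall>W. openin P W \<and> e l \<in> W \<longrightarrow> (\<forall>\<^sub>F x in F. e (g x) \<in> W)"
      and V: "openin (weak_star_topology B) V \<and> l \<in> V"
    then obtain W where W: "openin P W" "V = e -` W"
      unfolding op by blast
    then have "\<forall>\<^sub>F x in F. e (g x) \<in> W"
      using * V by blast
    then show "\<forall>\<^sub>F x in F. g x \<in> V"
      by (simp add: W(2))
  qed
  also have "\<dots> \<longleftrightarrow> limitin P (\<lambda>x. e (g x)) (e l) F"
    by (simp add: limitin_def top)
  also have "\<dots> \<longleftrightarrow> (\<forall>f. ((\<lambda>x. B f (g x)) \<longlongrightarrow> B f l) F)"
    by (simp add: P_def e_def limitin_componentwise)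
  finally show ?thesis .
qed

text \<open>
  From here on \<open>T\<close> is the topology on the Banach space to which all topological notions refer:
  \<open>euclidean\<close> (the norm topology) or \<open>weak_star_topology B\<close>.
\<close>

definition representation :: "(real ^ 'd \<Rightarrow> 'a::complex_banach \<Rightarrow> 'a) \<Rightarrow> bool"
  where "representation U \<longleftrightarrow>
    (\<forall>x. bounded_clinear (U x)) \<and> U 0 = id \<and> (\<forall>x y. U (x + y) = U x \<circ> U y)"

definition strongly_continuous_rep :: "(real ^ 'd \<Rightarrow> 'a::complex_banach \<Rightarrow> 'a) \<Rightarrow> bool"
  where "strongly_continuous_rep U \<longleftrightarrow>
    representation U \<and> (\<forall>\<phi>. ((\<lambda>x. norm (U x \<phi> - \<phi>)) \<longlongrightarrow> 0) (at 0))"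

definition weak_star_continuous_rep ::
    "('p::complex_banach \<Rightarrow> 'a::complex_banach \<Rightarrow> complex) \<Rightarrow> (real ^ 'd \<Rightarrow> 'a \<Rightarrow> 'a) \<Rightarrow> bool"
  where "weak_star_continuous_rep B U \<longleftrightarrow>
    representation U \<and>
    (\<forall>f x. \<exists>g. \<forall>\<phi>. B f (U x \<phi>) = B g \<phi>) \<and>
    (\<forall>f \<phi>. ((\<lambda>x. B f (U x \<phi>)) \<longlongrightarrow> B f \<phi>) (at 0))"

text \<open>
  The Bochner integral of the library requires a second countable range. For values in an
  arbitrary Banach space the strong integral is the Henstock--Kurzweil integral together with
  absolute convergence; on norm continuous integrands it agrees with the Bochner integral.
\<close>

definition has_strong_integral :: "(real ^ 'd \<Rightarrow> 'a::banach) \<Rightarrow> 'a \<Rightarrow> bool"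
  where "has_strong_integral g \<psi> \<longleftrightarrow>
    (g has_integral \<psi>) UNIV \<and> (\<lambda>y. norm (g y)) integrable_on UNIV"

definition has_weak_star_integral ::
    "('p \<Rightarrow> 'a \<Rightarrow> complex) \<Rightarrow> (real ^ 'd \<Rightarrow> 'a) \<Rightarrow> 'a \<Rightarrow> bool"
  where "has_weak_star_integral B g \<psi> \<longleftrightarrow>
    (\<forall>f. has_bochner_integral lborel (\<lambda>y. B f (g y)) (B f \<psi>))"

definition op_apply :: "('a \<times> 'a) set \<Rightarrow> 'a \<Rightarrow> 'a"
  where "op_apply A \<phi> = (THE \<psi>. (\<phi>, \<psi>) \<in> A)"

definition inf_gen ::
    "'a topology \<Rightarrow> (real ^ 'd \<Rightarrow> 'a::complex_banach \<Rightarrow> 'a) \<Rightarrow> 'd \<Rightarrow> ('a \<times> 'a) set"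
  where "inf_gen T U k =
    {(\<phi>, \<psi>). limitin T (\<lambda>t. (1 / t) *\<^sub>R (U (t *\<^sub>R axis k 1) \<phi> - \<phi>)) \<psi> (at 0)}"

text \<open>
  Multi-indices \<open>(k\<^sub>1, \<dots>, k\<^sub>n)\<close> are lists over the index type. In
  \<open>X\<^sup>\<alpha> = X\<^bsub>k\<^sub>1\<^esub> \<cdots> X\<^bsub>k\<^sub>n\<^esub>\<close> the last factor acts first, whereas \<open>R O S\<close> applies \<open>R\<close> first.
\<close>

primrec inf_gen_power ::
    "'a topology \<Rightarrow> (real ^ 'd \<Rightarrow> 'a::complex_banach \<Rightarrow> 'a) \<Rightarrow> 'd list \<Rightarrow> ('a \<times> 'a) set"
  where
    "inf_gen_power T U [] = Id"
  | "inf_gen_power T U (k # \<alpha>) = inf_gen_power T U \<alpha> O inf_gen T U k"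

definition diff_space ::
    "'a topology \<Rightarrow> (real ^ 'd \<Rightarrow> 'a::complex_banach \<Rightarrow> 'a) \<Rightarrow> nat \<Rightarrow> 'a set"
  where "diff_space T U n = (\<Inter>\<alpha>\<in>{\<alpha>. length \<alpha> = n}. Domain (inf_gen_power T U \<alpha>))"

definition smooth_space ::
    "'a topology \<Rightarrow> (real ^ 'd \<Rightarrow> 'a::complex_banach \<Rightarrow> 'a) \<Rightarrow> 'a set"
  where "smooth_space T U = (\<Inter>n\<in>{1..}. diff_space T U n)"

definition diff_seminorm ::
    "'a topology \<Rightarrow> (real ^ 'd \<Rightarrow> 'a::complex_banach \<Rightarrow> 'a) \<Rightarrow> nat \<Rightarrow> 'a \<Rightarrow> real"
  where "diff_seminorm T U k \<phi> =
    (SUP \<alpha>\<in>{\<alpha>. length \<alpha> = k}. norm (op_apply (inf_gen_power T U \<alpha>) \<phi>))"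

definition entire_analytic ::
    "'a topology \<Rightarrow> (real ^ 'd \<Rightarrow> 'a::complex_banach \<Rightarrow> 'a) \<Rightarrow> 'a set"
  where "entire_analytic T U =
    {\<phi> \<in> smooth_space T U.
      \<forall>s>0. summable (\<lambda>j. s ^ Suc j / fact (Suc j) * diff_seminorm T U (Suc j) \<phi>)}"

text \<open>A coefficient family \<open>c\<close> enters only through the values \<open>c \<alpha>\<close> with \<open>length \<alpha> \<le> m\<close>.\<close>

definition strongly_elliptic :: "nat \<Rightarrow> ('d::finite list \<Rightarrow> complex) \<Rightarrow> bool"
  where "strongly_elliptic m c \<longleftrightarrow>
    (\<exists>\<mu>>0. \<forall>\<xi>::real ^ 'd.
      Re ((- 1) ^ (m div 2) *
          (\<Sum>\<alpha> | length \<alpha> = m. c \<alpha> * complex_of_real (prod_list (map (\<lambda>k. \<xi> $ k) \<alpha>))))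
        \<ge> \<mu> * norm \<xi> ^ m)"

definition symbol :: "nat \<Rightarrow> ('d::finite list \<Rightarrow> complex) \<Rightarrow> real ^ 'd \<Rightarrow> complex"
  where "symbol m c \<xi> =
    (\<Sum>\<alpha> | length \<alpha> \<le> m. c \<alpha> * prod_list (map (\<lambda>k. - \<i> * complex_of_real (\<xi> $ k)) \<alpha>))"

definition heat_kernel :: "nat \<Rightarrow> ('d::finite list \<Rightarrow> complex) \<Rightarrow> real \<Rightarrow> real ^ 'd \<Rightarrow> complex"
  where "heat_kernel m c t x =
    1 / (2 * complex_of_real pi) ^ CARD('d) *
    (\<integral>\<xi>. exp (\<i> * complex_of_real (x \<bullet> \<xi>)) * exp (- complex_of_real t * symbol m c \<xi>) \<partial>lborel)"

definition rep_operator ::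
    "'a topology \<Rightarrow> (real ^ 'd \<Rightarrow> 'a::complex_banach \<Rightarrow> 'a) \<Rightarrow> nat \<Rightarrow>
      ('d list \<Rightarrow> complex) \<Rightarrow> ('a \<times> 'a) set"
  where "rep_operator T U m c =
    {(\<phi>, \<Sum>\<alpha> | length \<alpha> \<le> m. c \<alpha> *\<^sub>C op_apply (inf_gen_power T U \<alpha>) \<phi>) | \<phi>.
      \<phi> \<in> diff_space T U m}"

text \<open>
  The operators \<open>U(K\<^sub>t)\<close>, with the convention that the semigroup is the identity at \<open>t = 0\<close>. The
  parameter \<open>J\<close> is the notion of integral: \<open>J g \<psi>\<close> says that \<open>g\<close> is integrable with integral \<open>\<psi>\<close>.
\<close>

definition rep_semigroup ::
    "((real ^ 'd \<Rightarrow> 'a) \<Rightarrow> 'a \<Rightarrow> bool) \<Rightarrow> (real ^ 'd \<Rightarrow> 'a::complex_banach \<Rightarrow> 'a) \<Rightarrow> nat \<Rightarrow>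
      ('d list \<Rightarrow> complex) \<Rightarrow> real \<Rightarrow> 'a \<Rightarrow> 'a"
  where "rep_semigroup J U m c t \<phi> =
    (if t = 0 then \<phi> else (THE \<psi>. J (\<lambda>y. heat_kernel m c t y *\<^sub>C U y \<phi>) \<psi>))"

definition continuous_semigroup ::
    "'a::complex_banach topology \<Rightarrow> (real \<Rightarrow> 'a \<Rightarrow> 'a) \<Rightarrow> bool"
  where "continuous_semigroup T S \<longleftrightarrow>
    (\<forall>t\<ge>0. bounded_clinear (S t) \<and> continuous_map T T (S t)) \<and>
    S 0 = id \<and> (\<forall>s\<ge>0. \<forall>t\<ge>0. S (s + t) = S s \<circ> S t) \<and>
    (\<forall>\<phi>. continuous_map (top_of_set {0..}) T (\<lambda>t. S t \<phi>))"

definition sector :: "real \<Rightarrow> complex set"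
  where "sector \<theta> = {z. z \<noteq> 0 \<and> \<bar>Arg z\<bar> < \<theta>}"

definition holomorphic_semigroup ::
    "'a::complex_banach topology \<Rightarrow> (real \<Rightarrow> 'a \<Rightarrow> 'a) \<Rightarrow> bool"
  where "holomorphic_semigroup T S \<longleftrightarrow>
    (\<exists>\<theta> Z. 0 < \<theta> \<and> \<theta> \<le> pi / 2 \<and>
      (\<forall>t>0. Z (complex_of_real t) = S t) \<and>
      (\<forall>z\<in>sector \<theta>. bounded_clinear (Z z) \<and> continuous_map T T (Z z)) \<and>
      (\<forall>z\<in>sector \<theta>. \<forall>w\<in>sector \<theta>. Z (z + w) = Z z \<circ> Z w) \<and>
      (\<forall>z\<in>sector \<theta>. \<forall>\<phi>. \<exists>\<psi>.
        limitin T (\<lambda>w. (1 / w) *\<^sub>C (Z (z + w) \<phi> - Z z \<phi>)) \<psi> (at 0)) \<and>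
      (\<forall>\<theta>'. 0 < \<theta>' \<and> \<theta>' < \<theta> \<longrightarrow>
        (\<forall>\<phi>. limitin T (\<lambda>z. Z z \<phi>) \<phi> (at 0 within sector \<theta>'))))"

text \<open>The sign is that of the convention \<open>S\<^sub>t = e\<^bsup>-tA\<^esup>\<close> for the generator \<open>A\<close>.\<close>

definition semigroup_generator ::
    "'a::complex_banach topology \<Rightarrow> (real \<Rightarrow> 'a \<Rightarrow> 'a) \<Rightarrow> ('a \<times> 'a) set"
  where "semigroup_generator T S =
    {(\<phi>, \<psi>). limitin T (\<lambda>t. (1 / t) *\<^sub>R (\<phi> - S t \<phi>)) \<psi> (at_right 0)}"

end

theory Submission
  imports Defs "HOL-Complex_Analysis.Complex_Analysis" "HOL-Probability.Probability"
begin

text \<open>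
  To a function \<open>F\<close> on \<open>\<complex>\<^sup>d\<close> that is holomorphic and decays faster than exponentially in all strips
  of bounded imaginary part one assigns \<open>\<Psi> F = \<integral> (F\<^sup>\<or>)(y) U(y) dy\<close>, where \<open>F\<^sup>\<or>\<close> is the inverse
  Fourier transform. Shifting the contour gives exponential decay of \<open>F\<^sup>\<or>\<close>, with constants read off
  from bounds of \<open>F\<close> on strips, and Fourier inversion makes \<open>\<Psi>\<close> multiplicative. Since
  \<open>X\<^sub>k \<Psi> F = \<Psi>(-\<i> \<zeta>\<^sub>k F)\<close>, every assertion about \<open>S\<^sub>t = \<Psi>(e\<^bsup>-th\<^esup>)\<close> becomes an elementary estimate of
  multipliers: the semigroup law, holomorphy in \<open>t\<close> by Taylor expansion, and the bounds on
  \<open>X\<^sup>\<alpha> S\<^sub>t = \<Psi>((-\<i>\<zeta>)\<^sup>\<alpha> e\<^bsup>-th\<^esup>)\<close>. The generator and the closure of \<open>H\<^bsup>(U)\<^esup>\<close> both coincide with the closed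
  set of pairs \<open>(\<phi>, \<psi>)\<close> with \<open>S\<^sub>t \<psi> = \<Psi>(h e\<^bsup>-th\<^esup>) \<phi>\<close> for all \<open>t > 0\<close>.

  In the weak* case the weak* continuity of \<open>S\<^sub>t\<close> requires the integral on the predual, hence strong
  continuity of the predual group. This follows from weak continuity by Baire's theorem: an orbit
  lies in a separable subspace, and closed balls are weakly closed.
\<close>

section \<open>The Hahn-Banach theorem and weakly continuous groups\<close>

text \<open>The representation may grow like \<open>exp (W * l1norm x)\<close>, so the kernels must
  decay faster than that, and the limit t to 0 needs constants independent of t. Both dictate the
  size of the contour shift: for \<open>heat w\<close> with t = |w| the imaginary part is a constant
  plus t^(-1/m). There t times the m-th power of the shift is of order 1 + t, so the growth of the
  symbol off the real space costs only a factor a exp(\<omega> t). The strip leaves decay of rate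
  t^(-1/m) in y, the symbol gives decay of rate t^(1/m) in the real frequency, and the two powers
  cancel in the weighted L1 norm of the kernel. The factor (k!)^(1/m) is the m-th root of the one in
  a single term of the exponential series. Convergence in T must be uniform over each set of
  functionals in \<open>\<Lambda>\<close>, which pointwise dominated convergence does not give;
  limits are therefore estimated by explicit kernel bounds. Values at t = 0 are inserted by hand,
  because the constant multiplier 1 is not admissible.\<close>

definition sublinear :: "('a::real_vector \<Rightarrow> real) \<Rightarrow> bool"
  where "sublinear q \<longleftrightarrow> (\<forall>x y. q (x + y) \<le> q x + q y) \<and> (\<forall>r>0. \<forall>x. q (r *\<^sub>R x) \<le> r * q x)"

lemma sublinear_add: "sublinear q \<Longrightarrow> q (x + y) \<le> q x + q y"
  by (simp add: sublinear_def)

text \<open>Applying the inequality to the factor 1 / r gives the reverse one. The definition asks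
  only for the half that infima inherit directly.\<close>

lemma sublinear_scale:
  assumes "sublinear q" "r > 0"
  shows "q (r *\<^sub>R x) = r * q x"
proof (rule antisym)
  show "q (r *\<^sub>R x) \<le> r * q x"
    using assms by (simp add: sublinear_def)
  have "q ((1 / r) *\<^sub>R (r *\<^sub>R x)) \<le> (1 / r) * q (r *\<^sub>R x)"
    using assms unfolding sublinear_def by (metis zero_less_divide_1_iff)
  then show "r * q x \<le> q (r *\<^sub>R x)"
    using assms by (simp add: field_simps)
qed

lemma sublinear_zero:
  assumes "sublinear q"
  shows "q 0 = 0"
  using sublinear_scale[OF assms, of 2 0] by simp

lemma sublinear_minus:
  assumes "sublinear q"
  shows "- q (- x) \<le> q x"
  using sublinear_add[OF assms, of x "- x"] sublinear_zero[OF assms] by simp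

text \<open>Lowers q at \<open>- y\<close> as far as sublinearity permits: t = 0 shows
  \<open>q' x \<le> q x\<close>, t = 1 gives the value at \<open>- y\<close>, and
  \<open>- q (- x)\<close> bounds all competitors from below. A minimal q cannot be lowered, whence
  \<open>q (- y) = - q y\<close>, the missing half of linearity.\<close>

lemma sublinear_descent:
  assumes q: "sublinear q"
  obtains q' where "sublinear q'" "\<And>x. q' x \<le> q x" "q' (- y) \<le> - q y"
proof -
  define V where "V x = (\<lambda>t. q (x + t *\<^sub>R y) - t * q y) ` {0..}" for x
  define q' where "q' x = Inf (V x)" for x
  have lower: "- q (- x) \<le> v" if "v \<in> V x" for v x
  proof -
    from that obtain t where t: "t \<ge> 0" "v = q (x + t *\<^sub>R y) - t * q y"
      unfolding V_def by blast
    have "t * q y = q (t *\<^sub>R y)"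
      using t sublinear_scale[OF q, of t y] sublinear_zero[OF q] by (cases "t = 0") auto
    also have "\<dots> \<le> q (x + t *\<^sub>R y) + q (- x)"
      using sublinear_add[OF q, of "x + t *\<^sub>R y" "- x"] by simp
    finally show ?thesis
      using t by simp
  qed
  have bdd: "bdd_below (V x)" for x
    using lower by (meson bdd_below.I)
  have ne: "V x \<noteq> {}" for x
    by (auto simp: V_def)
  have le: "q' x \<le> q (x + t *\<^sub>R y) - t * q y" if "t \<ge> 0" for x t
    unfolding q'_def by (rule cInf_lower[OF _ bdd]) (use that in \<open>auto simp: V_def\<close>)
  have ge: "r \<le> q' x" if "\<And>t. t \<ge> 0 \<Longrightarrow> r \<le> q (x + t *\<^sub>R y) - t * q y" for r x
    unfolding q'_def by (rule cInf_greatest[OF ne]) (use that in \<open>auto simp: V_def\<close>)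
  show thesis
  proof (rule that[of q'])
    show "q' x \<le> q x" for x
      using le[of 0 x] by simp
    show "q' (- y) \<le> - q y"
      using le[of 1 "- y"] sublinear_zero[OF q] by simp
    show "sublinear q'"
      unfolding sublinear_def
    proof (intro conjI allI impI)
      fix x z
      have "q' (x + z) - (q (z + s *\<^sub>R y) - s * q y) \<le> q' x" if "s \<ge> 0" for s
      proof (rule ge)
        fix t :: real
        assume "t \<ge> 0"
        have "q (x + z + (t + s) *\<^sub>R y) \<le> q (x + t *\<^sub>R y) + q (z + s *\<^sub>R y)"
          using sublinear_add[OF q, of "x + t *\<^sub>R y" "z + s *\<^sub>R y"] by (simp add: algebra_simps)
        with le[of "t + s" "x + z"] \<open>t \<ge> 0\<close> \<open>s \<ge> 0\<close>
        show "q' (x + z) - (q (z + s *\<^sub>R y) - s * q y) \<le> q (x + t *\<^sub>R y) - t * q y"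
          by (simp add: algebra_simps)
      qed
      then have "q' (x + z) - q' x \<le> q' z"
        by (intro ge) (simp add: algebra_simps)
      then show "q' (x + z) \<le> q' x + q' z"
        by simp
    next
      fix r :: real and x
      assume r: "r > 0"
      have "q' (r *\<^sub>R x) / r \<le> q' x"
      proof (rule ge)
        fix t :: real
        assume t: "t \<ge> 0"
        have "q' (r *\<^sub>R x) \<le> q (r *\<^sub>R x + (r * t) *\<^sub>R y) - r * t * q y"
          using le[of "r * t" "r *\<^sub>R x"] r t by simp
        also have "q (r *\<^sub>R x + (r * t) *\<^sub>R y) = r * q (x + t *\<^sub>R y)"
          using sublinear_scale[OF q r, of "x + t *\<^sub>R y"] by (simp add: scaleR_add_right)
        finally show "q' (r *\<^sub>R x) / r \<le> q (x + t *\<^sub>R y) - t * q y"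
          using r by (simp add: field_simps)
      qed
      then show "q' (r *\<^sub>R x) \<le> r * q' x"
        using r by (simp add: field_simps)
    qed
  qed
qed

text \<open>Comparability is used for subadditivity: of two members q and r the smaller one, applied
  to x + y, is bounded by q x + r y. The infimum is finite since \<open>- p (- x)\<close> lies below
  every member.\<close>

lemma sublinear_Inf_chain:
  assumes C: "C \<noteq> {}" "\<And>q. q \<in> C \<Longrightarrow> sublinear q" "\<And>q x. q \<in> C \<Longrightarrow> q x \<le> p x"
    and chain: "\<And>q r. q \<in> C \<Longrightarrow> r \<in> C \<Longrightarrow> q \<le> r \<or> r \<le> q"
  obtains u where "sublinear u" "\<And>q x. q \<in> C \<Longrightarrow> u x \<le> q x"
proof -
  define u where "u x = (INF q\<in>C. q x)" for x
  have bdd: "bdd_below ((\<lambda>q. q x) ` C)" for x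
  proof (rule bdd_belowI2)
    fix q
    assume "q \<in> C"
    then show "- p (- x) \<le> q x"
      using sublinear_minus[OF C(2), of q x] C(3)[of q "- x"] by simp
  qed
  have le: "u x \<le> q x" if "q \<in> C" for q x
    unfolding u_def by (rule cINF_lower[OF bdd that])
  have ge: "r \<le> u x" if "\<And>q. q \<in> C \<Longrightarrow> r \<le> q x" for r x
    unfolding u_def by (rule cINF_greatest[OF C(1)]) (use that in auto)
  show thesis
  proof (rule that[of u])
    show "sublinear u"
      unfolding sublinear_def
    proof (intro conjI allI impI)
      fix x y
      have *: "u (x + y) \<le> q x + r y" if qr: "q \<in> C" "r \<in> C" for q r
        using chain[OF qr]
      proof
        assume "q \<le> r"
        then show ?thesis
          using le[OF qr(1), of "x + y"] sublinear_add[OF C(2)[OF qr(1)], of x y] le_funD[of q r y]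
          by simp
      next
        assume "r \<le> q"
        then show ?thesis
          using le[OF qr(2), of "x + y"] sublinear_add[OF C(2)[OF qr(2)], of x y] le_funD[of r q x]
          by simp
      qed
      have "u (x + y) - r y \<le> u x" if "r \<in> C" for r
        by (rule ge) (use *[OF _ that] in \<open>simp add: algebra_simps\<close>)
      then have "u (x + y) - u x \<le> u y"
        by (intro ge) (simp add: algebra_simps)
      then show "u (x + y) \<le> u x + u y"
        by simp
    next
      fix r :: real and x
      assume r: "r > 0"
      have "u (r *\<^sub>R x) / r \<le> u x"
      proof (rule ge)
        fix q
        assume q: "q \<in> C"
        then show "u (r *\<^sub>R x) / r \<le> q x"
          using le[OF q, of "r *\<^sub>R x"] sublinear_scale[OF C(2)[OF q] r, of x] r
          by (simp add: field_simps)
      qed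
      then show "u (r *\<^sub>R x) \<le> r * u x"
        using r by (simp add: field_simps)
    qed
  qed (use le in auto)
qed

text \<open>Zorn's lemma is applied to sublinear functionals instead of partial extensions: no
  subspaces have to be carried along, and minimality alone will give linearity.\<close>

lemma minimal_sublinear:
  assumes "sublinear p"
  obtains q where "sublinear q" "\<And>x. q x \<le> p x"
    "\<And>r. sublinear r \<Longrightarrow> (\<And>x. r x \<le> q x) \<Longrightarrow> r = q"
proof -
  define A where "A = {q. sublinear q \<and> q \<le> p}"
  \<comment> \<open>The order is reversed, so that a maximal element for \<open>P\<close> is a
    minimal functional and chains are bounded by their infima.\<close>
  define P where "P = (\<lambda>q r :: 'a \<Rightarrow> real. r \<le> q)"
  have po: "partial_order_on A (relation_of P A)"
    by (auto simp: P_def partial_order_on_def preorder_on_def refl_on_def relation_of_def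
        trans_def antisym_def)
  have "\<exists>m\<in>A. \<forall>q\<in>A. P m q \<longrightarrow> q = m"
  proof (rule predicate_Zorn[OF po])
    fix C
    assume "C \<in> Chains (relation_of P A)"
    then have C: "\<And>q. q \<in> C \<Longrightarrow> q \<in> A" "\<And>q r. q \<in> C \<Longrightarrow> r \<in> C \<Longrightarrow> q \<le> r \<or> r \<le> q"
      by (auto simp: Chains_def relation_of_def P_def)
    show "\<exists>u\<in>A. \<forall>q\<in>C. P q u"
    proof (cases "C = {}")
      case True
      then show ?thesis
        using assms by (auto simp: A_def)
    next
      case False
      obtain u where u: "sublinear u" "\<And>q x. q \<in> C \<Longrightarrow> u x \<le> q x"
      proof (rule sublinear_Inf_chain[OF False, of p])
        show "sublinear q" "q x \<le> p x" if "q \<in> C" for q x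
          using C(1)[OF that] by (auto simp: A_def le_fun_def)
      qed (use C in auto)
      moreover obtain q where "q \<in> C"
        using False by blast
      ultimately have "u \<le> p"
        using C(1)[of q] by (auto simp: A_def le_fun_def intro: order_trans)
      then show ?thesis
        using u by (auto simp: A_def P_def le_fun_def)
    qed
  qed
  then obtain m where m: "m \<in> A" "\<And>q. q \<in> A \<Longrightarrow> P m q \<Longrightarrow> q = m"
    by blast
  show thesis
  proof (rule that[of m])
    show "r = m" if "sublinear r" "\<And>x. r x \<le> m x" for r
      using m(1) that by (intro m(2)) (auto simp: A_def P_def le_fun_def intro: order_trans)
  qed (use m(1) in \<open>auto simp: A_def le_fun_def\<close>)
qed

text \<open>The majorant is first lowered to p' with \<open>p' (- x0) \<le> - p x0\<close>; every
  linear l below p' then satisfies \<open>- l x0 \<le> - p x0\<close>, which is the hard half of the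
  equality. A minimal functional below p' is odd by \<open>sublinear_descent\<close>, hence
  linear.\<close>

lemma hahn_banach_point:
  assumes p: "sublinear p"
  obtains l where "linear l" "\<And>x. l x \<le> p x" "l x0 = p x0"
proof -
  obtain p' where p': "sublinear p'" "\<And>x. p' x \<le> p x" "p' (- x0) \<le> - p x0"
    using sublinear_descent[OF p, of x0] by metis
  obtain l where l: "sublinear l" "\<And>x. l x \<le> p' x"
    "\<And>r. sublinear r \<Longrightarrow> (\<And>x. r x \<le> l x) \<Longrightarrow> r = l"
    using minimal_sublinear[OF p'(1)] by metis
  have minus: "l (- y) = - l y" for y
  proof -
    obtain r where r: "sublinear r" "\<And>x. r x \<le> l x" "r (- y) \<le> - l y"
      using sublinear_descent[OF l(1), of y] by metis
    have "r = l"
      using l(3) r(1,2) by blast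
    then show ?thesis
      using r(3) sublinear_minus[OF l(1), of "- y"] by simp
  qed
  have "linear l"
  proof (rule linearI)
    show "l (x + y) = l x + l y" for x y
    proof (rule antisym)
      show "l x + l y \<le> l (x + y)"
        using sublinear_add[OF l(1), of "- x" "- y"] minus[of x] minus[of y] minus[of "x + y"] by simp
    qed (rule sublinear_add[OF l(1)])
    fix r :: real and x
    consider "r > 0" | "r = 0" | "r < 0" by linarith
    then show "l (r *\<^sub>R x) = r *\<^sub>R l x"
    proof cases
      case 3
      then show ?thesis
        using sublinear_scale[OF l(1), of "- r" x] minus[of "r *\<^sub>R x"] by simp
    qed (use sublinear_scale[OF l(1)] sublinear_zero[OF l(1)] in auto)
  qed
  moreover have "l x \<le> p x" for x
    using l(2) p'(2) by (meson order_trans)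
  moreover have "l x0 = p x0"
    using l(2)[of "- x0"] p'(3) minus[of x0] calculation(2)[of x0] by simp
  ultimately show thesis
    using that by blast
qed

section \<open>Complex scalars and bounded complex-linear maps\<close>

lemma scaleC_zero [simp]: "0 *\<^sub>C x = (0::'a::complex_normed_vector)" "a *\<^sub>C (0::'a) = 0"
  using norm_scaleC[of 0 x] norm_scaleC[of a "0::'a"] by auto

lemma scaleC_one [simp]: "1 *\<^sub>C x = (x::'a::complex_normed_vector)"
  using scaleR_scaleC[of 1 x] by simp

lemma scaleC_minus_left: "(- a) *\<^sub>C x = - (a *\<^sub>C (x::'a::complex_normed_vector))"
  using scaleC_add_left[of a "- a" x] by (simp add: eq_neg_iff_add_eq_0 add.commute)

lemma scaleC_minus_right: "a *\<^sub>C (- x) = - (a *\<^sub>C (x::'a::complex_normed_vector))"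
  using scaleC_add_right[of a x "- x"] by (simp add: eq_neg_iff_add_eq_0 add.commute)

lemma scaleC_diff_right: "a *\<^sub>C (x - y) = a *\<^sub>C x - a *\<^sub>C (y::'a::complex_normed_vector)"
  using scaleC_add_right[of a x "- y"] by (simp add: scaleC_minus_right)

lemma scaleC_diff_left: "(a - b) *\<^sub>C x = a *\<^sub>C x - b *\<^sub>C (x::'a::complex_normed_vector)"
  using scaleC_add_left[of a "- b" x] by (simp add: scaleC_minus_left)

lemma bounded_clinearI:
  assumes "\<And>x y. f (x + y) = f x + f y" "\<And>a x. f (a *\<^sub>C x) = a *\<^sub>C f x"
    and "\<And>x. norm (f x) \<le> norm x * K"
  shows "bounded_clinear f"
  unfolding bounded_clinear_def
proof (intro conjI allI)
  show "bounded_linear f"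
    by (rule bounded_linear_intro[of f K]) (simp_all add: assms scaleR_scaleC)
qed (rule assms)

lemma bounded_clinear_imp_bounded_linear: "bounded_clinear f \<Longrightarrow> bounded_linear f"
  by (simp add: bounded_clinear_def)

lemma bounded_clinear_scaleC: "bounded_clinear f \<Longrightarrow> f (a *\<^sub>C x) = a *\<^sub>C f x"
  by (simp add: bounded_clinear_def)

lemma bounded_clinear_add: "bounded_clinear f \<Longrightarrow> f (x + y) = f x + f y"
  by (simp add: bounded_clinear_def linear_add bounded_linear.linear)

lemma bounded_clinear_diff: "bounded_clinear f \<Longrightarrow> f (x - y) = f x - f y"
  by (simp add: bounded_clinear_def linear_diff bounded_linear.linear)

lemma bounded_clinear_zero: "bounded_clinear f \<Longrightarrow> f 0 = 0"
  using bounded_clinear_diff[of f 0 0] by simp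

lemma bounded_clinear_compose:
  assumes "bounded_clinear f" "bounded_clinear g"
  shows "bounded_clinear (\<lambda>x. f (g x))"
  using assms bounded_linear_compose unfolding bounded_clinear_def by auto

text \<open>Complexification of the real theorem by l(x) = u(x) - i u(i x). Rotating x until l x is
  real and nonnegative bounds its modulus by p; at x0 the real part already exhausts that bound, so
  the imaginary part vanishes.\<close>

lemma clinear_support:
  fixes x0 :: "'a::complex_normed_vector"
  assumes add: "\<And>x y. p (x + y) \<le> p x + p y" and scale: "\<And>a x. p (a *\<^sub>C x) = cmod a * p x"
    and le: "\<And>x. p x \<le> norm x"
  obtains l :: "'a \<Rightarrow> complex" where "bounded_clinear l" "\<And>x. cmod (l x) \<le> p x" "l x0 = p x0"
proof -
  have p: "sublinear p"
    using add scale by (simp add: sublinear_def scaleR_scaleC)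
  obtain u where u: "linear u" "\<And>x. u x \<le> p x" "u x0 = p x0"
    using hahn_banach_point[OF p, of x0] by metis
  define l where "l x = Complex (u x) (- u (\<i> *\<^sub>C x))" for x
  have l_add: "l (x + y) = l x + l y" for x y
    by (simp add: l_def linear_add[OF u(1)] scaleC_add_right complex_eq_iff)
  have u_real: "u (complex_of_real r *\<^sub>C x) = r * u x" for r x
    using linear_scale[OF u(1), of r x] by (simp add: scaleR_scaleC)
  have l_scale: "l (a *\<^sub>C x) = a * l x" for a x
  proof -
    have 1: "a *\<^sub>C x = complex_of_real (Re a) *\<^sub>C x + complex_of_real (Im a) *\<^sub>C (\<i> *\<^sub>C x)"
      unfolding scaleC_scaleC scaleC_add_left[symmetric]
      by (rule arg_cong[where f = "\<lambda>a. a *\<^sub>C x"]) (auto simp: complex_eq_iff)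
    have 2: "\<i> *\<^sub>C a *\<^sub>C x = complex_of_real (Re a) *\<^sub>C (\<i> *\<^sub>C x) + complex_of_real (- Im a) *\<^sub>C x"
      unfolding scaleC_scaleC scaleC_add_left[symmetric]
      by (rule arg_cong[where f = "\<lambda>a. a *\<^sub>C x"]) (auto simp: complex_eq_iff)
    show ?thesis
      unfolding l_def 2 unfolding 1 by (simp add: linear_add[OF u(1)] u_real complex_eq_iff
          del: of_real_minus)
  qed
  have bound: "cmod (l x) \<le> p x" for x
  proof -
    show ?thesis
    proof (cases "l x = 0")
      case True
      then show ?thesis
        using sublinear_add[OF p, of x "- x"] scale[of "-1" x] sublinear_zero[OF p]
        by (simp add: scaleC_minus_left)
    next
      case False
      define a where "a = cnj (l x) / cmod (l x)"
      have a: "cmod a = 1"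
        using False by (simp add: a_def norm_divide)
      have "a * l x = cmod (l x)"
        using False complex_norm_square[of "l x"]
        by (simp add: a_def power2_eq_square mult.commute nonzero_divide_eq_eq)
      then have "l (a *\<^sub>C x) = cmod (l x)"
        by (simp add: l_scale)
      then have "u (a *\<^sub>C x) = cmod (l x)"
        by (simp add: l_def complex_eq_iff)
      then show ?thesis
        using u(2)[of "a *\<^sub>C x"] by (simp add: scale a)
    qed
  qed
  have "l x0 = p x0"
  proof -
    have "0 \<le> p x0"
      using bound[of x0] by (meson norm_ge_zero order_trans)
    moreover have "Re (l x0) = p x0"
      by (simp add: l_def u(3))
    ultimately have "Im (l x0) = 0"
      using power_mono[OF bound[of x0], of 2] cmod_power2[of "l x0"] by simp
    with \<open>Re (l x0) = p x0\<close> show ?thesis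
      by (simp add: complex_eq_iff)
  qed
  moreover have "bounded_clinear l"
    by (rule bounded_clinearI[where K = 1])
      (use l_add l_scale order_trans[OF bound le] in \<open>auto simp: scaleC_complex_def\<close>)
  ultimately show thesis
    using that bound by blast
qed

lemma norming_functional:
  fixes x :: "'a::complex_normed_vector"
  obtains l :: "'a \<Rightarrow> complex"
  where "bounded_clinear l" "\<And>y. cmod (l y) \<le> norm y" "l x = norm x"
  using clinear_support[of norm x] norm_triangle_ineq norm_scaleC order_refl by metis

text \<open>The distance to Y is a seminorm because Y is a complex subspace, and it is positive at x
  because Y is closed. A functional that supports it at x vanishes on Y and not at x.\<close>

lemma separating_functional:
  fixes x :: "'a::complex_normed_vector"
  assumes Y: "closed Y" "0 \<in> Y" "\<And>y z. y \<in> Y \<Longrightarrow> z \<in> Y \<Longrightarrow> y + z \<in> Y"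
    "\<And>a y. y \<in> Y \<Longrightarrow> a *\<^sub>C y \<in> Y"
    and "x \<notin> Y"
  obtains l :: "'a \<Rightarrow> complex" where "bounded_clinear l" "\<And>y. y \<in> Y \<Longrightarrow> l y = 0" "l x \<noteq> 0"
proof -
  define p where "p x = infdist x Y" for x
  have Yne: "Y \<noteq> {}"
    using Y(2) by blast
  have le: "p z \<le> norm (z - y)" if "y \<in> Y" for y z
    using infdist_le[OF that] by (simp add: p_def dist_norm)
  have ge: "r \<le> p z" if "\<And>y. y \<in> Y \<Longrightarrow> r \<le> norm (z - y)" for r z
    unfolding p_def infdist_notempty[OF Yne]
    by (rule cINF_greatest[OF Yne]) (use that in \<open>simp add: dist_norm\<close>)
  have add: "p (y + z) \<le> p y + p z" for y z
  proof -
    have 1: "p (y + z) \<le> norm (y - a) + norm (z - b)" if "a \<in> Y" "b \<in> Y" for a b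
      using le[OF Y(3)[OF that], of "y + z"] norm_triangle_ineq[of "y - a" "z - b"]
      by (simp add: algebra_simps)
    have "p (y + z) - norm (z - b) \<le> p y" if "b \<in> Y" for b
      by (rule ge) (use 1[OF _ that] in \<open>simp add: algebra_simps\<close>)
    then have "p (y + z) - p y \<le> p z"
      by (intro ge) (simp add: algebra_simps)
    then show ?thesis
      by simp
  qed
  have scale_le: "p (a *\<^sub>C z) \<le> cmod a * p z" for a z
  proof (cases "a = 0")
    case True
    then show ?thesis
      using le[OF Y(2), of 0] by simp
  next
    case False
    have "p (a *\<^sub>C z) / cmod a \<le> p z"
    proof (rule ge)
      fix y
      assume "y \<in> Y"
      then show "p (a *\<^sub>C z) / cmod a \<le> norm (z - y)"
        using le[OF Y(4)[of y a], of "a *\<^sub>C z"] False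
        by (simp add: scaleC_diff_right[symmetric] norm_scaleC field_simps)
    qed
    then show ?thesis
      using False by (simp add: field_simps)
  qed
  have scale: "p (a *\<^sub>C z) = cmod a * p z" for a z
  proof (cases "a = 0")
    case True
    then show ?thesis
      using scale_le[of 0 z] infdist_nonneg[of 0 Y] by (simp add: p_def)
  next
    case False
    have "p ((1 / a) *\<^sub>C a *\<^sub>C z) \<le> cmod (1 / a) * p (a *\<^sub>C z)"
      by (rule scale_le)
    then have "cmod a * p z \<le> p (a *\<^sub>C z)"
      using False by (simp add: scaleC_scaleC norm_divide field_simps)
    then show ?thesis
      using scale_le[of a z] by simp
  qed
  have "p z \<le> norm z" for z
    using le[OF Y(2), of z] by simp
  then obtain l :: "'a \<Rightarrow> complex"
    where l: "bounded_clinear l" "\<And>z. cmod (l z) \<le> p z" "l x = p x"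
    using clinear_support[of p x, OF add scale] by blast
  show thesis
  proof (rule that[OF l(1)])
    show "l y = 0" if "y \<in> Y" for y
      using l(2)[of y] that by (simp add: p_def)
    show "l x \<noteq> 0"
      using l(3) \<open>x \<notin> Y\<close> in_closed_iff_infdist_zero[OF Y(1) Yne, of x] by (simp add: p_def)
  qed
qed

text \<open>Banach-Steinhaus. One of the closed sets \<open>F n\<close> contains a ball by Baire's
  theorem; a vector of length r is a difference of two of its points, which gives the factor 2 n /
  r.\<close>

theorem uniform_boundedness:
  fixes A :: "'i \<Rightarrow> 'a::banach \<Rightarrow> 'b::real_normed_vector"
  assumes lin: "\<And>i. i \<in> I \<Longrightarrow> bounded_linear (A i)"
    and bdd: "\<And>x. \<exists>C. \<forall>i\<in>I. norm (A i x) \<le> C"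
  obtains C where "C \<ge> 0" "\<And>i x. i \<in> I \<Longrightarrow> norm (A i x) \<le> C * norm x"
proof -
  define F where "F n = {x. \<forall>i\<in>I. norm (A i x) \<le> real n}" for n
  have closed: "closed (F n)" for n
  proof -
    have "F n = (\<Inter>i\<in>I. {x. norm (A i x) \<le> real n})"
      by (auto simp: F_def)
    moreover have "closed {x. norm (A i x) \<le> real n}" if "i \<in> I" for i
      using lin[OF that]
      by (intro closed_Collect_le continuous_on_norm linear_continuous_on continuous_on_const)
    ultimately show ?thesis
      by (auto intro: closed_INT)
  qed
  have "(\<Union>n. F n) = UNIV"
  proof -
    have "\<exists>n. x \<in> F n" for x
    proof -
      obtain C where C: "\<And>i. i \<in> I \<Longrightarrow> norm (A i x) \<le> C"
        using bdd[of x] by blast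
      obtain n where "C \<le> real n"
        using real_arch_simple by blast
      then have "x \<in> F n"
        unfolding F_def using order_trans[OF C] by blast
      then show ?thesis ..
    qed
    then show ?thesis
      by blast
  qed
  then have *: "euclidean interior_of \<Union> (range F) \<noteq> {}"
    by simp
  obtain n where "interior (F n) \<noteq> {}"
  proof (rule ccontr)
    assume "\<not> thesis"
    then have "interior (F n) = {}" for n
      using that by blast
    then have "euclidean interior_of \<Union> (range F) = {}"
      using closed by (intro Baire_category_alt) (auto simp: completely_metrizable_space_euclidean)
    with * show False ..
  qed
  then obtain x0 r where r: "r > 0" "cball x0 r \<subseteq> F n"
    by (metis all_not_in_conv mem_interior_cball)
  show thesis
  proof (rule that[of "2 * real n / r"])
    fix i x
    assume i: "i \<in> I"
    interpret bounded_linear "A i"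
      using lin[OF i] .
    show "norm (A i x) \<le> 2 * real n / r * norm x"
    proof (cases "x = 0")
      case False
      define y where "y = (r / norm x) *\<^sub>R x"
      have "x0 + y \<in> F n" "x0 \<in> F n"
        using r False by (auto simp: y_def subset_iff dist_norm)
      then have "norm (A i (x0 + y)) \<le> n" "norm (A i x0) \<le> n"
        using i by (auto simp: F_def)
      then have "norm (A i y) \<le> 2 * n"
        using norm_triangle_ineq4[of "A i (x0 + y)" "A i x0"] by (simp add: add)
      then show ?thesis
        using False r by (simp add: y_def scaleR field_simps)
    qed (simp add: zero)
  qed (use r in auto)
qed

section \<open>Separable subspaces and orbits of weakly continuous groups\<close>

lemma rational_complex_dense:
  fixes a :: complex
  assumes "e > 0"
  obtains r s :: rat where "cmod (a - Complex (of_rat r) (of_rat s)) < e"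
proof -
  obtain r where r: "Re a < of_rat r" "of_rat r < Re a + e / 2"
    using of_rat_dense[of "Re a" "Re a + e / 2"] assms by auto
  obtain s where s: "Im a < of_rat s" "of_rat s < Im a + e / 2"
    using of_rat_dense[of "Im a" "Im a + e / 2"] assms by auto
  have "cmod (a - Complex (of_rat r) (of_rat s))
      \<le> \<bar>Re (a - Complex (of_rat r) (of_rat s))\<bar> + \<bar>Im (a - Complex (of_rat r) (of_rat s))\<bar>"
    by (rule cmod_le)
  also have "\<dots> < e"
    using r s by simp
  finally show thesis
    by (rule that)
qed

text \<open>E consists of the finite combinations of the v q whose coefficients have rational real
  and imaginary parts: a countable set whose closure is nevertheless a complex subspace.
  Representing combinations by lists makes addition a concatenation.\<close>

lemma countable_span_closure:
  fixes v :: "'i \<Rightarrow> 'a::complex_normed_vector"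
  assumes Q: "countable Q"
  obtains E where "countable E" "\<And>q. q \<in> Q \<Longrightarrow> v q \<in> E" "0 \<in> closure E"
    "\<And>y z. y \<in> closure E \<Longrightarrow> z \<in> closure E \<Longrightarrow> y + z \<in> closure E"
    "\<And>a y. y \<in> closure E \<Longrightarrow> a *\<^sub>C y \<in> closure E"
proof -
  define R where "R = range (\<lambda>(r, s). Complex (of_rat r) (of_rat s))"
  define g where "g xs = (\<Sum>(a, q)\<leftarrow>xs. a *\<^sub>C v q)" for xs
  define E where "E = g ` lists (R \<times> Q)"
  have R_mult: "a * b \<in> R" if "a \<in> R" "b \<in> R" for a b
  proof -
    from that obtain r s r' s' where "a = Complex (of_rat r) (of_rat s)" "b = Complex (of_rat r') (of_rat s')"
      by (auto simp: R_def)
    then have "a * b = Complex (of_rat (r * r' - s * s')) (of_rat (r * s' + s * r'))"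
      by (simp add: complex_eq_iff of_rat_mult of_rat_diff of_rat_add)
    then show ?thesis
      by (auto simp: R_def)
  qed
  have "1 = Complex (of_rat 1) (of_rat 0)"
    by (simp add: complex_eq_iff)
  then have R_1: "1 \<in> R"
    unfolding R_def by (metis case_prod_conv rangeI)
  have g_append: "g (xs @ ys) = g xs + g ys" for xs ys
    by (simp add: g_def)
  have E_add: "y + z \<in> E" if "y \<in> E" "z \<in> E" for y z
  proof -
    obtain xs ys where "xs \<in> lists (R \<times> Q)" "ys \<in> lists (R \<times> Q)" "y = g xs" "z = g ys"
      using \<open>y \<in> E\<close> \<open>z \<in> E\<close> unfolding E_def by blast
    then have "xs @ ys \<in> lists (R \<times> Q)" "y + z = g (xs @ ys)"
      by (auto simp: g_append)
    then show ?thesis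
      unfolding E_def by blast
  qed
  have g_scale: "xs \<in> lists (R \<times> Q) \<Longrightarrow> b *\<^sub>C g xs = g (map (\<lambda>(a, q). (b * a, q)) xs)" for b xs
    by (induction xs) (auto simp: g_def scaleC_add_right scaleC_scaleC)
  have E_scale: "b *\<^sub>C y \<in> E" if "b \<in> R" "y \<in> E" for b y
  proof -
    obtain xs where xs: "xs \<in> lists (R \<times> Q)" "y = g xs"
      using \<open>y \<in> E\<close> unfolding E_def by blast
    then have "map (\<lambda>(a, q). (b * a, q)) xs \<in> lists (R \<times> Q)"
      using R_mult[OF \<open>b \<in> R\<close>] by (fastforce simp: in_lists_conv_set)
    then show ?thesis
      using g_scale[OF xs(1), of b] xs(2) unfolding E_def by auto
  qed
  show thesis
  proof (rule that[of E])
    show "countable E"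
      unfolding E_def R_def using Q by auto
    show "v q \<in> E" if "q \<in> Q" for q
    proof -
      have "[(1, q)] \<in> lists (R \<times> Q)" "g [(1, q)] = v q"
        using that R_1 by (auto simp: g_def)
      then show ?thesis
        unfolding E_def by (metis image_eqI)
    qed
    have "g [] \<in> E"
      unfolding E_def by blast
    then show "0 \<in> closure E"
      using closure_subset[of E] by (auto simp: g_def)
    show "y + z \<in> closure E" if yz: "y \<in> closure E" "z \<in> closure E" for y z
    proof -
      obtain f h where "\<And>n. f n \<in> E" "f \<longlonglongrightarrow> y" "\<And>n. h n \<in> E" "h \<longlonglongrightarrow> z"
        using yz unfolding closure_sequential by blast
      then show ?thesis
        unfolding closure_sequential
        by (intro exI[of _ "\<lambda>n. f n + h n"]) (auto intro!: E_add tendsto_add)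
    qed
    show "a *\<^sub>C y \<in> closure E" if y: "y \<in> closure E" for a y
      unfolding closure_approachable
    proof (intro allI impI)
      fix e :: real
      assume e: "e > 0"
      \<comment> \<open>Half of e is spent on replacing a by a coefficient with rational parts, half
        on replacing y by an element of E. The added 1 keeps the quotient defined for y = 0.\<close>
      define d where "d = e / (2 * (norm y + 1))"
      have d: "d > 0" "d * norm y < e / 2"
        using e by (auto simp: d_def field_simps add_pos_nonneg)
      obtain r s where b: "cmod (a - Complex (of_rat r) (of_rat s)) < d"
        using rational_complex_dense[OF d(1)] .
      define b where "b = Complex (of_rat r) (of_rat s)"
      have bR: "b \<in> R"
        by (auto simp: b_def R_def)
      have "e / (2 * (cmod b + 1)) > 0"
        using e by (simp add: add_nonneg_pos)
      then obtain z where z: "z \<in> E" "dist z y < e / (2 * (cmod b + 1))"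
        using y unfolding closure_approachable by blast
      have "dist (b *\<^sub>C z) (a *\<^sub>C y) = norm (b *\<^sub>C (z - y) - (a - b) *\<^sub>C y)"
        by (simp add: dist_norm scaleC_diff_left scaleC_diff_right)
      also have "\<dots> \<le> cmod b * dist z y + cmod (a - b) * norm y"
        by (metis norm_triangle_ineq4 norm_scaleC dist_norm)
      also have "cmod b * dist z y \<le> e / 2"
      proof -
        have "cmod b * dist z y \<le> (cmod b + 1) * dist z y"
          by (simp add: mult_right_mono)
        also have "\<dots> \<le> e / 2"
        proof -
          have pos: "2 * (cmod b + 1) > 0"
            by (simp add: add_nonneg_pos)
          have "dist z y * (2 * (cmod b + 1)) < e"
            using z(2) unfolding pos_less_divide_eq[OF pos] .
          then show ?thesis
            by (simp add: algebra_simps)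
        qed
        finally show ?thesis .
      qed
      also have "cmod (a - b) * norm y \<le> d * norm y"
        using b unfolding b_def by (intro mult_right_mono) auto
      finally have "dist (b *\<^sub>C z) (a *\<^sub>C y) < e"
        using d(2) by simp
      then show "\<exists>y'\<in>E. dist y' (a *\<^sub>C y) < e"
        using E_scale[OF bR z(1)] by blast
    qed
  qed
qed

text \<open>Baire's theorem yields small oscillation of the orbit near some point x0 only; the group
  law carries it to 0, and the uniform bound on the unit ball pays for
  \<open>V (- x0)\<close>.\<close>

theorem weakly_continuous_group_imp_continuous:
  fixes V :: "real ^ 'd \<Rightarrow> 'p::complex_banach \<Rightarrow> 'p"
  assumes lin: "\<And>x. bounded_clinear (V x)" and zero: "V 0 = id"
    and add: "\<And>x y f. V (x + y) f = V x (V y f)"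
    and K: "K \<ge> 0" and bound: "\<And>x f. norm x \<le> 1 \<Longrightarrow> norm (V x f) \<le> K * norm f"
    and weak: "\<And>l. bounded_clinear l \<Longrightarrow> continuous_on UNIV (\<lambda>x. l (V x f) :: complex)"
  shows "((\<lambda>x. V x f) \<longlongrightarrow> f) (at 0)"
proof -
  obtain Q :: "(real ^ 'd) set"
    where Q: "countable Q" "\<And>X. open X \<Longrightarrow> X \<noteq> {} \<Longrightarrow> \<exists>q\<in>Q. q \<in> X"
    using countable_dense_exists by blast
  obtain E where E: "countable E" "\<And>q. q \<in> Q \<Longrightarrow> V q f \<in> E" "0 \<in> closure E"
    "\<And>y z. y \<in> closure E \<Longrightarrow> z \<in> closure E \<Longrightarrow> y + z \<in> closure E"
    "\<And>a y. y \<in> closure E \<Longrightarrow> a *\<^sub>C y \<in> closure E"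
    using countable_span_closure[OF Q(1), of "\<lambda>q. V q f"] by metis
  have orbit: "V x f \<in> closure E" for x
  proof (rule ccontr)
    assume "V x f \<notin> closure E"
    then obtain l :: "'p \<Rightarrow> complex"
      where l: "bounded_clinear l" "\<And>y. y \<in> closure E \<Longrightarrow> l y = 0" "l (V x f) \<noteq> 0"
      using separating_functional[of "closure E" "V x f"] E(3-5) by auto
    \<comment> \<open>A functional that does not vanish at one orbit point does not vanish on an
      open set of parameters, and this set meets the dense set Q.\<close>
    have "open {y. l (V y f) \<noteq> 0}"
      by (rule open_Collect_neq[OF weak[OF l(1)]]) auto
    then obtain q where "q \<in> Q" "l (V q f) \<noteq> 0"
      using Q(2)[of "{y. l (V y f) \<noteq> 0}"] l(3) by blast
    then show False
      using l(2)[of "V q f"] E(2)[of q] closure_subset[of E] by blast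
  qed
  show ?thesis
    unfolding LIM_eq
  proof (intro allI impI)
    fix r :: real
    assume r: "r > 0"
    \<comment> \<open>Two orbit points belonging to one set \<open>G y\<close> differ by at most e +
      e, and the transport to 0 multiplies this by K.\<close>
    define e where "e = r / (\<bar>K\<bar> + 1) / 2"
    have e: "e > 0" "K * (e + e) < r"
    proof -
      show "e > 0"
        using r by (auto simp: e_def)
      then have "K * (e + e) \<le> \<bar>K\<bar> * (e + e)"
        by (intro mult_right_mono) auto
      also have "\<dots> < (\<bar>K\<bar> + 1) * (e + e)"
        using \<open>e > 0\<close> by (simp add: algebra_simps)
      also have "\<dots> = r"
        unfolding e_def by (simp add: add_nonneg_eq_0_iff field_simps)
      finally show "K * (e + e) < r" .
    qed
    define G where "G y = {x \<in> cball 0 1. norm (V x f - y) \<le> e}" for y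
    have closed: "closed (G y)" for y
    proof -
      have "G y = cball 0 1 \<inter> (\<Inter>l\<in>{l. bounded_clinear l \<and> (\<forall>z. cmod (l z) \<le> norm z)}.
          {x. cmod (l (V x f) - l y) \<le> e})" (is "_ = ?C")
      proof (intro equalityI subsetI)
        fix x
        assume "x \<in> G y"
        then show "x \<in> ?C"
          by (auto simp: G_def bounded_clinear_diff[symmetric] intro: order_trans)
      next
        fix x
        assume x: "x \<in> ?C"
        obtain l :: "'p \<Rightarrow> complex"
          where l: "bounded_clinear l" "\<And>z. cmod (l z) \<le> norm z" "l (V x f - y) = norm (V x f - y)"
          using norming_functional[of "V x f - y"] by metis
        then have "cmod (l (V x f - y)) \<le> e"
          using x by (auto simp: bounded_clinear_diff)
        then show "x \<in> G y"
          using x l(3) by (simp add: G_def)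
      qed
      moreover have "closed {x. cmod (l (V x f) - l y) \<le> e}" if "bounded_clinear l" for l
        using weak[OF that] by (intro closed_Collect_le continuous_intros)
      ultimately show ?thesis
        by (simp only:) (intro closed_Int closed_INT closed_cball ballI, simp)
    qed
    have "cball 0 1 \<subseteq> \<Union> (G ` E)"
    proof
      fix x :: "real ^ 'd"
      assume "x \<in> cball 0 1"
      moreover obtain y where "y \<in> E" "dist y (V x f) < e"
        using orbit[of x] e(1) unfolding closure_approachable by blast
      ultimately show "x \<in> \<Union> (G ` E)"
        by (auto simp: G_def dist_norm norm_minus_commute intro!: bexI[of _ y])
    qed
    then have "ball 0 1 \<subseteq> euclidean interior_of \<Union> (G ` E)"
      by (simp add: interior_maximal subset_trans[OF ball_subset_cball])
    then have *: "euclidean interior_of \<Union> (G ` E) \<noteq> {}"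
      by (metis all_not_in_conv centre_in_ball subset_empty zero_less_one)
    obtain y where y: "y \<in> E" "interior (G y) \<noteq> {}"
    proof (rule ccontr)
      assume "\<not> thesis"
      then have "interior (G y) = {}" if "y \<in> E" for y
        using that \<open>\<And>y. y \<in> E \<Longrightarrow> interior (G y) \<noteq> {} \<Longrightarrow> thesis\<close> by blast
      then have "euclidean interior_of \<Union> (G ` E) = {}"
        using closed E(1)
        by (intro Baire_category_alt) (auto simp: completely_metrizable_space_euclidean)
      with * show False ..
    qed
    then obtain x0 s where s: "s > 0" "ball x0 s \<subseteq> G y"
      by (metis all_not_in_conv mem_interior)
    have x0: "norm x0 \<le> 1" "norm (V x0 f - y) \<le> e"
      using s by (auto simp: G_def subset_iff)
    show "\<exists>s>0. \<forall>x. x \<noteq> 0 \<and> norm (x - 0) < s \<longrightarrow> norm (V x f - f) < r"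
    proof (intro exI[of _ s] conjI allI impI s(1))
      fix x :: "real ^ 'd"
      assume "x \<noteq> 0 \<and> norm (x - 0) < s"
      then have "x0 + x \<in> G y"
        using s by (auto simp: subset_iff dist_norm)
      then have "norm (V (x0 + x) f - y) \<le> e"
        by (simp add: G_def)
      then have "norm (V (x0 + x) f - V x0 f) \<le> e + e"
        using norm_triangle_ineq4[of "V (x0 + x) f - y" "V x0 f - y"] x0(2) by simp
      \<comment> \<open>\<open>V (- x0)\<close> carries the orbit points at x0 + x and x0 to those
        at x and 0; its norm is at most K because \<open>norm x0 \<le> 1\<close>.\<close>
      moreover have "V x f - f = V (- x0) (V (x0 + x) f - V x0 f)"
        using add[of "- x0" "x0 + x" f] add[of "- x0" x0 f] bounded_clinear_diff[OF lin] zero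
        by simp
      then have "norm (V x f - f) \<le> K * norm (V (x0 + x) f - V x0 f)"
        using bound[of "- x0"] x0(1) by simp
      ultimately show "norm (V x f - f) < r"
        using e(2) mult_left_mono[OF _ K] by (metis order_le_less_trans order_trans)
    qed
  qed
qed

section \<open>Integration on Cartesian space\<close>

text \<open>The 1-norm measures growth and decay because its exponentials factorise over the
  coordinates, which makes \<open>(2 / c) ^ CARD('d)\<close> an exact integral.\<close>

definition l1norm :: "real ^ 'd \<Rightarrow> real"
  where "l1norm x = (\<Sum>j\<in>UNIV. \<bar>x $ j\<bar>)"

lemma l1norm_nonneg [simp]: "0 \<le> l1norm x"
  by (simp add: l1norm_def sum_nonneg)

lemma norm_le_l1norm: "norm x \<le> l1norm x"
  by (simp add: l1norm_def norm_le_l1_cart)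

lemma l1norm_le_norm: "l1norm (x :: real ^ 'd) \<le> CARD('d) * norm x"
  unfolding l1norm_def by (rule sum_bounded_above) (simp add: component_le_norm_cart)

lemma continuous_on_l1norm [continuous_intros]:
  "continuous_on S f \<Longrightarrow> continuous_on S (\<lambda>x. l1norm (f x))"
  unfolding l1norm_def by (intro continuous_intros)

lemma l1norm_triangle: "l1norm (x + y) \<le> l1norm x + l1norm y"
  unfolding l1norm_def sum.distrib[symmetric] by (intro sum_mono) (simp add: abs_triangle_ineq)

section \<open>Integrals of products of coordinate functions\<close>

lemma Basis_cart: "(Basis :: (real ^ 'd) set) = (\<lambda>j. axis j 1) ` UNIV"
  by (auto simp: Basis_vec_def)

lemma inj_axis: "inj (\<lambda>j. axis j (1::real) :: real ^ 'd)"
  by (auto simp: inj_on_def axis_eq_axis)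

text \<open>Lebesgue measure on a Euclidean space is the image of a product measure indexed by
  \<open>Basis\<close>; the work lies in relabelling the basis vectors \<open>axis j 1\<close> by
  their indices j.\<close>

lemma prod_cart:
  fixes f :: "'d::finite \<Rightarrow> real \<Rightarrow> 'b::{real_normed_field,banach,second_countable_topology}"
  assumes f: "\<And>j. integrable lborel (f j)"
  shows integrable_prod_cart: "integrable lborel (\<lambda>x :: real ^ 'd. \<Prod>j\<in>UNIV. f j (x $ j))"
    and integral_prod_cart:
      "(\<integral>x. (\<Prod>j\<in>UNIV. f j (x $ j)) \<partial>(lborel :: (real ^ 'd) measure)) = (\<Prod>j\<in>UNIV. \<integral>x. f j x \<partial>lborel)"
proof -
  interpret product_sigma_finite "\<lambda>_ :: real ^ 'd. lborel :: real measure"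
    by standard
  define g where "g b = f (inv (\<lambda>j. axis j (1::real)) b)" for b :: "real ^ 'd"
  have g_axis: "g (axis j 1) = f j" for j
    by (simp add: g_def inv_f_f[OF inj_axis])
  have g: "integrable lborel (g b)" for b
    by (simp add: g_def f)
  have [measurable]: "f j \<in> borel_measurable borel" for j
    using borel_measurable_integrable[OF f, of j] by simp
  have eq: "(\<Prod>j\<in>UNIV. f j ((\<Sum>b\<in>Basis. y b *\<^sub>R b) $ j)) = (\<Prod>b\<in>Basis. g b (y b))"
    for y :: "real ^ 'd \<Rightarrow> real"
  proof -
    have "(\<Sum>b\<in>Basis. y b *\<^sub>R b) $ j = y (axis j 1)" for j
    proof -
      have "(\<Sum>b\<in>Basis. y b *\<^sub>R b) $ j = (\<Sum>b\<in>Basis. y b *\<^sub>R b) \<bullet> axis j 1"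
        by (simp add: cart_eq_inner_axis)
      also have "\<dots> = y (axis j 1)"
        by (subst inner_sum_left_Basis) (auto simp: Basis_vec_def)
      finally show ?thesis .
    qed
    then show ?thesis
      by (simp add: Basis_cart prod.reindex[OF inj_axis] g_axis)
  qed
  have "integrable (\<Pi>\<^sub>M b\<in>(Basis :: (real ^ 'd) set). lborel) (\<lambda>y. \<Prod>b\<in>Basis. g b (y b))"
    by (rule product_integrable_prod) (auto simp: g)
  then show "integrable lborel (\<lambda>x :: real ^ 'd. \<Prod>j\<in>UNIV. f j (x $ j))"
    by (subst lborel_eq, subst integrable_distr_eq) (simp_all add: eq del: sum_component)
  have "(\<integral>x. (\<Prod>j\<in>UNIV. f j (x $ j)) \<partial>(lborel :: (real ^ 'd) measure))
      = (\<integral>y. (\<Prod>b\<in>Basis. g b (y b)) \<partial>(\<Pi>\<^sub>M b\<in>(Basis :: (real ^ 'd) set). lborel))"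
    by (subst lborel_eq, subst integral_distr) (simp_all add: eq del: sum_component)
  also have "\<dots> = (\<Prod>b\<in>(Basis :: (real ^ 'd) set). \<integral>x. g b x \<partial>lborel)"
    by (rule product_integral_prod) (auto simp: g)
  also have "\<dots> = (\<Prod>j\<in>UNIV. \<integral>x. f j x \<partial>lborel)"
    by (simp add: Basis_cart prod.reindex[OF inj_axis] g_axis)
  finally show "(\<integral>x. (\<Prod>j\<in>UNIV. f j (x $ j)) \<partial>(lborel :: (real ^ 'd) measure))
      = (\<Prod>j\<in>UNIV. \<integral>x. f j x \<partial>lborel)" .
qed

lemma has_bochner_integral_exp_abs:
  fixes c :: real
  assumes c: "c > 0"
  shows "has_bochner_integral lborel (\<lambda>x. exp (- (c * \<bar>x\<bar>))) (2 / c)"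
proof -
  have "has_bochner_integral lborel (\<lambda>x::real. indicator {0..} x *\<^sub>R exp (- \<bar>x\<bar>)) 1"
  proof (rule has_bochner_integral_nn_integral)
    have "(\<integral>\<^sup>+x. ennreal (indicator {0..} x *\<^sub>R exp (- \<bar>x\<bar>)) \<partial>lborel)
        = (\<integral>\<^sup>+x. ennreal (x ^ 0 * exp (- x)) * indicator {0..} (x::real) \<partial>lborel)"
      by (intro nn_integral_cong) (auto simp: indicator_def)
    then show "(\<integral>\<^sup>+x. ennreal (indicator {0..} x *\<^sub>R exp (- \<bar>x\<bar>)) \<partial>lborel) = ennreal 1"
      using nn_intergal_power_times_exp_Ici[of 0] by simp
  qed auto
  then have "has_bochner_integral lborel (\<lambda>x::real. exp (- \<bar>x\<bar>)) 2"
    using has_bochner_integral_even_function[of "\<lambda>x::real. exp (- \<bar>x\<bar>)" 1] by simp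
  then have "has_bochner_integral lborel (\<lambda>x::real. exp (- \<bar>0 + c * x\<bar>)) (2 /\<^sub>R \<bar>c\<bar>)"
    using lborel_has_bochner_integral_real_affine_iff[of c "\<lambda>x. exp (- \<bar>x\<bar>)" 2 0] c by simp
  then show ?thesis
    using c by (simp add: abs_mult divide_inverse mult.commute)
qed

lemma exp_l1norm:
  assumes c: "c > 0"
  shows integrable_exp_l1norm: "integrable lborel (\<lambda>x :: real ^ 'd. exp (- (c * l1norm x)))"
    and integral_exp_l1norm:
      "(\<integral>x. exp (- (c * l1norm x)) \<partial>(lborel :: (real ^ 'd) measure)) = (2 / c) ^ CARD('d)"
proof -
  have *: "exp (- (c * l1norm x)) = (\<Prod>j\<in>UNIV. exp (- (c * \<bar>x $ j\<bar>)))" for x :: "real ^ 'd"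
    by (simp add: l1norm_def sum_distrib_left sum_negf[symmetric] exp_sum)
  show "integrable lborel (\<lambda>x :: real ^ 'd. exp (- (c * l1norm x)))"
    unfolding * using has_bochner_integral_exp_abs[OF c]
    by (intro integrable_prod_cart) (auto simp: has_bochner_integral_iff)
  show "(\<integral>x. exp (- (c * l1norm x)) \<partial>(lborel :: (real ^ 'd) measure)) = (2 / c) ^ CARD('d)"
    unfolding * using has_bochner_integral_exp_abs[OF c]
    by (subst integral_prod_cart) (auto simp: has_bochner_integral_iff)
qed

text \<open>If f is not measurable, neither is its translate; then both functions are non-integrable
  and both integrals are 0 by convention.\<close>

lemma
  fixes f :: "'a::euclidean_space \<Rightarrow> 'b::{banach,second_countable_topology}"
  shows integral_lborel_translation: "(\<integral>x. f (a + x) \<partial>lborel) = (\<integral>x. f x \<partial>lborel)"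
    and integrable_lborel_translation: "integrable lborel (\<lambda>x. f (a + x)) \<longleftrightarrow> integrable lborel f"
proof -
  have *: "f \<in> borel_measurable borel" if "(\<lambda>x. f (a + x)) \<in> borel_measurable borel"
  proof -
    have "(\<lambda>x. - a + x) \<in> borel_measurable borel"
      by (intro borel_measurable_continuous_onI continuous_intros)
    then have "(\<lambda>x. f (a + (- a + x))) \<in> borel_measurable borel"
      by (rule measurable_compose[OF _ that])
    then show ?thesis
      by (simp only: add_minus_cancel)
  qed
  have not_int: "\<not> integrable lborel f" "\<not> integrable lborel (\<lambda>x. f (a + x))"
    if "f \<notin> borel_measurable borel"
  proof -
    show "\<not> integrable lborel f"
      using that borel_measurable_integrable[of lborel f] by auto
    show "\<not> integrable lborel (\<lambda>x. f (a + x))"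
    proof
      assume "integrable lborel (\<lambda>x. f (a + x))"
      from borel_measurable_integrable[OF this]
      have "(\<lambda>x. f (a + x)) \<in> borel_measurable borel"
        by (simp only: measurable_lborel2)
      from *[OF this] that show False
        by contradiction
    qed
  qed
  show "integrable lborel (\<lambda>x. f (a + x)) \<longleftrightarrow> integrable lborel f"
  proof (cases "f \<in> borel_measurable borel")
    case True
    have "integrable (distr lborel borel ((+) a)) f \<longleftrightarrow> integrable lborel (\<lambda>x. f (a + x))"
      by (rule integrable_distr_eq) (simp_all add: True)
    then show ?thesis
      unfolding lborel_distr_plus ..
  qed (use not_int in blast)
  show "(\<integral>x. f (a + x) \<partial>lborel) = (\<integral>x. f x \<partial>lborel)"
  proof (cases "f \<in> borel_measurable borel")
    case True
    have "integral\<^sup>L (distr lborel borel ((+) a)) f = (\<integral>x. f (a + x) \<partial>lborel)"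
      by (rule integral_distr) (simp_all add: True)
    then show ?thesis
      unfolding lborel_distr_plus ..
  next
    case False
    then show ?thesis
      using not_int[OF False] by (simp add: not_integrable_integral_eq)
  qed
qed

lemma integral_lborel_scaling:
  fixes f :: "'a::euclidean_space \<Rightarrow> 'b::{banach,second_countable_topology}"
  assumes [measurable]: "f \<in> borel_measurable borel" and c: "c > 0"
  shows "(\<integral>x. f x \<partial>lborel) = c ^ DIM('a) *\<^sub>R (\<integral>x. f (c *\<^sub>R x) \<partial>lborel)"
proof -
  have "(\<integral>x. f x \<partial>lborel)
      = (\<integral>x. f x \<partial>density (distr lborel borel (\<lambda>x. 0 + c *\<^sub>R x)) (\<lambda>_. ennreal (\<bar>c\<bar> ^ DIM('a))))"
    using lborel_affine[of c "0::'a"] c by simp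
  also have "\<dots> = c ^ DIM('a) *\<^sub>R (\<integral>x. f (c *\<^sub>R x) \<partial>lborel)"
    using c by (simp add: integral_density integral_distr)
  finally show ?thesis .
qed

text \<open>A non-integrable f has integral 0, which the nonnegative g dominates as well; the
  estimate can thus precede any proof of integrability.\<close>

lemma norm_integral_le:
  fixes f :: "'x \<Rightarrow> 'b::{banach,second_countable_topology}"
  assumes g: "integrable M g" and le: "\<And>x. norm (f x) \<le> g x"
  shows "norm (\<integral>x. f x \<partial>M) \<le> (\<integral>x. g x \<partial>M)"
proof (cases "integrable M f")
  case True
  have "norm (\<integral>x. f x \<partial>M) \<le> (\<integral>x. norm (f x) \<partial>M)"
    by (rule integral_norm_bound)
  also have "\<dots> \<le> (\<integral>x. g x \<partial>M)"
    using True g le by (intro integral_mono) auto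
  finally show ?thesis .
next
  case False
  have "0 \<le> g x" for x
    using le[of x] norm_ge_zero order_trans by blast
  then show ?thesis
    using False by (simp add: not_integrable_integral_eq)
qed

text \<open>Holomorphy allows a domination of f alone: Cauchy's inequality on unit circles dominates
  the derivative by the same g, and the mean value inequality then dominates the difference
  quotients. The radius 2 leaves room for unit circles about all points at distance at most 1 from
  w0.\<close>

lemma has_field_derivative_integral:
  fixes f :: "complex \<Rightarrow> 'x \<Rightarrow> complex"
  assumes holo: "\<And>x. (\<lambda>w. f w x) holomorphic_on UNIV"
    and meas: "\<And>w. f w \<in> borel_measurable M"
    and bound: "\<And>w x. dist w w0 \<le> 2 \<Longrightarrow> cmod (f w x) \<le> g x"
    and g: "integrable M g"
  shows "((\<lambda>w. \<integral>x. f w x \<partial>M) has_field_derivative (\<integral>x. deriv (\<lambda>w. f w x) w0 \<partial>M)) (at w0)"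
proof -
  have int: "integrable M (f w)" if "dist w w0 \<le> 2" for w
    by (rule Bochner_Integration.integrable_bound[OF g meas], rule AE_I2)
      (use order_trans[OF bound[OF that] abs_ge_self] in simp)
  have deriv: "((\<lambda>w. f w x) has_field_derivative deriv (\<lambda>w. f w x) w) (at w)" for w x
    by (rule holomorphic_derivI[OF holo open_UNIV UNIV_I])
  have deriv_bound: "cmod (deriv (\<lambda>w. f w x) w) \<le> g x" if w: "dist w w0 \<le> 1" for w x
  proof -
    have "cmod ((deriv ^^ 1) (\<lambda>w. f w x) w) \<le> fact 1 * g x / 1 ^ 1"
    proof (rule Cauchy_inequality)
      show "(\<lambda>w. f w x) holomorphic_on ball w 1"
        by (rule holomorphic_on_subset[OF holo]) simp
      show "continuous_on (cball w 1) (\<lambda>w. f w x)"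
        by (rule continuous_on_subset[OF holomorphic_on_imp_continuous_on[OF holo]]) simp
      fix v
      assume "cmod (w - v) = 1"
      then show "cmod (f v x) \<le> g x"
        using w dist_triangle[of v w0 w] by (intro bound) (simp add: dist_norm norm_minus_commute)
    qed simp
    then show ?thesis
      by simp
  qed
  have lip: "cmod (f v x - f w0 x) \<le> g x * cmod (v - w0)" if "dist v w0 \<le> 1" for v x
  proof (rule field_differentiable_bound[OF convex_cball[of w0 1],
        of "\<lambda>w. f w x" "\<lambda>w. deriv (\<lambda>w. f w x) w"])
    show "((\<lambda>w. f w x) has_field_derivative deriv (\<lambda>w. f w x) w) (at w within cball w0 1)" for w
      by (rule has_field_derivative_at_within[OF deriv])
    show "cmod (deriv (\<lambda>w. f w x) w) \<le> g x" if "w \<in> cball w0 1" for w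
      using that by (intro deriv_bound) (simp add: dist_commute)
  qed (use that in \<open>auto simp: dist_commute\<close>)
  show ?thesis
    unfolding has_field_derivative_iff tendsto_at_iff_sequentially
  proof (intro allI impI)
    fix X :: "nat \<Rightarrow> complex"
    assume X: "\<forall>i. X i \<in> UNIV - {w0}" "X \<longlonglongrightarrow> w0"
    \<comment> \<open>From N on the sequence stays in the disc where \<open>lip\<close> applies; the
      shift is undone at the end by \<open>LIMSEQ_offset\<close>.\<close>
    obtain N where N: "\<And>n. n \<ge> N \<Longrightarrow> dist (X n) w0 < 1"
      using X(2) unfolding lim_sequentially by (metis zero_less_one)
    define q where "q n x = (f (X (n + N)) x - f w0 x) / (X (n + N) - w0)" for n x
    have ne: "X n \<noteq> w0" for n
      using X(1) by auto
    have lim: "(\<lambda>n. q n x) \<longlonglongrightarrow> deriv (\<lambda>w. f w x) w0" for x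
    proof -
      have "((\<lambda>w. (f w x - f w0 x) / (w - w0)) \<longlongrightarrow> deriv (\<lambda>w. f w x) w0) (at w0)"
        using deriv[of x w0] by (simp add: has_field_derivative_iff)
      moreover have "filterlim (\<lambda>n. X (n + N)) (at w0) sequentially"
        using LIMSEQ_ignore_initial_segment[OF X(2), of N] ne by (simp add: filterlim_at)
      ultimately show ?thesis
        unfolding q_def by (rule filterlim_compose)
    qed
    have q_meas: "q n \<in> borel_measurable M" for n
      unfolding q_def using meas by (intro borel_measurable_divide borel_measurable_diff) auto
    have "(\<lambda>n. \<integral>x. q n x \<partial>M) \<longlonglongrightarrow> (\<integral>x. deriv (\<lambda>w. f w x) w0 \<partial>M)"
    proof (rule integral_dominated_convergence[where w = g])
      show "(\<lambda>x. deriv (\<lambda>w. f w x) w0) \<in> borel_measurable M"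
        using q_meas lim by (rule borel_measurable_LIMSEQ_metric)
      show "AE x in M. norm (q n x) \<le> g x" for n
      proof (rule AE_I2)
        fix x
        show "norm (q n x) \<le> g x"
          using lip[of "X (n + N)" x] N[of "n + N"] ne[of "n + N"]
          by (simp add: q_def norm_divide divide_le_eq)
      qed
    qed (use g q_meas lim in auto)
    also have "(\<lambda>n. \<integral>x. q n x \<partial>M)
        = (\<lambda>n. ((\<integral>x. f (X (n + N)) x \<partial>M) - (\<integral>x. f w0 x \<partial>M)) / (X (n + N) - w0))"
    proof
      fix n
      have "dist (X (n + N)) w0 \<le> 2"
        using N[of "n + N"] by simp
      then show "(\<integral>x. q n x \<partial>M) = ((\<integral>x. f (X (n + N)) x \<partial>M) - (\<integral>x. f w0 x \<partial>M)) / (X (n + N) - w0)"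
        using int[of w0] int[of "X (n + N)"] unfolding q_def by simp
    qed
    finally show "((\<lambda>y. ((\<integral>x. f y x \<partial>M) - (\<integral>x. f w0 x \<partial>M)) / (y - w0)) \<circ> X)
        \<longlonglongrightarrow> (\<integral>x. deriv (\<lambda>w. f w x) w0 \<partial>M)"
      unfolding comp_def by (rule LIMSEQ_offset)
  qed
qed

text \<open>Separates the two requirements of Fubini's theorem: h provides the integrability on the
  product space, while the character or weight k is merely continuous and bounded.\<close>

lemma fubini_kernel:
  fixes h :: "'a::euclidean_space \<Rightarrow> 'b::euclidean_space \<Rightarrow> complex"
  assumes h: "integrable (lborel \<Otimes>\<^sub>M lborel) (\<lambda>(x, y). h x y)"
    and k: "continuous_on UNIV (\<lambda>(x, y). k x y)" and bound: "\<And>x y. cmod (k x y) \<le> C"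
  shows "(\<integral>x. (\<integral>y. h x y * k x y \<partial>lborel) \<partial>lborel) = (\<integral>y. (\<integral>x. h x y * k x y \<partial>lborel) \<partial>lborel)"
proof -
  have k': "(\<lambda>(x, y). k x y) \<in> borel_measurable (lborel \<Otimes>\<^sub>M lborel)"
    using borel_measurable_continuous_onI[OF k]
    by (subst measurable_cong_sets[OF sets_pair_measure_cong[OF sets_lborel sets_lborel] refl])
      (simp add: borel_prod)
  have "integrable (lborel \<Otimes>\<^sub>M lborel) (\<lambda>p. C *\<^sub>R norm (case p of (x, y) \<Rightarrow> h x y))"
    by (intro integrable_scaleR_right integrable_norm h)
  moreover have "(\<lambda>(x, y). h x y * k x y) \<in> borel_measurable (lborel \<Otimes>\<^sub>M lborel)"
    using borel_measurable_times[OF borel_measurable_integrable[OF h] k'] by (simp add: case_prod_beta')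
  ultimately have "integrable (lborel \<Otimes>\<^sub>M lborel) (\<lambda>(x, y). h x y * k x y)"
  proof (rule Bochner_Integration.integrable_bound, intro AE_I2)
    fix p :: "'a \<times> 'b"
    obtain x y where p: "p = (x, y)"
      by (cases p)
    have "cmod (h x y) * cmod (k x y) \<le> cmod (h x y) * C"
      by (rule mult_left_mono[OF bound]) simp
    then have "cmod (h x y * k x y) \<le> C * cmod (h x y)"
      by (simp add: norm_mult mult.commute)
    also have "\<dots> \<le> \<bar>C * cmod (h x y)\<bar>"
      by (rule abs_ge_self)
    finally show "norm (case p of (x, y) \<Rightarrow> h x y * k x y) \<le> norm (C *\<^sub>R norm (case p of (x, y) \<Rightarrow> h x y))"
      by (simp add: p)
  qed
  then show ?thesis
    by (rule lborel_pair.Fubini_integral[symmetric])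
qed

lemma fubini_product:
  fixes f :: "'a::euclidean_space \<Rightarrow> complex" and g :: "'b::euclidean_space \<Rightarrow> complex"
  assumes f: "integrable lborel f" and g: "integrable lborel g"
    and k: "continuous_on UNIV (\<lambda>(x, y). k x y)" "\<And>x y. cmod (k x y) \<le> C"
  shows "(\<integral>x. (\<integral>y. f x * g y * k x y \<partial>lborel) \<partial>lborel) = (\<integral>y. (\<integral>x. f x * g y * k x y \<partial>lborel) \<partial>lborel)"
proof (rule fubini_kernel[OF _ k])
  have [measurable]: "f \<in> borel_measurable borel" "g \<in> borel_measurable borel"
    using f g borel_measurable_integrable by auto
  show "integrable (lborel \<Otimes>\<^sub>M lborel) (\<lambda>(x, y). f x * g y)"
  proof (rule lborel_pair.Fubini_integrable)
    show "integrable lborel (\<lambda>x. \<integral>y. norm (case (x, y) of (x, y) \<Rightarrow> f x * g y) \<partial>lborel)"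
      using f by (simp add: norm_mult)
    show "AE x in lborel. integrable lborel (\<lambda>y. case (x, y) of (x, y) \<Rightarrow> f x * g y)"
      using g by simp
  qed measurable
qed

lemma fubini_convolution:
  fixes f g :: "'a::euclidean_space \<Rightarrow> complex"
  assumes f: "integrable lborel f" and g: "integrable lborel g"
    and k: "continuous_on UNIV (\<lambda>(x, y). k x y)" "\<And>x y. cmod (k x y) \<le> C"
  shows "(\<integral>x. (\<integral>y. f x * g (y - x) * k x y \<partial>lborel) \<partial>lborel)
    = (\<integral>y. (\<integral>x. f x * g (y - x) * k x y \<partial>lborel) \<partial>lborel)"
proof (rule fubini_kernel[OF _ k])
  have [measurable]: "f \<in> borel_measurable borel" "g \<in> borel_measurable borel"
    using f g borel_measurable_integrable by auto
  have shift: "integrable lborel (\<lambda>y. g (y - x))"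
    "(\<integral>y. cmod (g (y - x)) \<partial>lborel) = (\<integral>y. cmod (g y) \<partial>lborel)" for x
    using integrable_lborel_translation[of g "- x"] integral_lborel_translation[of "\<lambda>y. cmod (g y)" "- x"] g
    by simp_all
  show "integrable (lborel \<Otimes>\<^sub>M lborel) (\<lambda>(x, y). f x * g (y - x))"
  proof (rule lborel_pair.Fubini_integrable)
    show "integrable lborel (\<lambda>x. \<integral>y. norm (case (x, y) of (x, y) \<Rightarrow> f x * g (y - x)) \<partial>lborel)"
      using f by (simp add: norm_mult shift)
    show "AE x in lborel. integrable lborel (\<lambda>y. case (x, y) of (x, y) \<Rightarrow> f x * g (y - x))"
      using shift by simp
  qed measurable
qed

section \<open>Fourier inversion for entire multipliers\<close>

definition strip :: "real \<Rightarrow> (complex ^ 'd) set"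
  where "strip R = {z. \<forall>j. \<bar>Im (z $ j)\<bar> \<le> R}"

definition rl1 :: "complex ^ 'd \<Rightarrow> real"
  where "rl1 z = (\<Sum>j\<in>UNIV. \<bar>Re (z $ j)\<bar>)"

definition cvec :: "real ^ 'd \<Rightarrow> complex ^ 'd"
  where "cvec x = (\<chi> j. complex_of_real (x $ j))"

definition cpair :: "real ^ 'd \<Rightarrow> complex ^ 'd \<Rightarrow> complex"
  where "cpair x z = (\<Sum>j\<in>UNIV. complex_of_real (x $ j) * z $ j)"

text \<open>Holomorphy on every complex line is what the contour shift works with; together with
  continuity it amounts to holomorphy in d variables (Osgood's lemma).\<close>

definition line_holomorphic :: "(complex ^ 'd \<Rightarrow> complex) \<Rightarrow> bool"
  where "line_holomorphic F \<longleftrightarrow>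
    continuous_on UNIV F \<and> (\<forall>a b. (\<lambda>w. F (a + w *s b)) holomorphic_on UNIV)"

text \<open>The multipliers of the class \<open>admissible\<close>, with constants that may depend
  on the strip. Polynomials and the exponentials of \<open>cpair x\<close> belong to it.\<close>

definition tame :: "(complex ^ 'd \<Rightarrow> complex) \<Rightarrow> bool"
  where "tame F \<longleftrightarrow> line_holomorphic F \<and>
    (\<forall>R. \<exists>A c. \<forall>z\<in>strip R. cmod (F z) \<le> A * exp (c * rl1 z))"

text \<open>Decay at every exponential rate c, rather than at one, makes the class stable under all
  tame multipliers, in particular under the symbols of the operators U x and X_k.\<close>

definition admissible :: "(complex ^ 'd \<Rightarrow> complex) \<Rightarrow> bool"
  where "admissible F \<longleftrightarrow> line_holomorphic F \<and>
    (\<forall>R c. \<exists>A. \<forall>z\<in>strip R. cmod (F z) \<le> A * exp (- (c * rl1 z)))"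

definition fourier_inv :: "(complex ^ 'd \<Rightarrow> complex) \<Rightarrow> real ^ 'd \<Rightarrow> complex"
  where "fourier_inv F x = 1 / (2 * complex_of_real pi) ^ CARD('d) *
    (\<integral>\<xi>. exp (\<i> * complex_of_real (x \<bullet> \<xi>)) * F (cvec \<xi>) \<partial>lborel)"

lemma rl1_nonneg [simp]: "0 \<le> rl1 z"
  by (simp add: rl1_def sum_nonneg)

lemma rl1_cvec [simp]: "rl1 (cvec x) = l1norm x"
  by (simp add: rl1_def cvec_def l1norm_def)

lemma cvec_nth [simp]: "cvec x $ j = complex_of_real (x $ j)"
  by (simp add: cvec_def)

lemma cpair_cvec: "cpair x (cvec y) = complex_of_real (x \<bullet> y)"
  by (simp add: cpair_def inner_vec_def)

lemma continuous_on_cvec [continuous_intros]: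
  "continuous_on S f \<Longrightarrow> continuous_on S (\<lambda>x. cvec (f x))"
  unfolding cvec_def by (intro continuous_intros)

lemma rl1_le_add: "rl1 z \<le> rl1 (z + a) + rl1 a"
proof -
  have "\<bar>Re (z $ j)\<bar> \<le> \<bar>Re ((z + a) $ j)\<bar> + \<bar>Re (a $ j)\<bar>" for j
    by simp
  then show ?thesis
    unfolding rl1_def sum.distrib[symmetric] by (intro sum_mono)
qed

section \<open>Closure properties of holomorphic, tame and admissible functions\<close>

lemma line_holomorphic_const: "line_holomorphic (\<lambda>z. a)"
  by (simp add: line_holomorphic_def)

lemma line_holomorphic_nth: "line_holomorphic (\<lambda>z. z $ j)"
  unfolding line_holomorphic_def by (auto intro!: continuous_intros holomorphic_intros)

lemma line_holomorphic_add:
  "line_holomorphic F \<Longrightarrow> line_holomorphic G \<Longrightarrow> line_holomorphic (\<lambda>z. F z + G z)"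
  unfolding line_holomorphic_def by (auto intro!: continuous_intros holomorphic_intros)

lemma line_holomorphic_mult:
  "line_holomorphic F \<Longrightarrow> line_holomorphic G \<Longrightarrow> line_holomorphic (\<lambda>z. F z * G z)"
  unfolding line_holomorphic_def by (auto intro!: continuous_intros holomorphic_intros)

lemma line_holomorphic_exp: "line_holomorphic F \<Longrightarrow> line_holomorphic (\<lambda>z. exp (F z))"
  unfolding line_holomorphic_def by (auto intro!: continuous_intros holomorphic_intros)

lemma line_holomorphic_sum:
  "(\<And>i. i \<in> I \<Longrightarrow> line_holomorphic (F i)) \<Longrightarrow> line_holomorphic (\<lambda>z. \<Sum>i\<in>I. F i z)"
  by (induction I rule: infinite_finite_induct)
    (auto simp: line_holomorphic_const intro!: line_holomorphic_add)

lemma line_holomorphic_translate: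
  assumes "line_holomorphic F"
  shows "line_holomorphic (\<lambda>z. F (z + b))"
  unfolding line_holomorphic_def
proof (intro conjI allI)
  have F: "continuous_on UNIV F"
    using assms by (simp add: line_holomorphic_def)
  show "continuous_on UNIV (\<lambda>z. F (z + b))"
    by (rule continuous_on_compose2[OF F]) (intro continuous_intros, simp)
  fix a c
  have "(\<lambda>w. F ((a + b) + w *s c)) holomorphic_on UNIV"
    using assms unfolding line_holomorphic_def by blast
  then show "(\<lambda>w. F (a + w *s c + b)) holomorphic_on UNIV"
    by (simp add: add_ac)
qed

lemma tameI:
  assumes "line_holomorphic F" "\<And>R. \<exists>A c. \<forall>z\<in>strip R. cmod (F z) \<le> A * exp (c * rl1 z)"
  shows "tame F"
  using assms by (simp add: tame_def)

lemma tame_bound: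
  assumes "tame F"
  obtains A c where "A \<ge> 0" "c \<ge> 0" "\<And>z. z \<in> strip R \<Longrightarrow> cmod (F z) \<le> A * exp (c * rl1 z)"
proof -
  obtain A c where *: "\<And>z. z \<in> strip R \<Longrightarrow> cmod (F z) \<le> A * exp (c * rl1 z)"
    using assms unfolding tame_def by blast
  show thesis
  proof (rule that[of "\<bar>A\<bar>" "\<bar>c\<bar>"])
    fix z :: "complex ^ 'a"
    assume "z \<in> strip R"
    then have "cmod (F z) \<le> A * exp (c * rl1 z)"
      by (rule *)
    also have "\<dots> \<le> \<bar>A\<bar> * exp (\<bar>c\<bar> * rl1 z)"
      by (intro mult_mono) (auto intro!: mult_right_mono)
    finally show "cmod (F z) \<le> \<bar>A\<bar> * exp (\<bar>c\<bar> * rl1 z)" .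
  qed auto
qed

lemma admissible_bound:
  assumes "admissible F"
  obtains A where "A \<ge> 0" "\<And>z. z \<in> strip R \<Longrightarrow> cmod (F z) \<le> A * exp (- (c * rl1 z))"
proof -
  obtain A where *: "\<And>z. z \<in> strip R \<Longrightarrow> cmod (F z) \<le> A * exp (- (c * rl1 z))"
    using assms unfolding admissible_def by blast
  show thesis
  proof (rule that[of "\<bar>A\<bar>"])
    fix z :: "complex ^ 'a"
    assume "z \<in> strip R"
    then have "cmod (F z) \<le> A * exp (- (c * rl1 z))"
      by (rule *)
    also have "\<dots> \<le> \<bar>A\<bar> * exp (- (c * rl1 z))"
      by (intro mult_right_mono) auto
    finally show "cmod (F z) \<le> \<bar>A\<bar> * exp (- (c * rl1 z))" .
  qed auto
qed

lemma tame_const: "tame (\<lambda>z. a)"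
  by (rule tameI[OF line_holomorphic_const]) (intro exI[of _ "cmod a"] exI[of _ 0], simp)

lemma tame_nth: "tame (\<lambda>z. z $ j)"
proof (rule tameI[OF line_holomorphic_nth])
  fix R :: real
  have "cmod (z $ j) \<le> (1 + \<bar>R\<bar>) * exp (1 * rl1 z)" if "z \<in> strip R" for z :: "complex ^ 'a"
  proof -
    have "\<bar>Re (z $ j)\<bar> \<le> rl1 z"
      unfolding rl1_def by (rule member_le_sum) auto
    moreover have "\<bar>Im (z $ j)\<bar> \<le> \<bar>R\<bar>"
      using that unfolding strip_def by (auto intro: order_trans)
    ultimately have "cmod (z $ j) \<le> rl1 z + \<bar>R\<bar>"
      using cmod_le[of "z $ j"] by linarith
    also have "\<dots> \<le> (1 + rl1 z) + \<bar>R\<bar> * exp (rl1 z)"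
    proof -
      have "\<bar>R\<bar> * 1 \<le> \<bar>R\<bar> * exp (rl1 z)"
        by (intro mult_left_mono) auto
      then show ?thesis by simp
    qed
    also have "1 + rl1 z \<le> exp (rl1 z)"
      by (rule exp_ge_add_one_self)
    finally show ?thesis
      by (simp add: algebra_simps)
  qed
  then show "\<exists>A c. \<forall>z\<in>strip R. cmod (z $ j) \<le> A * exp (c * rl1 z)"
    by blast
qed

lemma tame_add:
  assumes "tame F" "tame G"
  shows "tame (\<lambda>z. F z + G z)"
proof (rule tameI)
  show "line_holomorphic (\<lambda>z. F z + G z)"
    using assms by (auto simp: tame_def intro: line_holomorphic_add)
  fix R :: real
  obtain A c where A: "A \<ge> 0" "c \<ge> 0" "\<And>z. z \<in> strip R \<Longrightarrow> cmod (F z) \<le> A * exp (c * rl1 z)"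
    using tame_bound[OF assms(1), of R] by metis
  obtain B e where B: "B \<ge> 0" "e \<ge> 0" "\<And>z. z \<in> strip R \<Longrightarrow> cmod (G z) \<le> B * exp (e * rl1 z)"
    using tame_bound[OF assms(2), of R] by metis
  have "cmod (F z + G z) \<le> (A + B) * exp ((c + e) * rl1 z)" if z: "z \<in> strip R" for z
  proof -
    have "cmod (F z + G z) \<le> A * exp (c * rl1 z) + B * exp (e * rl1 z)"
      using A(3)[OF z] B(3)[OF z] norm_triangle_ineq[of "F z" "G z"] by linarith
    also have "\<dots> \<le> A * exp ((c + e) * rl1 z) + B * exp ((c + e) * rl1 z)"
      using A(1,2) B(1,2) by (intro add_mono mult_left_mono) (auto intro: mult_right_mono)
    finally show ?thesis
      by (simp add: algebra_simps)
  qed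
  then show "\<exists>A c. \<forall>z\<in>strip R. cmod (F z + G z) \<le> A * exp (c * rl1 z)"
    by blast
qed

lemma tame_mult:
  assumes "tame F" "tame G"
  shows "tame (\<lambda>z. F z * G z)"
proof (rule tameI)
  show "line_holomorphic (\<lambda>z. F z * G z)"
    using assms by (auto simp: tame_def intro: line_holomorphic_mult)
  fix R :: real
  obtain A c where A: "A \<ge> 0" "c \<ge> 0" "\<And>z. z \<in> strip R \<Longrightarrow> cmod (F z) \<le> A * exp (c * rl1 z)"
    using tame_bound[OF assms(1), of R] by metis
  obtain B e where B: "B \<ge> 0" "e \<ge> 0" "\<And>z. z \<in> strip R \<Longrightarrow> cmod (G z) \<le> B * exp (e * rl1 z)"
    using tame_bound[OF assms(2), of R] by metis
  have "cmod (F z * G z) \<le> (A * B) * exp ((c + e) * rl1 z)" if z: "z \<in> strip R" for z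
  proof -
    have "cmod (F z * G z) \<le> (A * exp (c * rl1 z)) * (B * exp (e * rl1 z))"
      unfolding norm_mult using A B z by (intro mult_mono) auto
    then show ?thesis
      by (simp add: algebra_simps exp_add)
  qed
  then show "\<exists>A c. \<forall>z\<in>strip R. cmod (F z * G z) \<le> A * exp (c * rl1 z)"
    by blast
qed

lemma tame_sum: "(\<And>i. i \<in> I \<Longrightarrow> tame (F i)) \<Longrightarrow> tame (\<lambda>z. \<Sum>i\<in>I. F i z)"
  by (induction I rule: infinite_finite_induct) (auto simp: tame_const intro!: tame_add)

text \<open>With a = i this is the Fourier character, with a = -i the symbol of U x.\<close>

lemma tame_exp_cpair: "tame (\<lambda>z. exp (a * cpair x z))"
proof (rule tameI)
  show "line_holomorphic (\<lambda>z. exp (a * cpair x z))"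
    unfolding cpair_def
    by (intro line_holomorphic_exp line_holomorphic_mult line_holomorphic_sum line_holomorphic_const
        line_holomorphic_nth)
  fix R :: real
  define c where "c = cmod a * l1norm x"
  have "cmod (exp (a * cpair x z)) \<le> exp (c * (CARD('a) * \<bar>R\<bar>)) * exp (c * rl1 z)"
    if z: "z \<in> strip R" for z :: "complex ^ 'a"
  proof -
    have zj: "cmod (z $ j) \<le> rl1 z + CARD('a) * \<bar>R\<bar>" for j
    proof -
      have "\<bar>Re (z $ j)\<bar> \<le> rl1 z"
        unfolding rl1_def by (rule member_le_sum) auto
      moreover have "\<bar>Im (z $ j)\<bar> \<le> \<bar>R\<bar>"
        using that unfolding strip_def by (auto intro: order_trans)
      moreover have "1 * \<bar>R\<bar> \<le> CARD('a) * \<bar>R\<bar>"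
        by (intro mult_right_mono) (auto simp: Suc_le_eq)
      ultimately show ?thesis
        using cmod_le[of "z $ j"] by linarith
    qed
    have "cmod (cpair x z) \<le> (\<Sum>j\<in>UNIV. \<bar>x $ j\<bar> * (rl1 z + CARD('a) * \<bar>R\<bar>))"
      unfolding cpair_def by (rule sum_norm_le) (auto simp: norm_mult intro!: mult_left_mono zj)
    then have "cmod (cpair x z) \<le> l1norm x * (rl1 z + CARD('a) * \<bar>R\<bar>)"
      by (simp add: l1norm_def sum_distrib_right)
    then have "cmod a * cmod (cpair x z) \<le> c * (rl1 z + CARD('a) * \<bar>R\<bar>)"
      unfolding c_def by (simp add: mult.assoc mult_left_mono)
    moreover have "Re (a * cpair x z) \<le> cmod a * cmod (cpair x z)"
      by (metis complex_Re_le_cmod norm_mult)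
    ultimately show ?thesis
      by (simp add: exp_add[symmetric] algebra_simps)
  qed
  then show "\<exists>A c. \<forall>z\<in>strip R. cmod (exp (a * cpair x z)) \<le> A * exp (c * rl1 z)"
    by blast
qed

lemma admissible_mult:
  assumes "tame G" "admissible F"
  shows "admissible (\<lambda>z. G z * F z)"
  unfolding admissible_def
proof (intro conjI allI)
  show "line_holomorphic (\<lambda>z. G z * F z)"
    using assms by (auto simp: tame_def admissible_def intro: line_holomorphic_mult)
  fix R c :: real
  obtain B e where B: "B \<ge> 0" "e \<ge> 0" "\<And>z. z \<in> strip R \<Longrightarrow> cmod (G z) \<le> B * exp (e * rl1 z)"
    using tame_bound[OF assms(1), of R] by metis
  obtain A where A: "A \<ge> 0" "\<And>z. z \<in> strip R \<Longrightarrow> cmod (F z) \<le> A * exp (- ((c + e) * rl1 z))"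
    using admissible_bound[OF assms(2), of R "c + e"] by metis
  have "cmod (G z * F z) \<le> (B * A) * exp (- (c * rl1 z))" if z: "z \<in> strip R" for z
  proof -
    have "cmod (G z * F z) \<le> (B * exp (e * rl1 z)) * (A * exp (- ((c + e) * rl1 z)))"
      unfolding norm_mult using A B z by (intro mult_mono) auto
    also have "\<dots> = (B * A) * exp (e * rl1 z + - ((c + e) * rl1 z))"
      unfolding exp_add by (simp add: mult_ac)
    finally show ?thesis
      by (simp add: algebra_simps)
  qed
  then show "\<exists>A. \<forall>z\<in>strip R. cmod (G z * F z) \<le> A * exp (- (c * rl1 z))"
    by blast
qed

lemma admissible_imp_tame: "admissible F \<Longrightarrow> tame F"
  unfolding admissible_def tame_def
  by (metis minus_mult_left)

lemma admissible_add:
  assumes "admissible F" "admissible G"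
  shows "admissible (\<lambda>z. F z + G z)"
  unfolding admissible_def
proof (intro conjI allI)
  show "line_holomorphic (\<lambda>z. F z + G z)"
    using assms by (auto simp: admissible_def intro: line_holomorphic_add)
  fix R c :: real
  obtain A where A: "\<And>z. z \<in> strip R \<Longrightarrow> cmod (F z) \<le> A * exp (- (c * rl1 z))"
    using admissible_bound[OF assms(1), of R c] by metis
  obtain B where B: "\<And>z. z \<in> strip R \<Longrightarrow> cmod (G z) \<le> B * exp (- (c * rl1 z))"
    using admissible_bound[OF assms(2), of R c] by metis
  have "cmod (F z + G z) \<le> (A + B) * exp (- (c * rl1 z))" if z: "z \<in> strip R" for z
    using A[OF z] B[OF z] norm_triangle_ineq[of "F z" "G z"] unfolding distrib_right by linarith
  then show "\<exists>A. \<forall>z\<in>strip R. cmod (F z + G z) \<le> A * exp (- (c * rl1 z))"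
    by blast
qed

lemma admissible_cmult: "admissible F \<Longrightarrow> admissible (\<lambda>z. a * F z)"
  by (rule admissible_mult[OF tame_const])

lemma admissible_uminus: "admissible F \<Longrightarrow> admissible (\<lambda>z. - F z)"
  using admissible_cmult[of F "-1"] by simp

lemma admissible_diff: "admissible F \<Longrightarrow> admissible G \<Longrightarrow> admissible (\<lambda>z. F z - G z)"
  using admissible_add[of F "\<lambda>z. - G z"] admissible_uminus[of G] by simp

lemma admissible_zero: "admissible (\<lambda>z. 0)"
  unfolding admissible_def by (intro conjI allI exI[of _ 0] line_holomorphic_const) simp

lemma admissible_sum:
  "(\<And>i. i \<in> I \<Longrightarrow> admissible (F i)) \<Longrightarrow> admissible (\<lambda>z. \<Sum>i\<in>I. F i z)"
  by (induction I rule: infinite_finite_induct) (auto simp: admissible_zero intro!: admissible_add)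

lemma admissible_translate:
  assumes "admissible F"
  shows "admissible (\<lambda>z. F (z + cvec x))"
  unfolding admissible_def
proof (intro conjI allI)
  show "line_holomorphic (\<lambda>z. F (z + cvec x))"
    using assms by (auto simp: admissible_def intro: line_holomorphic_translate)
  fix R c :: real
  obtain A where A: "A \<ge> 0" "\<And>z. z \<in> strip R \<Longrightarrow> cmod (F z) \<le> A * exp (- (\<bar>c\<bar> * rl1 z))"
    using admissible_bound[OF assms, of R "\<bar>c\<bar>"] by metis
  have "cmod (F (z + cvec x)) \<le> (A * exp (\<bar>c\<bar> * l1norm x)) * exp (- (c * rl1 z))" if z: "z \<in> strip R" for z
  proof -
    have "c * rl1 z \<le> \<bar>c\<bar> * rl1 z"
      by (rule mult_right_mono) auto
    also have "\<dots> \<le> \<bar>c\<bar> * (rl1 (z + cvec x) + l1norm x)"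
      using rl1_le_add[of z "cvec x"] by (intro mult_left_mono) auto
    finally have "- (\<bar>c\<bar> * rl1 (z + cvec x)) \<le> \<bar>c\<bar> * l1norm x + - (c * rl1 z)"
      by (simp add: algebra_simps)
    then have "A * exp (- (\<bar>c\<bar> * rl1 (z + cvec x))) \<le> A * exp (\<bar>c\<bar> * l1norm x + - (c * rl1 z))"
      using A(1) by (intro mult_left_mono) auto
    moreover have "z + cvec x \<in> strip R"
      using z by (simp add: strip_def)
    ultimately show ?thesis
      using A(2)[of "z + cvec x"] unfolding exp_add by simp
  qed
  then show "\<exists>A. \<forall>z\<in>strip R. cmod (F (z + cvec x)) \<le> A * exp (- (c * rl1 z))"
    by blast
qed

lemma continuous_admissible: "admissible F \<Longrightarrow> continuous_on UNIV F"
  by (simp add: admissible_def line_holomorphic_def)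

lemma admissible_cvec:
  assumes "admissible F"
  shows continuous_admissible_cvec: "continuous_on UNIV (\<lambda>\<xi>. F (cvec \<xi>))"
    and integrable_admissible_cvec: "integrable lborel (\<lambda>\<xi>. F (cvec \<xi>))"
proof -
  show 1: "continuous_on UNIV (\<lambda>\<xi>. F (cvec \<xi>))"
    by (rule continuous_on_compose2[OF continuous_admissible[OF assms]]) (intro continuous_intros, simp)
  obtain A where A: "A \<ge> 0" "\<And>z. z \<in> strip 0 \<Longrightarrow> cmod (F z) \<le> A * exp (- (1 * rl1 z))"
    using admissible_bound[OF assms, of 0 1] by metis
  show "integrable lborel (\<lambda>\<xi>. F (cvec \<xi>))"
  proof (rule Bochner_Integration.integrable_bound)
    show "integrable lborel (\<lambda>\<xi>. A * exp (- (1 * l1norm \<xi>)))"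
      by (intro integrable_mult_right integrable_exp_l1norm) simp
    show "(\<lambda>\<xi>. F (cvec \<xi>)) \<in> borel_measurable lborel"
      using borel_measurable_continuous_onI[OF 1] by simp
    show "AE \<xi> in lborel. norm (F (cvec \<xi>)) \<le> norm (A * exp (- (1 * l1norm \<xi>)))"
      using A(1) A(2)[of "cvec _"] by (intro AE_I2) (simp add: strip_def)
  qed
qed

text \<open>
  \<open>w \<mapsto> \<integral> F (\<xi> + w \<eta>) d\<xi>\<close> is holomorphic, and translation invariance makes it periodic under all
  real shifts; hence it is constant, and the contour may be moved from \<open>w = 0\<close> to \<open>w = \<i>\<close>.
\<close>

lemma contour_shift:
  assumes F: "admissible F"
  shows "(\<integral>\<xi>. F (cvec \<xi> + w *s cvec \<eta>) \<partial>lborel) = (\<integral>\<xi>. F (cvec \<xi>) \<partial>lborel)"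
proof -
  define G where "G w = (\<integral>\<xi>. F (cvec \<xi> + w *s cvec \<eta>) \<partial>lborel)" for w
  have "(G has_field_derivative 0) (at w0)" for w0
  proof -
    \<comment> \<open>A common bound, for all w in the disc of radius 2 about w0, of the imaginary
      parts of w \<eta> and of its displacement in the real direction.\<close>
    define R where "R = (cmod w0 + 2) * l1norm \<eta>"
    obtain A where A: "A \<ge> 0" "\<And>z. z \<in> strip R \<Longrightarrow> cmod (F z) \<le> A * exp (- (1 * rl1 z))"
      using admissible_bound[OF F, of R 1] by metis
    define g where "g \<xi> = A * exp R * exp (- (1 * l1norm \<xi>))" for \<xi> :: "real ^ 'a"
    have eta: "\<bar>\<eta> $ j\<bar> \<le> l1norm \<eta>" for j
      unfolding l1norm_def by (rule member_le_sum) auto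
    have bound: "cmod (F (cvec \<xi> + w *s cvec \<eta>)) \<le> g \<xi>" if w: "dist w w0 \<le> 2" for w \<xi>
    proof -
      have w': "cmod w \<le> cmod w0 + 2"
        using w norm_triangle_sub[of w w0] by (simp add: dist_norm)
      have "\<bar>Im w\<bar> * \<bar>\<eta> $ j\<bar> \<le> R" for j
        unfolding R_def using w' abs_Im_le_cmod[of w] by (intro mult_mono eta) auto
      then have "cvec \<xi> + w *s cvec \<eta> \<in> strip R"
        by (simp add: strip_def abs_mult)
      then have "cmod (F (cvec \<xi> + w *s cvec \<eta>)) \<le> A * exp (- (1 * rl1 (cvec \<xi> + w *s cvec \<eta>)))"
        by (rule A)
      also have "\<dots> \<le> A * exp (R + - (1 * l1norm \<xi>))"
      proof -
        have "rl1 (w *s cvec \<eta>) = \<bar>Re w\<bar> * l1norm \<eta>"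
          by (simp add: rl1_def l1norm_def abs_mult sum_distrib_left)
        also have "\<dots> \<le> R"
          unfolding R_def using w' abs_Re_le_cmod[of w] by (intro mult_right_mono) auto
        finally have "l1norm \<xi> \<le> rl1 (cvec \<xi> + w *s cvec \<eta>) + R"
          using rl1_le_add[of "cvec \<xi>" "w *s cvec \<eta>"] by simp
        then show ?thesis
          using A(1) by (intro mult_left_mono) auto
      qed
      finally show ?thesis
        unfolding g_def exp_add by (simp add: mult_ac)
    qed
    have meas: "(\<lambda>\<xi>. F (cvec \<xi> + w *s cvec \<eta>)) \<in> borel_measurable lborel" for w
    proof -
      have "continuous_on UNIV (\<lambda>\<xi>. F (cvec \<xi> + w *s cvec \<eta>))"
        unfolding vector_scalar_mult_def
        by (rule continuous_on_compose2[OF continuous_admissible[OF F]]) (intro continuous_intros, simp)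
      then show ?thesis
        using borel_measurable_continuous_onI by simp
    qed
    have holo: "(\<lambda>w. F (cvec \<xi> + w *s cvec \<eta>)) holomorphic_on UNIV" for \<xi>
      using F by (auto simp: admissible_def line_holomorphic_def)
    have "integrable lborel g"
      unfolding g_def by (intro integrable_mult_right integrable_exp_l1norm) simp
    from has_field_derivative_integral[where f = "\<lambda>w \<xi>. F (cvec \<xi> + w *s cvec \<eta>)", OF holo meas bound this]
    obtain D where D: "(G has_field_derivative D) (at w0)"
      unfolding G_def by blast
    have periodic: "G (w0 + complex_of_real r) = G w0" for r
    proof -
      have eq: "cvec \<xi> + (w0 + complex_of_real r) *s cvec \<eta> = cvec (r *\<^sub>R \<eta> + \<xi>) + w0 *s cvec \<eta>" for \<xi>
        by (simp add: vec_eq_iff algebra_simps)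
      show ?thesis
        unfolding G_def eq
        by (rule integral_lborel_translation[of "\<lambda>\<xi>. F (cvec \<xi> + w0 *s cvec \<eta>)" "r *\<^sub>R \<eta>"])
    qed
    define X where "X n = w0 + complex_of_real (inverse (real (Suc n)))" for n
    have "X \<longlonglongrightarrow> w0 + complex_of_real 0"
      unfolding X_def by (intro tendsto_intros LIMSEQ_inverse_real_of_nat)
    then have X: "X \<longlonglongrightarrow> w0"
      by simp
    have "inverse (complex_of_nat (Suc n)) \<noteq> 0" for n
      by (simp del: of_nat_Suc)
    then have ne: "\<forall>n. X n \<in> UNIV - {w0}"
      by (simp add: X_def del: of_nat_Suc)
    have "(\<lambda>n. (G (X n) - G w0) / (X n - w0)) \<longlonglongrightarrow> D"
      using D[unfolded has_field_derivative_iff tendsto_at_iff_sequentially comp_def,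
          rule_format, OF ne[rule_format] X] .
    moreover have "(\<lambda>n. (G (X n) - G w0) / (X n - w0)) = (\<lambda>n. 0)"
      unfolding X_def periodic by simp
    ultimately have "D = 0"
      using LIMSEQ_unique tendsto_const by metis
    with D show ?thesis
      by simp
  qed
  then obtain k where "\<And>w. G w = k"
    using has_field_derivative_zero_constant[of UNIV G] by auto
  then have "G w = G 0"
    by simp
  then show ?thesis
    by (simp add: G_def)
qed

text \<open>Each coordinate is shifted by R in the direction of the sign of x_j, so that the
  character contributes exactly exp(- R l1norm x). The remaining integral gives the constant (2
  pi)^(-d) (2 / c)^d.\<close>

lemma fourier_inv_bound:
  fixes F :: "complex ^ 'd \<Rightarrow> complex"
  assumes F: "admissible F" and c: "c > 0" and R: "R \<ge> 0"
    and A: "\<And>z. z \<in> strip R \<Longrightarrow> cmod (F z) \<le> A * exp (- (c * rl1 z))"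
  shows "cmod (fourier_inv F x) \<le> A / (pi * c) ^ CARD('d) * exp (- (R * l1norm x))"
proof -
  define \<eta> :: "real ^ 'd" where "\<eta> = (\<chi> j. R * sgn (x $ j))"
  define F' where "F' z = exp (\<i> * cpair x z) * F z" for z
  have F': "admissible F'"
    unfolding F'_def by (intro admissible_mult tame_exp_cpair F)
  have "(\<integral>\<xi>. exp (\<i> * complex_of_real (x \<bullet> \<xi>)) * F (cvec \<xi>) \<partial>lborel) = (\<integral>\<xi>. F' (cvec \<xi>) \<partial>lborel)"
    by (simp add: F'_def cpair_cvec)
  also have "\<dots> = (\<integral>\<xi>. F' (cvec \<xi> + \<i> *s cvec \<eta>) \<partial>lborel)"
    by (rule contour_shift[OF F', symmetric])
  finally have eq: "(\<integral>\<xi>. exp (\<i> * complex_of_real (x \<bullet> \<xi>)) * F (cvec \<xi>) \<partial>lborel)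
      = (\<integral>\<xi>. F' (cvec \<xi> + \<i> *s cvec \<eta>) \<partial>lborel)" .
  have bound: "cmod (F' (cvec \<xi> + \<i> *s cvec \<eta>)) \<le> A * exp (- (R * l1norm x)) * exp (- (c * l1norm \<xi>))"
    for \<xi> :: "real ^ 'd"
  proof -
    have "cpair x (cvec \<xi> + \<i> *s cvec \<eta>) = complex_of_real (x \<bullet> \<xi>) + \<i> * complex_of_real (R * l1norm x)"
      by (simp add: cpair_def inner_vec_def l1norm_def \<eta>_def algebra_simps sum.distrib
          sum_distrib_left abs_sgn)
    then have "cmod (exp (\<i> * cpair x (cvec \<xi> + \<i> *s cvec \<eta>))) = exp (- (R * l1norm x))"
      by simp
    moreover have "\<bar>R * sgn a\<bar> \<le> R" for a :: real
      using R by (simp add: abs_mult sgn_if)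
    then have "cvec \<xi> + \<i> *s cvec \<eta> \<in> strip R"
      by (simp add: strip_def \<eta>_def)
    moreover have "rl1 (cvec \<xi> + \<i> *s cvec \<eta>) = l1norm \<xi>"
      by (simp add: rl1_def l1norm_def)
    ultimately show ?thesis
      using A[of "cvec \<xi> + \<i> *s cvec \<eta>"] by (simp add: F'_def norm_mult mult_ac)
  qed
  have "cmod (\<integral>\<xi>. F' (cvec \<xi> + \<i> *s cvec \<eta>) \<partial>lborel)
      \<le> (\<integral>\<xi>. A * exp (- (R * l1norm x)) * exp (- (c * l1norm \<xi>)) \<partial>(lborel :: (real ^ 'd) measure))"
    by (intro norm_integral_le bound integrable_mult_right integrable_exp_l1norm c)
  also have "\<dots> = A * exp (- (R * l1norm x)) * (2 / c) ^ CARD('d)"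
    by (simp add: integral_exp_l1norm[OF c])
  finally have "cmod (fourier_inv F x) \<le> 1 / (2 * pi) ^ CARD('d) * (A * exp (- (R * l1norm x)) * (2 / c) ^ CARD('d))"
    unfolding fourier_inv_def eq norm_mult
    by (intro mult_mono) (auto simp: norm_divide norm_power norm_mult)
  also have "\<dots> = A / (pi * c) ^ CARD('d) * exp (- (R * l1norm x))"
    using c by (simp add: power_mult_distrib power_divide field_simps)
  finally show ?thesis .
qed

lemma continuous_fourier_inv:
  assumes F: "admissible F"
  shows "continuous_on UNIV (fourier_inv F)"
proof -
  define k where "k x \<xi> = exp (\<i> * complex_of_real (x \<bullet> \<xi>)) * F (cvec \<xi>)" for x \<xi>
  have "continuous_on UNIV (\<lambda>x. \<integral>\<xi>. k x \<xi> \<partial>lborel)"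
  proof (rule continuous_on_sequentiallyI)
    fix u :: "nat \<Rightarrow> real ^ 'a" and a
    assume u: "u \<longlonglongrightarrow> a"
    have meas: "k x \<in> borel_measurable lborel" for x
    proof -
      have "continuous_on UNIV (k x)"
        unfolding k_def by (intro continuous_intros continuous_admissible_cvec F)
      then show ?thesis
        using borel_measurable_continuous_onI by simp
    qed
    show "(\<lambda>n. \<integral>\<xi>. k (u n) \<xi> \<partial>lborel) \<longlonglongrightarrow> (\<integral>\<xi>. k a \<xi> \<partial>lborel)"
    proof (rule integral_dominated_convergence[where w = "\<lambda>\<xi>. cmod (F (cvec \<xi>))"])
      show "AE \<xi> in lborel. (\<lambda>n. k (u n) \<xi>) \<longlonglongrightarrow> k a \<xi>"
        unfolding k_def by (intro AE_I2 tendsto_intros u)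
      show "AE \<xi> in lborel. norm (k (u n) \<xi>) \<le> cmod (F (cvec \<xi>))" for n
        by (intro AE_I2) (simp add: k_def norm_mult)
    qed (intro meas integrable_norm integrable_admissible_cvec F)+
  qed
  then show ?thesis
    unfolding fourier_inv_def[abs_def] k_def by (intro continuous_intros)
qed

text \<open>R - w is the decay that survives the weight. Both factors of the bound are kept explicit
  because c and R - w will scale with opposite powers of t.\<close>

lemma fourier_inv_weighted:
  fixes F :: "complex ^ 'd \<Rightarrow> complex"
  assumes F: "admissible F" and c: "c > 0" and R: "R \<ge> 0" "R > w"
    and A: "\<And>z. z \<in> strip R \<Longrightarrow> cmod (F z) \<le> A * exp (- (c * rl1 z))"
  shows integrable_fourier_inv_weighted':
      "integrable lborel (\<lambda>x. cmod (fourier_inv F x) * exp (w * l1norm x))"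
    and integral_fourier_inv_weighted:
      "(\<integral>x. cmod (fourier_inv F x) * exp (w * l1norm x) \<partial>lborel)
        \<le> A / (pi * c) ^ CARD('d) * (2 / (R - w)) ^ CARD('d)"
proof -
  define B where "B = A / (pi * c) ^ CARD('d)"
  have bound: "cmod (fourier_inv F x) * exp (w * l1norm x) \<le> B * exp (- ((R - w) * l1norm x))" for x
  proof -
    have "cmod (fourier_inv F x) * exp (w * l1norm x) \<le> (B * exp (- (R * l1norm x))) * exp (w * l1norm x)"
      unfolding B_def by (intro mult_right_mono fourier_inv_bound F c R A) auto
    also have "\<dots> = B * exp (- (R * l1norm x) + w * l1norm x)"
      unfolding exp_add by simp
    finally show ?thesis
      by (simp add: algebra_simps)
  qed
  have int: "integrable lborel (\<lambda>x :: real ^ 'd. B * exp (- ((R - w) * l1norm x)))"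
    using R by (intro integrable_mult_right integrable_exp_l1norm) simp
  have "continuous_on UNIV (\<lambda>x. cmod (fourier_inv F x) * exp (w * l1norm x))"
    by (intro continuous_intros continuous_fourier_inv F)
  then have meas: "(\<lambda>x. cmod (fourier_inv F x) * exp (w * l1norm x)) \<in> borel_measurable lborel"
    using borel_measurable_continuous_onI by simp
  show 1: "integrable lborel (\<lambda>x. cmod (fourier_inv F x) * exp (w * l1norm x))"
    by (rule Bochner_Integration.integrable_bound[OF int meas], rule AE_I2)
      (use order_trans[OF bound abs_ge_self] in simp)
  have "(\<integral>x. cmod (fourier_inv F x) * exp (w * l1norm x) \<partial>lborel)
      \<le> (\<integral>x. B * exp (- ((R - w) * l1norm x)) \<partial>(lborel :: (real ^ 'd) measure))"
    by (rule integral_mono[OF 1 int bound])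
  also have "\<dots> = B * (2 / (R - w)) ^ CARD('d)"
    by (subst integral_mult_right_zero, subst integral_exp_l1norm) (use R in auto)
  finally show "(\<integral>x. cmod (fourier_inv F x) * exp (w * l1norm x) \<partial>lborel)
        \<le> A / (pi * c) ^ CARD('d) * (2 / (R - w)) ^ CARD('d)"
    by (simp add: B_def)
qed

lemma integrable_fourier_inv_weighted:
  assumes F: "admissible F"
  shows "integrable lborel (\<lambda>x. cmod (fourier_inv F x) * exp (w * l1norm x))"
proof -
  obtain A where A: "\<And>z. z \<in> strip (\<bar>w\<bar> + 1) \<Longrightarrow> cmod (F z) \<le> A * exp (- (1 * rl1 z))"
    using admissible_bound[OF F, of "\<bar>w\<bar> + 1" 1] by metis
  show ?thesis
    by (rule integrable_fourier_inv_weighted'[OF F _ _ _ A]) auto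
qed

lemma integrable_fourier_inv:
  assumes F: "admissible F"
  shows "integrable lborel (fourier_inv F)"
proof (rule Bochner_Integration.integrable_bound)
  show "integrable lborel (\<lambda>x. cmod (fourier_inv F x) * exp (0 * l1norm x))"
    by (rule integrable_fourier_inv_weighted[OF F])
  show "fourier_inv F \<in> borel_measurable lborel"
    using borel_measurable_continuous_onI[OF continuous_fourier_inv[OF F]] by simp
qed simp

lemma integrable_fourier_integrand:
  assumes F: "admissible F"
  shows "integrable lborel (\<lambda>\<xi>. exp (\<i> * complex_of_real (x \<bullet> \<xi>)) * F (cvec \<xi>))"
proof -
  have "admissible (\<lambda>z. exp (\<i> * cpair x z) * F z)"
    by (intro admissible_mult tame_exp_cpair F)
  from integrable_admissible_cvec[OF this] show ?thesis
    by (simp add: cpair_cvec)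
qed

lemma fourier_inv_add:
  assumes "admissible F" "admissible G"
  shows "fourier_inv (\<lambda>z. F z + G z) x = fourier_inv F x + fourier_inv G x"
  unfolding fourier_inv_def distrib_left
  by (subst Bochner_Integration.integral_add)
    (auto simp: distrib_left intro: integrable_fourier_integrand assms)

lemma fourier_inv_cmult: "fourier_inv (\<lambda>z. a * F z) x = a * fourier_inv F x"
  unfolding fourier_inv_def
  by (subst mult.left_commute, subst integral_mult_right_zero) (simp add: mult_ac)

lemma exp_inner_diff:
  "exp (\<i> * complex_of_real ((x - y) \<bullet> z))
    = exp (\<i> * complex_of_real (x \<bullet> z)) * exp (- \<i> * complex_of_real (y \<bullet> z))"
  unfolding inner_diff_left of_real_diff right_diff_distrib
  by (simp add: exp_diff exp_minus divide_inverse)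

lemma fourier_inv_modulate:
  "fourier_inv (\<lambda>z. exp (- \<i> * cpair x z) * F z) y = fourier_inv F (y - x)"
  unfolding fourier_inv_def
  by (simp add: cpair_cvec exp_inner_diff mult.assoc)

lemma fourier_inv_translate:
  assumes F: "admissible F"
  shows "fourier_inv (\<lambda>z. F (z + cvec x)) y = exp (- \<i> * complex_of_real (y \<bullet> x)) * fourier_inv F y"
proof -
  define k where "k \<xi> = exp (\<i> * complex_of_real (y \<bullet> \<xi>)) * F (cvec \<xi>)" for \<xi>
  have cv: "cvec \<xi> + cvec x = cvec (x + \<xi>)" for \<xi>
    by (simp add: vec_eq_iff)
  have "exp (\<i> * complex_of_real (y \<bullet> \<xi>)) * F (cvec \<xi> + cvec x)
      = exp (- \<i> * complex_of_real (y \<bullet> x)) * k (x + \<xi>)" for \<xi>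
    unfolding k_def cv inner_add_right of_real_add distrib_left exp_add
    by (simp add: exp_minus mult.assoc)
  then have "(\<integral>\<xi>. exp (\<i> * complex_of_real (y \<bullet> \<xi>)) * F (cvec \<xi> + cvec x) \<partial>lborel)
      = exp (- \<i> * complex_of_real (y \<bullet> x)) * (\<integral>\<xi>. k \<xi> \<partial>lborel)"
    by (simp add: integral_lborel_translation)
  then show ?thesis
    by (simp add: fourier_inv_def k_def)
qed

section \<open>Gaussian regularisation and Fourier inversion\<close>

definition gauss :: "real ^ 'd \<Rightarrow> real"
  where "gauss x = (\<Prod>j\<in>UNIV. std_normal_density (x $ j))"

lemma gauss_eq:
  "(\<Prod>j\<in>UNIV. exp (- (x $ j)\<^sup>2 / 2)) = sqrt (2 * pi) ^ CARD('d) * gauss (x :: real ^ 'd)"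
  by (simp add: gauss_def std_normal_density_def prod_dividef)

lemma integrable_gauss: "integrable lborel gauss"
  unfolding gauss_def[abs_def] by (intro integrable_prod_cart) auto

lemma continuous_gauss: "continuous_on S gauss"
  unfolding gauss_def std_normal_density_def by (intro continuous_intros) auto

lemma gauss_nonneg: "0 \<le> gauss x"
  unfolding gauss_def by (intro prod_nonneg) auto

lemma gauss_le: "gauss (x :: real ^ 'd) \<le> gauss (0 :: real ^ 'd)"
  unfolding gauss_def by (intro prod_mono) (auto simp: std_normal_density_def divide_simps)

text \<open>The integral factorises over the coordinates, and each factor is a value of the
  characteristic function of the standard normal law.\<close>

lemma fourier_gauss:
  "(\<integral>y. exp (\<i> * complex_of_real (u \<bullet> y)) * complex_of_real (gauss y) \<partial>lborel)
    = complex_of_real (sqrt (2 * pi) ^ CARD('d) * gauss (u :: real ^ 'd))"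
proof -
  define f where "f j t = exp (\<i> * complex_of_real (u $ j * t)) * complex_of_real (std_normal_density t)" for j t
  have 1: "exp (\<i> * complex_of_real (u \<bullet> y)) * complex_of_real (gauss y) = (\<Prod>j\<in>UNIV. f j (y $ j))" for y
    unfolding f_def gauss_def
    by (simp add: prod.distrib inner_vec_def sum_distrib_left exp_sum)
  have int: "integrable lborel (f j)" for j
  proof (rule Bochner_Integration.integrable_bound)
    show "integrable lborel std_normal_density"
      by simp
    show "f j \<in> borel_measurable lborel"
      unfolding f_def by measurable
  qed (simp add: f_def norm_mult)
  have "(\<integral>t. f j t \<partial>lborel) = complex_of_real (exp (- (u $ j)\<^sup>2 / 2))" for j
  proof -
    have "(\<integral>t. f j t \<partial>lborel) = (\<integral>t. std_normal_density t *\<^sub>R iexp (u $ j * t) \<partial>lborel)"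
      by (simp add: f_def scaleR_conv_of_real mult.commute)
    also have "\<dots> = char std_normal_distribution (u $ j)"
      unfolding char_def by (subst integral_density) auto
    finally show ?thesis
      by (simp add: char_std_normal_distribution)
  qed
  then show ?thesis
    unfolding 1 integral_prod_cart[OF int] by (simp add: gauss_eq[symmetric])
qed

lemma integral_gauss: "(\<integral>y. complex_of_real (gauss y) \<partial>(lborel :: (real ^ 'd) measure)) = 1"
proof -
  have "gauss (0 :: real ^ 'd) = 1 / sqrt (2 * pi) ^ CARD('d)"
    by (simp add: gauss_def std_normal_density_def power_divide)
  then show ?thesis
    using fourier_gauss[of "0 :: real ^ 'd"] by simp
qed

text \<open>Inversion at the origin by Gaussian regularisation. By Fubini, pairing G(e u) with a
  Gaussian equals pairing \<open>fourier_inv G\<close> with a Gaussian of width 1 / e. Both sides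
  converge by domination as e tends to 0, and the constants match through gauss 0 = 1 / a with a =
  (2 pi)^(d/2).\<close>

lemma integral_fourier_inv:
  fixes G :: "complex ^ 'd \<Rightarrow> complex"
  assumes G: "admissible G"
  shows "(\<integral>y. fourier_inv G y \<partial>lborel) = G 0"
proof -
  define a where "a = sqrt (2 * pi) ^ CARD('d)"
  have "sqrt (2 * pi) * sqrt (2 * pi) = 2 * pi"
    by (simp only: real_sqrt_mult_self) simp
  then have a: "a > 0" "a * a = (2 * pi) ^ CARD('d)"
    unfolding a_def power_mult_distrib[symmetric] by (simp, simp only:)
  have gauss0: "gauss (0 :: real ^ 'd) = 1 / a"
    by (simp add: a_def gauss_def std_normal_density_def power_divide)
  define \<gamma> where "\<gamma> y = complex_of_real (gauss y)" for y :: "real ^ 'd"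
  have \<gamma>_int: "integrable lborel \<gamma>"
    unfolding \<gamma>_def by (intro integrable_of_real integrable_gauss)
  have \<gamma>_cont: "continuous_on UNIV (\<lambda>y. \<gamma> (f y))" if "continuous_on UNIV f" for f :: "real ^ 'd \<Rightarrow> real ^ 'd"
    unfolding \<gamma>_def by (intro continuous_on_of_real continuous_on_compose2[OF continuous_gauss[of UNIV] that]) simp
  have meas: "f \<in> borel_measurable lborel" if "continuous_on UNIV f" for f :: "real ^ 'd \<Rightarrow> complex"
    using borel_measurable_continuous_onI[OF that] by simp
  have G_cont: "continuous_on UNIV (\<lambda>u. G (cvec (f u)))" if "continuous_on UNIV f" for f :: "real ^ 'd \<Rightarrow> real ^ 'd"
    by (rule continuous_on_compose2[OF continuous_admissible_cvec[OF G] that]) simp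
  obtain A where A: "A \<ge> 0" "\<And>z. z \<in> strip 0 \<Longrightarrow> cmod (G z) \<le> A * exp (- (1 * rl1 z))"
    using admissible_bound[OF G, of 0 1] by metis
  have A': "cmod (G (cvec u)) \<le> A * exp (- l1norm u)" for u
    using A(2)[of "cvec u"] by (simp add: strip_def)
  have A'': "cmod (G (cvec u)) \<le> A" for u
    using A'[of u] A(1) mult_left_mono[of "exp (- l1norm u)" 1 A] by simp
  have eq: "(\<integral>u. G (cvec (e *\<^sub>R u)) * (a * \<gamma> u) \<partial>lborel)
      = (2 * pi) ^ CARD('d) * (\<integral>y. \<gamma> (e *\<^sub>R y) * fourier_inv G y \<partial>lborel)" if e: "e > 0" for e
  proof -
    have int: "integrable lborel (\<lambda>u. G (cvec (e *\<^sub>R u)))"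
    proof (rule Bochner_Integration.integrable_bound)
      show "integrable lborel (\<lambda>u :: real ^ 'd. A * exp (- (e * l1norm u)))"
        using e by (intro integrable_mult_right integrable_exp_l1norm)
      show "(\<lambda>u. G (cvec (e *\<^sub>R u))) \<in> borel_measurable lborel"
        by (intro meas G_cont continuous_intros)
      have "l1norm (e *\<^sub>R u) = e * l1norm u" for u :: "real ^ 'd"
        using e by (simp add: l1norm_def abs_mult sum_distrib_left)
      then show "AE u in lborel. norm (G (cvec (e *\<^sub>R u))) \<le> norm (A * exp (- (e * l1norm u)))"
        using A'[of "e *\<^sub>R _"] A(1) by (intro AE_I2) simp
    qed
    have "(\<integral>u. G (cvec (e *\<^sub>R u)) * (a * \<gamma> u) \<partial>lborel)
        = (\<integral>u. G (cvec (e *\<^sub>R u)) * (\<integral>y. exp (\<i> * complex_of_real (u \<bullet> y)) * \<gamma> y \<partial>lborel) \<partial>lborel)"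
      unfolding \<gamma>_def fourier_gauss a_def by simp
    also have "\<dots> = (\<integral>u. (\<integral>y. G (cvec (e *\<^sub>R u)) * \<gamma> y * exp (\<i> * complex_of_real (u \<bullet> y)) \<partial>lborel) \<partial>lborel)"
      by (subst integral_mult_right_zero[symmetric]) (simp add: mult_ac)
    also have "\<dots> = (\<integral>y. (\<integral>u. G (cvec (e *\<^sub>R u)) * \<gamma> y * exp (\<i> * complex_of_real (u \<bullet> y)) \<partial>lborel) \<partial>lborel)"
      by (rule fubini_product[OF int \<gamma>_int, where C = 1])
        (auto simp: case_prod_beta intro!: continuous_intros)
    also have "\<dots> = (\<integral>y. \<gamma> y * (\<integral>u. exp (\<i> * complex_of_real (y \<bullet> u)) * G (cvec (e *\<^sub>R u)) \<partial>lborel) \<partial>lborel)"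
      by (subst integral_mult_right_zero[symmetric]) (simp add: mult_ac inner_commute)
    \<comment> \<open>The substitution v = e u in the inner integral produces e^(-d); the
      substitution y to e y that follows in the outer one cancels it.\<close>
    also have "\<dots> = (\<integral>y. \<gamma> y * ((2 * pi) ^ CARD('d) / e ^ CARD('d) * fourier_inv G ((1 / e) *\<^sub>R y)) \<partial>lborel)"
    proof -
      have "(\<integral>u. exp (\<i> * complex_of_real (y \<bullet> u)) * G (cvec (e *\<^sub>R u)) \<partial>lborel)
          = (2 * pi) ^ CARD('d) / e ^ CARD('d) * fourier_inv G ((1 / e) *\<^sub>R y)" for y
      proof -
        define h where "h v = exp (\<i> * complex_of_real (((1 / e) *\<^sub>R y) \<bullet> v)) * G (cvec v)" for v
        have "h \<in> borel_measurable borel"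
          unfolding h_def
          by (intro borel_measurable_continuous_onI continuous_intros continuous_admissible_cvec G)
        then have "(\<integral>v. h v \<partial>lborel) = e ^ DIM(real ^ 'd) *\<^sub>R (\<integral>u. h (e *\<^sub>R u) \<partial>lborel)"
          using e by (rule integral_lborel_scaling)
        moreover have "h (e *\<^sub>R u) = exp (\<i> * complex_of_real (y \<bullet> u)) * G (cvec (e *\<^sub>R u))" for u
          using e by (simp add: h_def)
        moreover have "(\<integral>v. h v \<partial>lborel) = (2 * pi) ^ CARD('d) * fourier_inv G ((1 / e) *\<^sub>R y)"
          by (simp add: fourier_inv_def h_def)
        ultimately show ?thesis
          using e by (simp add: scaleR_conv_of_real field_simps)
      qed
      then show ?thesis
        by simp
    qed
    also have "\<dots> = (2 * pi) ^ CARD('d) * (\<integral>y. \<gamma> (e *\<^sub>R y) * fourier_inv G y \<partial>lborel)"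
    proof -
      define q where "q y = \<gamma> y * ((2 * pi) ^ CARD('d) / e ^ CARD('d) * fourier_inv G ((1 / e) *\<^sub>R y))" for y
      have "continuous_on UNIV q"
        unfolding q_def
        by (intro continuous_intros \<gamma>_cont continuous_on_compose2[OF continuous_fourier_inv[OF G]]) (use e in auto)
      then have "(\<integral>y. q y \<partial>lborel) = e ^ DIM(real ^ 'd) *\<^sub>R (\<integral>y. q (e *\<^sub>R y) \<partial>lborel)"
        using e by (intro integral_lborel_scaling borel_measurable_continuous_onI)
      also have "(\<integral>y. q (e *\<^sub>R y) \<partial>lborel)
          = (\<integral>y. (2 * pi) ^ CARD('d) / e ^ CARD('d) * (\<gamma> (e *\<^sub>R y) * fourier_inv G y) \<partial>lborel)"
        using e by (intro Bochner_Integration.integral_cong) (auto simp: q_def)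
      also have "e ^ DIM(real ^ 'd) *\<^sub>R \<dots> = (2 * pi) ^ CARD('d) * (\<integral>y. \<gamma> (e *\<^sub>R y) * fourier_inv G y \<partial>lborel)"
        using e by (simp add: scaleR_conv_of_real)
      finally show ?thesis
        unfolding q_def .
    qed
    finally show ?thesis .
  qed
  define e where "e n = inverse (real (Suc n))" for n
  have e: "e n > 0" for n
    by (simp add: e_def)
  have e_lim: "e \<longlonglongrightarrow> 0"
    unfolding e_def by (rule LIMSEQ_inverse_real_of_nat)
  have e_vec: "(\<lambda>n. e n *\<^sub>R u) \<longlonglongrightarrow> 0" for u :: "real ^ 'd"
    using tendsto_scaleR[OF e_lim tendsto_const[of u]] by simp
  have G_lim: "(\<lambda>n. G (cvec (e n *\<^sub>R u))) \<longlonglongrightarrow> G (cvec 0)" for u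
    by (rule continuous_on_tendsto_compose[OF continuous_admissible_cvec[OF G] e_vec]) auto
  have \<gamma>_lim: "(\<lambda>n. \<gamma> (e n *\<^sub>R u)) \<longlonglongrightarrow> \<gamma> 0" for u
    by (rule continuous_on_tendsto_compose[OF \<gamma>_cont[OF continuous_on_id] e_vec]) auto
  have "(\<lambda>n. \<integral>u. G (cvec (e n *\<^sub>R u)) * (a * \<gamma> u) \<partial>lborel) \<longlonglongrightarrow> (\<integral>u. G (cvec 0) * (a * \<gamma> u) \<partial>lborel)"
  proof (rule integral_dominated_convergence[where w = "\<lambda>u. A * (a * gauss u)"])
    show "integrable lborel (\<lambda>u :: real ^ 'd. A * (a * gauss u))"
      by (intro integrable_mult_right integrable_gauss)
    show "AE u in lborel. (\<lambda>n. G (cvec (e n *\<^sub>R u)) * (a * \<gamma> u)) \<longlonglongrightarrow> G (cvec 0) * (a * \<gamma> u)"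
      by (intro AE_I2 tendsto_intros G_lim)
    show "AE u in lborel. norm (G (cvec (e n *\<^sub>R u)) * (a * \<gamma> u)) \<le> A * (a * gauss u)" for n
      using a A'' by (intro AE_I2) (simp add: \<gamma>_def norm_mult gauss_nonneg mult_right_mono)
  qed (intro meas continuous_intros G_cont \<gamma>_cont)+
  also have "(\<integral>u. G (cvec 0) * (a * \<gamma> u) \<partial>lborel) = a * G 0"
  proof -
    have "cvec (0 :: real ^ 'd) = 0"
      by (simp add: vec_eq_iff)
    then show ?thesis
      using integral_gauss[where 'd = 'd] by (simp add: \<gamma>_def)
  qed
  finally have 1: "(\<lambda>n. (2 * pi) ^ CARD('d) * (\<integral>y. \<gamma> (e n *\<^sub>R y) * fourier_inv G y \<partial>lborel)) \<longlonglongrightarrow> a * G 0"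
    unfolding eq[OF e] .
  have "(\<lambda>n. \<integral>y. \<gamma> (e n *\<^sub>R y) * fourier_inv G y \<partial>lborel) \<longlonglongrightarrow> (\<integral>y. \<gamma> 0 * fourier_inv G y \<partial>lborel)"
  proof (rule integral_dominated_convergence[where w = "\<lambda>y. gauss (0 :: real ^ 'd) * cmod (fourier_inv G y)"])
    show "integrable lborel (\<lambda>y. gauss (0 :: real ^ 'd) * cmod (fourier_inv G y))"
      by (intro integrable_mult_right integrable_norm integrable_fourier_inv G)
    show "AE y in lborel. (\<lambda>n. \<gamma> (e n *\<^sub>R y) * fourier_inv G y) \<longlonglongrightarrow> \<gamma> 0 * fourier_inv G y"
      by (intro AE_I2 tendsto_intros \<gamma>_lim)
    show "AE y in lborel. norm (\<gamma> (e n *\<^sub>R y) * fourier_inv G y) \<le> gauss (0 :: real ^ 'd) * cmod (fourier_inv G y)" for n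
      by (intro AE_I2) (auto simp: \<gamma>_def norm_mult gauss_nonneg gauss_le intro!: mult_right_mono)
  qed (intro meas continuous_intros \<gamma>_cont continuous_fourier_inv G)+
  then have "(\<lambda>n. (2 * pi) ^ CARD('d) * (\<integral>y. \<gamma> (e n *\<^sub>R y) * fourier_inv G y \<partial>lborel))
      \<longlonglongrightarrow> (2 * pi) ^ CARD('d) * (\<integral>y. \<gamma> 0 * fourier_inv G y \<partial>lborel)"
    by (intro tendsto_intros)
  with 1 have "a * G 0 = (2 * pi) ^ CARD('d) * (\<integral>y. \<gamma> 0 * fourier_inv G y \<partial>lborel)"
    by (rule LIMSEQ_unique)
  also have "\<dots> = complex_of_real (a * a) * (complex_of_real (1 / a) * (\<integral>y. fourier_inv G y \<partial>lborel))"
    unfolding a(2) by (simp add: \<gamma>_def gauss0)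
  finally show ?thesis
    using a(1) by simp
qed

text \<open>A real translation of G moves the evaluation point to the origin and multiplies the
  inverse transform by a character.\<close>

lemma fourier_inversion:
  assumes G: "admissible G"
  shows "(\<integral>y. exp (- \<i> * complex_of_real (y \<bullet> \<xi>)) * fourier_inv G y \<partial>lborel) = G (cvec \<xi>)"
  using integral_fourier_inv[OF admissible_translate[OF G, of \<xi>]] by (simp add: fourier_inv_translate[OF G])

text \<open>Only the inverse transform of F is written out; after exchanging the integrals, the
  inner one is the inversion formula for G.\<close>

lemma fourier_inv_convolution:
  assumes F: "admissible F" and G: "admissible G"
  shows "(\<integral>y. fourier_inv F (x - y) * fourier_inv G y \<partial>lborel) = fourier_inv (\<lambda>z. F z * G z) x"
proof -
  define b where "b = 1 / (2 * complex_of_real pi) ^ CARD('a)"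
  have "fourier_inv F (x - y) * fourier_inv G y
      = b * (\<integral>\<xi>. fourier_inv G y * F (cvec \<xi>) * exp (\<i> * complex_of_real ((x - y) \<bullet> \<xi>)) \<partial>lborel)" for y
  proof -
    have "(\<integral>\<xi>. fourier_inv G y * F (cvec \<xi>) * exp (\<i> * complex_of_real ((x - y) \<bullet> \<xi>)) \<partial>lborel)
        = fourier_inv G y * (\<integral>\<xi>. exp (\<i> * complex_of_real ((x - y) \<bullet> \<xi>)) * F (cvec \<xi>) \<partial>lborel)"
      by (subst integral_mult_right_zero[symmetric]) (simp add: mult_ac)
    then show ?thesis
      by (simp add: fourier_inv_def[of F] b_def)
  qed
  then have "(\<integral>y. fourier_inv F (x - y) * fourier_inv G y \<partial>lborel)
      = b * (\<integral>y. (\<integral>\<xi>. fourier_inv G y * F (cvec \<xi>) * exp (\<i> * complex_of_real ((x - y) \<bullet> \<xi>)) \<partial>lborel) \<partial>lborel)"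
    by simp
  also have "(\<integral>y. (\<integral>\<xi>. fourier_inv G y * F (cvec \<xi>) * exp (\<i> * complex_of_real ((x - y) \<bullet> \<xi>)) \<partial>lborel) \<partial>lborel)
      = (\<integral>\<xi>. (\<integral>y. fourier_inv G y * F (cvec \<xi>) * exp (\<i> * complex_of_real ((x - y) \<bullet> \<xi>)) \<partial>lborel) \<partial>lborel)"
    by (rule fubini_product[OF integrable_fourier_inv[OF G] integrable_admissible_cvec[OF F], where C = 1])
      (auto simp: case_prod_beta intro!: continuous_intros)
  also have "\<dots> = (\<integral>\<xi>. exp (\<i> * complex_of_real (x \<bullet> \<xi>)) * (F (cvec \<xi>) * G (cvec \<xi>)) \<partial>lborel)"
  proof (rule Bochner_Integration.integral_cong[OF refl])
    fix \<xi>
    have eq: "fourier_inv G y * F (cvec \<xi>) * exp (\<i> * complex_of_real ((x - y) \<bullet> \<xi>))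
        = (exp (\<i> * complex_of_real (x \<bullet> \<xi>)) * F (cvec \<xi>))
          * (exp (- \<i> * complex_of_real (y \<bullet> \<xi>)) * fourier_inv G y)" for y
      by (simp only: exp_inner_diff mult_ac)
    show "(\<integral>y. fourier_inv G y * F (cvec \<xi>) * exp (\<i> * complex_of_real ((x - y) \<bullet> \<xi>)) \<partial>lborel)
        = exp (\<i> * complex_of_real (x \<bullet> \<xi>)) * (F (cvec \<xi>) * G (cvec \<xi>))"
      unfolding eq integral_mult_right_zero fourier_inversion[OF G] by (rule mult.assoc)
  qed
  finally show ?thesis
    by (simp add: fourier_inv_def b_def)
qed

section \<open>Symbols of strongly elliptic operators\<close>

definition re_vec :: "complex ^ 'd \<Rightarrow> real ^ 'd"
  where "re_vec z = (\<chi> j. Re (z $ j))"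

definition monomial :: "'d list \<Rightarrow> complex ^ 'd \<Rightarrow> complex"
  where "monomial \<alpha> z = prod_list (map (\<lambda>k. - \<i> * z $ k) \<alpha>)"

definition csymbol :: "nat \<Rightarrow> ('d::finite list \<Rightarrow> complex) \<Rightarrow> complex ^ 'd \<Rightarrow> complex"
  where "csymbol m c z = (\<Sum>\<alpha> | length \<alpha> \<le> m. c \<alpha> * monomial \<alpha> z)"

lemma monomial_simps [simp]:
  "monomial [] z = 1" "monomial (k # \<alpha>) z = - \<i> * z $ k * monomial \<alpha> z"
  by (simp_all add: monomial_def)

lemma csymbol_cvec: "csymbol m c (cvec \<xi>) = symbol m c \<xi>"
  by (simp add: csymbol_def symbol_def monomial_def)

lemma finite_lists_length_le_UNIV: "finite {\<alpha> :: 'd::finite list. length \<alpha> \<le> m}"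
  using finite_lists_length_le[of "UNIV :: 'd set" m] by simp

lemma finite_lists_length_eq_UNIV: "finite {\<alpha> :: 'd::finite list. length \<alpha> = m}"
  using finite_lists_length_eq[of "UNIV :: 'd set" m] by simp

lemma tame_monomial: "tame (monomial \<alpha>)"
proof (induction \<alpha>)
  case Nil
  then show ?case
    using tame_const[of 1] by (simp add: monomial_def[abs_def])
next
  case (Cons k \<alpha>)
  have "tame (\<lambda>z. (- \<i> * z $ k) * monomial \<alpha> z)"
    by (intro tame_mult tame_const tame_nth Cons)
  then show ?case
    by (simp add: monomial_def[abs_def])
qed

lemma tame_csymbol: "tame (csymbol m c)"
  unfolding csymbol_def[abs_def] by (intro tame_sum tame_mult tame_const tame_monomial)

lemma rl1_le_re_vec: "rl1 (z :: complex ^ 'd) \<le> CARD('d) * norm (re_vec z)"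
  using l1norm_le_norm[of "re_vec z"] by (simp add: rl1_def l1norm_def re_vec_def)

lemma strip_nth_le:
  assumes z: "z \<in> strip R"
  shows "cmod (z $ k) \<le> norm (re_vec z) + R" "cmod (z $ k - complex_of_real (re_vec z $ k)) \<le> R"
proof -
  have "\<bar>Re (z $ k)\<bar> \<le> norm (re_vec z)"
    using component_le_norm_cart[of "re_vec z" k] by (simp add: re_vec_def)
  moreover have "\<bar>Im (z $ k)\<bar> \<le> R"
    using z by (simp add: strip_def)
  ultimately show "cmod (z $ k) \<le> norm (re_vec z) + R"
    using cmod_le[of "z $ k"] by linarith
  have "z $ k - complex_of_real (re_vec z $ k) = \<i> * complex_of_real (Im (z $ k))"
    by (simp add: re_vec_def complex_eq_iff)
  then show "cmod (z $ k - complex_of_real (re_vec z $ k)) \<le> R"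
    using \<open>\<bar>Im (z $ k)\<bar> \<le> R\<close> by (simp add: norm_mult)
qed

lemma norm_monomial_le:
  fixes z :: "complex ^ 'd"
  assumes "\<And>k. cmod (z $ k) \<le> b" "b \<ge> 0"
  shows "cmod (monomial \<alpha> z) \<le> b ^ length \<alpha>"
proof (induction \<alpha>)
  case (Cons k \<alpha>)
  have "cmod (z $ k) * cmod (monomial \<alpha> z) \<le> b * b ^ length \<alpha>"
    by (intro mult_mono assms Cons) auto
  then show ?case
    by (simp add: norm_mult)
qed simp

text \<open>A telescoping product estimate. The expected bound n r (s + r)^(n - 1), with n the
  length of \<alpha>, is multiplied by s + r, so that the induction meets no exponent n - 1 at the
  empty list.\<close>

lemma norm_monomial_diff_le:
  fixes z x :: "complex ^ 'd" and s r :: real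
  assumes z: "\<And>k. cmod (z $ k) \<le> s + r" and x: "\<And>k. cmod (x $ k) \<le> s"
    and d: "\<And>k. cmod (z $ k - x $ k) \<le> r" and "s \<ge> 0" "r \<ge> 0"
  shows "(s + r) * cmod (monomial \<alpha> z - monomial \<alpha> x) \<le> length \<alpha> * r * (s + r) ^ length \<alpha>"
proof (induction \<alpha>)
  case (Cons k \<alpha>)
  define D where "D = cmod (monomial \<alpha> z - monomial \<alpha> x)"
  have "monomial (k # \<alpha>) z - monomial (k # \<alpha>) x
      = - \<i> * ((z $ k - x $ k) * monomial \<alpha> z) + - \<i> * (x $ k * (monomial \<alpha> z - monomial \<alpha> x))"
    by (simp add: algebra_simps)
  then have "cmod (monomial (k # \<alpha>) z - monomial (k # \<alpha>) x)
      \<le> cmod (z $ k - x $ k) * cmod (monomial \<alpha> z) + cmod (x $ k) * D"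
    using norm_triangle_ineq[of "- \<i> * ((z $ k - x $ k) * monomial \<alpha> z)" "- \<i> * (x $ k * (monomial \<alpha> z - monomial \<alpha> x))"]
    by (simp add: norm_mult D_def)
  also have "\<dots> \<le> r * (s + r) ^ length \<alpha> + s * D"
    using assms by (intro add_mono mult_mono norm_monomial_le) (auto simp: D_def)
  finally have "(s + r) * cmod (monomial (k # \<alpha>) z - monomial (k # \<alpha>) x)
      \<le> (s + r) * (r * (s + r) ^ length \<alpha> + s * D)"
    using assms by (intro mult_left_mono) auto
  also have "\<dots> = r * (s + r) ^ Suc (length \<alpha>) + s * ((s + r) * D)"
    by (simp add: algebra_simps)
  also have "s * ((s + r) * D) \<le> (s + r) * (length \<alpha> * r * (s + r) ^ length \<alpha>)"
    by (rule mult_mono) (use Cons assms in \<open>auto simp: D_def\<close>)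
  also have "r * (s + r) ^ Suc (length \<alpha>) + (s + r) * (length \<alpha> * r * (s + r) ^ length \<alpha>)
      = length (k # \<alpha>) * r * (s + r) ^ length (k # \<alpha>)"
    by (simp add: algebra_simps)
  finally show ?case
    by simp
qed simp

text \<open>An inequality of Young's type, by cases: if \<open>r \<le> \<delta> * s\<close>, the
  left side is at most a multiple of \<delta> s^(n+1), small by the choice of \<delta>; otherwise s
  is at most r / \<delta> and everything is a multiple of r^(n+1).\<close>

lemma absorb_lower_order:
  fixes K e :: real
  assumes "e > 0" "K \<ge> 0"
  obtains C where "C \<ge> 0" "\<And>s r. s \<ge> 0 \<Longrightarrow> r \<ge> 0 \<Longrightarrow> K * r * (s + r) ^ n \<le> e * s ^ Suc n + C * r ^ Suc n"
proof -
  \<comment> \<open>\<open>\<delta> \<le> 1\<close> gives \<open>s + r \<le> 2 * s\<close> in the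
    first case, whence the power of 2; K + 1 replaces K to avoid a division by 0.\<close>
  define \<delta> where "\<delta> = min 1 (e / ((K + 1) * 2 ^ n))"
  have \<delta>: "\<delta> > 0" "\<delta> \<le> 1" "(K + 1) * 2 ^ n * \<delta> \<le> e"
  proof -
    have "(K + 1) * 2 ^ n > 0"
      using assms by simp
    then show "\<delta> > 0"
      using assms by (simp add: \<delta>_def)
    have "(K + 1) * 2 ^ n * \<delta> \<le> (K + 1) * 2 ^ n * (e / ((K + 1) * 2 ^ n))"
      using assms by (intro mult_left_mono) (auto simp: \<delta>_def)
    also have "\<dots> = e"
      using assms by simp
    finally show "(K + 1) * 2 ^ n * \<delta> \<le> e" .
  qed (simp add: \<delta>_def)
  show thesis
  proof (rule that[of "K * (1 / \<delta> + 1) ^ n"])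
    show "K * (1 / \<delta> + 1) ^ n \<ge> 0"
      using assms \<delta> by simp
    fix s r :: real
    assume s: "s \<ge> 0" and r: "r \<ge> 0"
    show "K * r * (s + r) ^ n \<le> e * s ^ Suc n + K * (1 / \<delta> + 1) ^ n * r ^ Suc n"
    proof (cases "r \<le> \<delta> * s")
      case True
      have "r \<le> s"
        using True \<delta> s mult_right_mono[of \<delta> 1 s] by simp
      then have "K * r * (s + r) ^ n \<le> K * (\<delta> * s) * (2 * s) ^ n"
        using True s r assms \<delta> by (intro mult_mono power_mono) auto
      also have "\<dots> = (K * 2 ^ n * \<delta>) * s ^ Suc n"
        by (simp add: power_mult_distrib mult_ac)
      also have "\<dots> \<le> e * s ^ Suc n"
      proof (intro mult_right_mono)
        have "K * 2 ^ n * \<delta> \<le> (K + 1) * 2 ^ n * \<delta>"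
          using \<delta> by (intro mult_right_mono) auto
        then show "K * 2 ^ n * \<delta> \<le> e"
          using \<delta>(3) by (rule order_trans)
      qed (use s in auto)
      finally show ?thesis
        using assms \<delta> r by (simp add: add_increasing2)
    next
      case False
      then have "s + r \<le> (1 / \<delta> + 1) * r"
        using \<delta> by (simp add: field_simps)
      then have "K * r * (s + r) ^ n \<le> K * r * ((1 / \<delta> + 1) * r) ^ n"
        using s r assms by (intro mult_left_mono power_mono) auto
      also have "\<dots> = K * (1 / \<delta> + 1) ^ n * r ^ Suc n"
        unfolding power_mult_distrib by (simp add: mult_ac)
      finally show ?thesis
        using assms s by (simp add: add_increasing)
    qed
  qed
qed

lemma add_power_le:
  fixes s r :: real
  assumes "s \<ge> 0" "r \<ge> 0"
  shows "(s + r) ^ n \<le> 2 ^ n * (s ^ n + r ^ n)"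
proof -
  have "(s + r) ^ n \<le> (2 * max s r) ^ n"
    using assms by (intro power_mono) auto
  also have "\<dots> = 2 ^ n * max s r ^ n"
    by (simp add: power_mult_distrib)
  also have "max s r ^ n \<le> s ^ n + r ^ n"
    using assms by (simp add: max_def)
  finally show ?thesis
    by simp
qed

text \<open>The number r exceeds the half-width of the strip by 1 and so bounds both the imaginary
  parts and the constant 1. Since \<open>s + r \<ge> 1\<close>, the terms of lower order and the
  error of passing to the real part are both of size r (s + r)^(m-1).\<close>

lemma symbol_perturbation:
  assumes m: "m \<ge> 1" and z: "z \<in> strip (r - 1)" and r: "r \<ge> 1"
  defines "s \<equiv> norm (re_vec z)"
  shows "cmod (csymbol m c z - (\<Sum>\<alpha> | length \<alpha> = m. c \<alpha> * monomial \<alpha> (cvec (re_vec z))))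
      \<le> (\<Sum>\<alpha> | length \<alpha> \<le> m. cmod (c \<alpha>)) * m * r * (s + r) ^ (m - 1)"
    and "cmod (csymbol m c z) \<le> (\<Sum>\<alpha> | length \<alpha> \<le> m. cmod (c \<alpha>)) * (s + r) ^ m"
proof -
  have s: "s \<ge> 0"
    by (simp add: s_def)
  have zk: "cmod (z $ k) \<le> s + r" "cmod (z $ k - cvec (re_vec z) $ k) \<le> r" for k
    using strip_nth_le[OF z, of k] by (auto simp: s_def)
  have xk: "cmod (cvec (re_vec z) $ k) \<le> s" for k
    by (simp add: s_def component_le_norm_cart)
  have sr: "s + r \<ge> 1"
    using s r by simp
  have mono: "cmod (monomial \<alpha> z) \<le> (s + r) ^ length \<alpha>" for \<alpha>
    by (rule norm_monomial_le) (use zk sr in auto)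
  define x where "x = cvec (re_vec z)"
  define E where "E \<alpha> = (if length \<alpha> = m then monomial \<alpha> z - monomial \<alpha> x else monomial \<alpha> z)" for \<alpha>
  have "(\<Sum>\<alpha> | length \<alpha> = m. c \<alpha> * monomial \<alpha> x)
      = (\<Sum>\<alpha> | length \<alpha> \<le> m. if length \<alpha> = m then c \<alpha> * monomial \<alpha> x else 0)"
    by (rule sum.mono_neutral_cong_left) (auto simp: finite_lists_length_le_UNIV)
  then have "csymbol m c z - (\<Sum>\<alpha> | length \<alpha> = m. c \<alpha> * monomial \<alpha> x) = (\<Sum>\<alpha> | length \<alpha> \<le> m. c \<alpha> * E \<alpha>)"
    unfolding csymbol_def by (simp add: sum_subtractf[symmetric]) (auto simp: E_def algebra_simps intro!: sum.cong)
  also have "cmod \<dots> \<le> (\<Sum>\<alpha> | length \<alpha> \<le> m. cmod (c \<alpha>) * (m * r * (s + r) ^ (m - 1)))"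
  proof (rule sum_norm_le)
    fix \<alpha> :: "'a list"
    assume "\<alpha> \<in> {\<alpha>. length \<alpha> \<le> m}"
    then have \<alpha>: "length \<alpha> \<le> m"
      by simp
    have "cmod (E \<alpha>) \<le> m * r * (s + r) ^ (m - 1)"
    proof (cases "length \<alpha> = m")
      case True
      have "(s + r) * cmod (monomial \<alpha> z - monomial \<alpha> x) \<le> length \<alpha> * r * (s + r) ^ length \<alpha>"
        unfolding x_def by (rule norm_monomial_diff_le) (use zk xk s r in auto)
      also have "\<dots> = (s + r) * (m * r * (s + r) ^ (m - 1))"
        using True m by (cases m) (auto simp: mult_ac)
      finally show ?thesis
        using sr True by (simp add: E_def)
    next
      case False
      then have "length \<alpha> \<le> m - 1"
        using \<alpha> by simp
      then have "cmod (E \<alpha>) \<le> (s + r) ^ (m - 1)"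
        using mono[of \<alpha>] power_increasing[OF _ sr, of "length \<alpha>" "m - 1"] False by (simp add: E_def)
      also have "\<dots> = 1 * (s + r) ^ (m - 1)"
        by simp
      also have "\<dots> \<le> (m * r) * (s + r) ^ (m - 1)"
        using m r sr mult_mono[of 1 "real m" 1 r] by (intro mult_right_mono) auto
      finally show ?thesis .
    qed
    then show "cmod (c \<alpha> * E \<alpha>) \<le> cmod (c \<alpha>) * (m * r * (s + r) ^ (m - 1))"
      by (simp add: norm_mult mult_left_mono)
  qed
  finally show "cmod (csymbol m c z - (\<Sum>\<alpha> | length \<alpha> = m. c \<alpha> * monomial \<alpha> (cvec (re_vec z))))
      \<le> (\<Sum>\<alpha> | length \<alpha> \<le> m. cmod (c \<alpha>)) * m * r * (s + r) ^ (m - 1)"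
    by (simp only: x_def sum_distrib_right mult.assoc)
  have "cmod (csymbol m c z) \<le> (\<Sum>\<alpha> | length \<alpha> \<le> m. cmod (c \<alpha>) * (s + r) ^ m)"
    unfolding csymbol_def
  proof (rule sum_norm_le)
    fix \<alpha> :: "'a list"
    assume "\<alpha> \<in> {\<alpha>. length \<alpha> \<le> m}"
    then have "cmod (monomial \<alpha> z) \<le> (s + r) ^ m"
      using mono[of \<alpha>] power_increasing[OF _ sr, of "length \<alpha>" m] by simp
    then show "cmod (c \<alpha> * monomial \<alpha> z) \<le> cmod (c \<alpha>) * (s + r) ^ m"
      by (simp add: norm_mult mult_left_mono)
  qed
  then show "cmod (csymbol m c z) \<le> (\<Sum>\<alpha> | length \<alpha> \<le> m. cmod (c \<alpha>)) * (s + r) ^ m"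
    by (simp add: sum_distrib_right)
qed

text \<open>Evenness of m enters through (-i)^m = (-1)^(m/2), which identifies the principal part of
  h with the form in the definition of strong ellipticity.\<close>

lemma principal_symbol:
  assumes m: "even m"
  shows "(\<Sum>\<alpha> | length \<alpha> = m. c \<alpha> * monomial \<alpha> (cvec \<xi>))
    = (- 1) ^ (m div 2) * (\<Sum>\<alpha> | length \<alpha> = m. c \<alpha> * complex_of_real (prod_list (map (\<lambda>k. \<xi> $ k) \<alpha>)))"
proof -
  have mono: "monomial \<alpha> (cvec \<xi>) = (- \<i>) ^ length \<alpha> * complex_of_real (prod_list (map (\<lambda>k. \<xi> $ k) \<alpha>))" for \<alpha>
    by (induction \<alpha>) auto
  have "(- \<i>) ^ m = ((- \<i>) ^ 2) ^ (m div 2)"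
    using m by (simp flip: power_mult)
  then have "(- \<i>) ^ m = (- 1) ^ (m div 2)"
    by simp
  then show ?thesis
    unfolding mono sum_distrib_left by (intro sum.cong) auto
qed

section \<open>Lower bounds for the symbol in a sector of times\<close>

lemma sector_bounds:
  assumes "e > 0"
  obtains \<theta> where "0 < \<theta>" "\<theta> \<le> pi / 2"
    "\<And>w. w \<in> sector \<theta> \<Longrightarrow> Re w \<ge> 3 / 4 * cmod w \<and> \<bar>Im w\<bar> \<le> e * cmod w"
proof -
  \<comment> \<open>An argument below 1/2 has squared sine at most 1/4, hence cosine at least its
    own square, which is at least 3/4.\<close>
  define \<theta> where "\<theta> = min (1 / 2) e"
  show thesis
  proof (rule that[of \<theta>])
    show "0 < \<theta>" "\<theta> \<le> pi / 2"
      using assms pi_gt3 by (auto simp: \<theta>_def)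
    fix w
    assume "w \<in> sector \<theta>"
    then have a: "\<bar>Arg w\<bar> < 1 / 2" "\<bar>Arg w\<bar> < e"
      by (auto simp: sector_def \<theta>_def)
    have w: "Re w = cmod w * cos (Arg w)" "Im w = cmod w * sin (Arg w)"
      by (metis Re_rcis Im_rcis rcis_cmod_Arg)+
    have s: "\<bar>sin (Arg w)\<bar> \<le> \<bar>Arg w\<bar>"
      by (rule abs_sin_x_le_abs_x)
    have "cos (Arg w) > 0"
      using a pi_gt3 by (intro cos_gt_zero_pi) auto
    have "(sin (Arg w))\<^sup>2 \<le> (1 / 2)\<^sup>2"
      using s a by (intro power2_le_iff_abs_le[THEN iffD2]) auto
    then have "3 / 4 \<le> (cos (Arg w))\<^sup>2"
      using sin_cos_squared_add[of "Arg w"] by (simp add: power2_eq_square)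
    also have "\<dots> \<le> cos (Arg w)"
      using \<open>cos (Arg w) > 0\<close> cos_le_one[of "Arg w"] mult_left_mono[of "cos (Arg w)" 1 "cos (Arg w)"]
      by (simp add: power2_eq_square)
    finally have "cmod w * (3 / 4) \<le> cmod w * cos (Arg w)"
      by (intro mult_left_mono) auto
    moreover have "cmod w * \<bar>sin (Arg w)\<bar> \<le> cmod w * e"
      using s a by (intro mult_left_mono) auto
    ultimately show "Re w \<ge> 3 / 4 * cmod w \<and> \<bar>Im w\<bar> \<le> e * cmod w"
      unfolding w by (simp add: abs_mult mult_ac)
  qed
qed

text \<open>Ellipticity survives a small rotation and a bounded imaginary shift. Of the 3/4 \<mu>0
  granted by Re w, the imaginary part of w consumes 1/4 \<mu>0, and lower-order terms with the shift
  another 1/4 \<mu>0 plus a multiple of r^m; 1/4 \<mu>0 is left. The constant C + N serves both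
  bounds.\<close>

lemma elliptic_sector_bound:
  fixes c :: "'d::finite list \<Rightarrow> complex"
  assumes m: "even m" "m \<ge> 2" and elliptic: "strongly_elliptic m c"
  obtains \<theta> \<mu> C where "0 < \<theta>" "\<theta> \<le> pi / 2" "\<mu> > 0" "C \<ge> 0"
    "\<And>w z r. w \<in> sector \<theta> \<Longrightarrow> r \<ge> 1 \<Longrightarrow> z \<in> strip (r - 1) \<Longrightarrow>
      Re (w * csymbol m c z) \<ge> cmod w * (\<mu> * norm (re_vec z) ^ m - C * r ^ m)"
    "\<And>z r. r \<ge> 1 \<Longrightarrow> z \<in> strip (r - 1) \<Longrightarrow> cmod (csymbol m c z) \<le> C * (norm (re_vec z) + r) ^ m"
proof -
  obtain \<mu>0 where \<mu>0: "\<mu>0 > 0" "\<And>\<xi> :: real ^ 'd. Re ((- 1) ^ (m div 2) *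
      (\<Sum>\<alpha> | length \<alpha> = m. c \<alpha> * complex_of_real (prod_list (map (\<lambda>k. \<xi> $ k) \<alpha>)))) \<ge> \<mu>0 * norm \<xi> ^ m"
    using elliptic unfolding strongly_elliptic_def by blast
  define N where "N = (\<Sum>\<alpha> | length \<alpha> \<le> m. cmod (c \<alpha>))"
  have N: "N \<ge> 0"
    by (simp add: N_def sum_nonneg)
  define P where "P \<xi> = (\<Sum>\<alpha> | length \<alpha> = m. c \<alpha> * monomial \<alpha> (cvec \<xi>))" for \<xi> :: "real ^ 'd"
  have ReP: "Re (P \<xi>) \<ge> \<mu>0 * norm \<xi> ^ m" for \<xi>
    unfolding P_def principal_symbol[OF m(1)] by (rule \<mu>0)
  have normP: "cmod (P \<xi>) \<le> N * norm \<xi> ^ m" for \<xi>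
  proof -
    have "cmod (P \<xi>) \<le> (\<Sum>\<alpha> | length \<alpha> = m. cmod (c \<alpha>) * norm \<xi> ^ m)"
      unfolding P_def
    proof (rule sum_norm_le)
      fix \<alpha> :: "'d list"
      assume "\<alpha> \<in> {\<alpha>. length \<alpha> = m}"
      then have "cmod (monomial \<alpha> (cvec \<xi>)) \<le> norm \<xi> ^ m"
        using norm_monomial_le[of "cvec \<xi>" "norm \<xi>" \<alpha>] by (simp add: component_le_norm_cart)
      then show "cmod (c \<alpha> * monomial \<alpha> (cvec \<xi>)) \<le> cmod (c \<alpha>) * norm \<xi> ^ m"
        by (simp add: norm_mult mult_left_mono)
    qed
    also have "\<dots> \<le> (\<Sum>\<alpha> | length \<alpha> \<le> m. cmod (c \<alpha>) * norm \<xi> ^ m)"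
      by (intro sum_mono2 finite_lists_length_le_UNIV) auto
    finally show ?thesis
      by (simp add: N_def sum_distrib_right)
  qed
  obtain C where C: "C \<ge> 0" "\<And>s r. s \<ge> 0 \<Longrightarrow> r \<ge> 0 \<Longrightarrow>
      N * m * r * (s + r) ^ (m - 1) \<le> \<mu>0 / 4 * s ^ Suc (m - 1) + C * r ^ Suc (m - 1)"
    using absorb_lower_order[of "\<mu>0 / 4" "N * m" "m - 1"] \<mu>0(1) N by auto
  have Suc_m: "Suc (m - 1) = m"
    using m by simp
  \<comment> \<open>This aperture makes the loss from Im w, against the bound N s^m of the principal
    part, at most \<mu>0 / 4; N + 1 avoids a division by 0.\<close>
  have "\<mu>0 / (4 * (N + 1)) > 0"
    using \<mu>0 N by simp
  then obtain \<theta> where \<theta>: "0 < \<theta>" "\<theta> \<le> pi / 2"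
    "\<And>w. w \<in> sector \<theta> \<Longrightarrow> Re w \<ge> 3 / 4 * cmod w \<and> \<bar>Im w\<bar> \<le> \<mu>0 / (4 * (N + 1)) * cmod w"
    using sector_bounds by blast
  show thesis
  proof (rule that[of \<theta> "\<mu>0 / 4" "C + N"])
    show "\<mu>0 / 4 > 0" "C + N \<ge> 0"
      using \<mu>0 C N by auto
    fix z :: "complex ^ 'd" and r :: real
    assume r: "r \<ge> 1" and z: "z \<in> strip (r - 1)"
    define s where "s = norm (re_vec z)"
    have s: "s \<ge> 0"
      by (simp add: s_def)
    have h: "cmod (csymbol m c z) \<le> N * (s + r) ^ m"
      using symbol_perturbation(2)[OF _ z r, of m c] m by (simp add: N_def s_def)
    also have "\<dots> \<le> (C + N) * (s + r) ^ m"
      using C s r by (intro mult_right_mono) auto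
    finally show "cmod (csymbol m c z) \<le> (C + N) * (norm (re_vec z) + r) ^ m"
      by (simp add: s_def)
    fix w
    assume w: "w \<in> sector \<theta>"
    define D where "D = csymbol m c z - P (re_vec z)"
    have "cmod D \<le> N * m * r * (s + r) ^ (m - 1)"
      using symbol_perturbation(1)[OF _ z r, of m c] m by (simp add: N_def s_def D_def P_def)
    also have "\<dots> \<le> \<mu>0 / 4 * s ^ m + C * r ^ m"
      using C(2)[of s r] s r unfolding Suc_m by simp
    finally have D: "cmod D \<le> \<mu>0 / 4 * s ^ m + C * r ^ m" .
    have "cmod w * cmod D \<le> cmod w * (\<mu>0 / 4 * s ^ m + C * r ^ m)"
      by (intro mult_left_mono D) auto
    moreover have "- (cmod w * cmod D) \<le> Re (w * D)"
      using complex_Re_le_cmod[of "- (w * D)"] by (simp add: norm_mult)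
    moreover have "Re (w * P (re_vec z)) \<ge> cmod w * (\<mu>0 / 2 * s ^ m)"
    proof -
      have "Re w \<ge> 0"
        using \<theta>(3)[OF w] norm_ge_zero[of w] by linarith
      then have "Re w * Re (P (re_vec z)) \<ge> 3 / 4 * cmod w * (\<mu>0 * s ^ m)"
        using \<theta>(3)[OF w] ReP[of "re_vec z"] \<mu>0(1) s unfolding s_def
        by (intro mult_mono) auto
      moreover have "Im w * Im (P (re_vec z)) \<le> \<mu>0 / 4 * (cmod w * s ^ m)"
      proof -
        have "Im w * Im (P (re_vec z)) \<le> \<bar>Im w\<bar> * \<bar>Im (P (re_vec z))\<bar>"
          by (metis abs_ge_self abs_mult)
        also have "\<dots> \<le> (\<mu>0 / (4 * (N + 1)) * cmod w) * (N * s ^ m)"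
          using \<theta>(3)[OF w] normP[of "re_vec z"] abs_Im_le_cmod[of "P (re_vec z)"] \<mu>0(1) N unfolding s_def
          by (intro mult_mono) auto
        also have "\<dots> = (\<mu>0 / 4 * (cmod w * s ^ m)) * (N / (N + 1))"
          using N by (simp add: field_simps)
        also have "\<dots> \<le> (\<mu>0 / 4 * (cmod w * s ^ m)) * 1"
          using N \<mu>0 s by (intro mult_left_mono) auto
        finally show ?thesis
          by simp
      qed
      ultimately show ?thesis
        by (simp add: algebra_simps)
    qed
    moreover have "Re (w * csymbol m c z) = Re (w * P (re_vec z)) + Re (w * D)"
      by (simp add: D_def algebra_simps)
    ultimately have "Re (w * csymbol m c z) \<ge> cmod w * (\<mu>0 / 4 * s ^ m - C * r ^ m)"
      by (simp add: algebra_simps)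
    moreover have "cmod w * (\<mu>0 / 4 * s ^ m - (C + N) * r ^ m) \<le> cmod w * (\<mu>0 / 4 * s ^ m - C * r ^ m)"
      using N r by (intro mult_left_mono) (auto simp: algebra_simps)
    ultimately show "Re (w * csymbol m c z) \<ge> cmod w * (\<mu>0 / 4 * norm (re_vec z) ^ m - (C + N) * r ^ m)"
      by (simp add: s_def)
  qed (use \<theta> in auto)
qed

text \<open>For s > 1 the square is completed, using s^2 \<le> s^m; the summand a covers s \<le>
  1.\<close>

lemma linear_le_power:
  fixes a b s :: real
  assumes "b > 0" "a \<ge> 0" "s \<ge> 0" "m \<ge> 2"
  shows "a * s \<le> b * s ^ m + (a + a\<^sup>2 / (4 * b))"
proof (cases "s \<le> 1")
  case True
  then have "a * s \<le> a * 1"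
    using assms by (intro mult_left_mono) auto
  then show ?thesis
    using assms by (smt (verit) divide_nonneg_pos mult_nonneg_nonneg zero_le_power zero_le_power2)
next
  case False
  have "b * s\<^sup>2 \<le> b * s ^ m"
    using False assms by (intro mult_left_mono power_increasing) auto
  moreover have "0 \<le> (2 * b * s - a)\<^sup>2 / (4 * b)"
    using assms by simp
  then have "a * s \<le> b * s\<^sup>2 + a\<^sup>2 / (4 * b)"
    using assms by (simp add: power2_eq_square field_simps)
  ultimately show ?thesis
    using assms by linarith
qed

text \<open>Since m \<ge> 2, a decay like exp(- b s^m) beats every exponential of the 1-norm, at the
  cost of a constant depending on the rate.\<close>

lemma admissibleI_power_decay:
  fixes F :: "complex ^ 'd \<Rightarrow> complex"
  assumes F: "line_holomorphic F" and b: "b > 0" and m: "m \<ge> 2"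
    and bound: "\<And>R. \<exists>B. \<forall>z\<in>strip R. cmod (F z) \<le> B * exp (- (b * norm (re_vec z) ^ m))"
  shows "admissible F"
  unfolding admissible_def
proof (intro conjI allI F)
  fix R c :: real
  obtain B where B: "\<And>z. z \<in> strip R \<Longrightarrow> cmod (F z) \<le> B * exp (- (b * norm (re_vec z) ^ m))"
    using bound[of R] by blast
  define a where "a = \<bar>c\<bar> * CARD('d)"
  define K where "K = a + a\<^sup>2 / (4 * b)"
  have "cmod (F z) \<le> (\<bar>B\<bar> * exp K) * exp (- (c * rl1 z))" if z: "z \<in> strip R" for z
  proof -
    have "c * rl1 z \<le> \<bar>c\<bar> * rl1 z"
      by (intro mult_right_mono) auto
    also have "\<dots> \<le> a * norm (re_vec z)"
      unfolding a_def mult.assoc by (intro mult_left_mono rl1_le_re_vec) auto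
    also have "\<dots> \<le> b * norm (re_vec z) ^ m + K"
      unfolding K_def by (rule linear_le_power) (use b m in \<open>auto simp: a_def\<close>)
    finally have le: "- (b * norm (re_vec z) ^ m) \<le> K + - (c * rl1 z)"
      by simp
    have "cmod (F z) \<le> B * exp (- (b * norm (re_vec z) ^ m))"
      by (rule B[OF z])
    also have "\<dots> \<le> \<bar>B\<bar> * exp (K + - (c * rl1 z))"
      using le by (intro mult_mono) auto
    finally show ?thesis
      unfolding exp_add by (simp only: mult.assoc)
  qed
  then show "\<exists>A. \<forall>z\<in>strip R. cmod (F z) \<le> A * exp (- (c * rl1 z))"
    by blast
qed

text \<open>Trades decay of order m for an exponential whose rate scales like b^(1/m). The constant
  is independent of b because x \<le> x^m + 1 for x = b^(1/m) s. With b proportional to t this is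
  the source of the rate t^(1/m).\<close>

lemma exp_power_le:
  fixes z :: "complex ^ 'd"
  assumes b: "b > 0" and m: "m \<ge> 1"
  shows "exp (- (b * norm (re_vec z) ^ m)) \<le> exp 1 * exp (- (b powr (1 / m) / CARD('d) * rl1 z))"
proof -
  define x where "x = b powr (1 / m) * norm (re_vec z)"
  have x: "x \<ge> 0"
    by (simp add: x_def)
  have "x ^ m = b * norm (re_vec z) ^ m"
    using b m by (simp add: x_def power_mult_distrib powr_realpow[symmetric] powr_powr)
  moreover have "x \<le> x ^ m + 1"
  proof (cases "x \<le> 1")
    case True
    then show ?thesis
      using x by (simp add: add_increasing)
  next
    case False
    then have "x ^ 1 \<le> x ^ m"
      using m by (intro power_increasing) auto
    then show ?thesis
      by simp
  qed
  moreover have "b powr (1 / m) / CARD('d) * rl1 z \<le> x"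
    using mult_left_mono[OF rl1_le_re_vec[of z], of "b powr (1 / m) / CARD('d)"]
    by (simp add: x_def)
  ultimately have "- (b * norm (re_vec z) ^ m) \<le> 1 + - (b powr (1 / m) / CARD('d) * rl1 z)"
    by simp
  then show ?thesis
    by (simp add: exp_add[symmetric])
qed

text \<open>The k-th term of the exponential series at e x^m bounds x^(k m); the m-th root of that
  bound produces the factor (k!)^(1/m) of the seminorm estimate.\<close>

lemma power_le_fact_exp:
  fixes x e :: real
  assumes x: "x \<ge> 0" and e: "e > 0" and m: "m \<ge> 1"
  shows "x ^ k \<le> fact k powr (1 / m) * e powr (- real k / m) * exp (e * x ^ m / m)"
proof -
  have "(e * x ^ m) ^ k / fact k \<le> exp (e * x ^ m)"
  proof -
    have "(\<Sum>n\<in>{k}. (e * x ^ m) ^ n /\<^sub>R fact n) \<le> (\<Sum>n. (e * x ^ m) ^ n /\<^sub>R fact n)"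
      using e x by (intro sum_le_suminf summable_exp_generic) auto
    then show ?thesis
      by (simp add: exp_def divide_inverse mult.commute)
  qed
  then have "(x ^ k) ^ m \<le> fact k * inverse (e ^ k) * exp (e * x ^ m)"
    using e by (simp add: power_mult_distrib power_mult[symmetric] mult.commute[of m] field_simps)
  then have "((x ^ k) ^ m) powr (1 / m) \<le> (fact k * inverse (e ^ k) * exp (e * x ^ m)) powr (1 / m)"
    using x by (intro powr_mono2) auto
  moreover have "((x ^ k) ^ m) powr (1 / m) = x ^ k"
  proof (cases "x ^ k = 0")
    case True
    then show ?thesis
      using m by (simp only: True) (simp add: zero_power)
  next
    case False
    then have "x ^ k > 0"
      using zero_le_power[OF x, of k] by linarith
    then show ?thesis
      using m by (simp add: powr_realpow[symmetric] powr_powr)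
  qed
  moreover have "(fact k * inverse (e ^ k) * exp (e * x ^ m)) powr (1 / m)
      = fact k powr (1 / m) * e powr (- real k / m) * exp (e * x ^ m / m)"
  proof -
    have "inverse (e ^ k) = e powr (- real k)"
      using e by (simp add: powr_minus powr_realpow)
    then show ?thesis
      using e by (simp add: powr_mult powr_powr exp_powr_real)
  qed
  ultimately show ?thesis
    by simp
qed

text \<open>t^(-1/m) is the shift whose m-th power is 1 / t. Adding a constant to it keeps t times
  the m-th power of order 1 + t, so its exponential is a constant times exp(\<omega> t).\<close>

lemma add_le_max_power:
  fixes t w :: real
  assumes t: "t > 0" and w: "w \<ge> 0" and m: "m \<ge> 1"
  shows "t * (w + t powr (- 1 / m)) ^ m \<le> 2 ^ m * (w ^ m * t + 1)"
proof -
  have "(w + t powr (- 1 / m)) ^ m \<le> 2 ^ m * (w ^ m + (t powr (- 1 / m)) ^ m)"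
    using t w by (intro add_power_le) auto
  moreover have "(t powr (- 1 / m)) ^ m = 1 / t"
  proof -
    have "(t powr (- 1 / m)) ^ m = (t powr (- 1 / m)) powr real m"
      using t by (subst powr_realpow) auto
    also have "\<dots> = t powr (- 1 / m * m)"
      by (rule powr_powr)
    also have "- 1 / real m * m = - 1"
      using m by simp
    finally show ?thesis
      using t by (simp add: powr_neg_one)
  qed
  ultimately have "t * (w + t powr (- 1 / m)) ^ m \<le> t * (2 ^ m * (w ^ m + 1 / t))"
    using t by (intro mult_left_mono) auto
  also have "t * (2 ^ m * (w ^ m + 1 / t)) = 2 ^ m * (w ^ m * t + 1)"
    using t by (simp add: field_simps)
  finally show ?thesis .
qed

lemma exp_taylor1: "cmod (exp u - 1 - u) \<le> (cmod u)\<^sup>2 * exp (cmod u)"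
proof -
  have "(\<lambda>n. u ^ (n + 2) /\<^sub>R fact (n + 2)) sums (exp u - (\<Sum>i<2. u ^ i /\<^sub>R fact i))"
    by (rule sums_split_initial_segment[OF exp_converges])
  then have s: "(\<lambda>n. u ^ (n + 2) /\<^sub>R fact (n + 2)) sums (exp u - 1 - u)"
    by (simp add: numeral_2_eq_2 algebra_simps)
  have e: "(\<lambda>n. (cmod u)\<^sup>2 * (cmod u ^ n /\<^sub>R fact n)) sums ((cmod u)\<^sup>2 * exp (cmod u))"
    by (intro sums_mult exp_converges)
  have le: "cmod (u ^ (n + 2) /\<^sub>R fact (n + 2)) \<le> (cmod u)\<^sup>2 * (cmod u ^ n /\<^sub>R fact n)" for n
  proof -
    have "cmod (u ^ (n + 2) /\<^sub>R fact (n + 2)) = (cmod u)\<^sup>2 * cmod u ^ n * inverse (fact (n + 2))"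
      by (simp add: norm_power norm_mult power_add power2_eq_square)
    also have "\<dots> \<le> (cmod u)\<^sup>2 * cmod u ^ n * inverse (fact n)"
      by (intro mult_left_mono le_imp_inverse_le fact_mono) auto
    finally show ?thesis
      by (simp add: mult_ac)
  qed
  have "cmod (exp u - 1 - u) = cmod (\<Sum>n. u ^ (n + 2) /\<^sub>R fact (n + 2))"
    using s by (simp add: sums_iff)
  also have "\<dots> \<le> (\<Sum>n. (cmod u)\<^sup>2 * (cmod u ^ n /\<^sub>R fact n))"
    by (rule norm_suminf_le[OF le]) (use e in \<open>auto simp: sums_iff\<close>)
  also have "\<dots> = (cmod u)\<^sup>2 * exp (cmod u)"
    using e by (simp add: sums_iff)
  finally show ?thesis .
qed

lemma power2_le_exp:
  fixes x d :: real
  assumes "x \<ge> 0" "d > 0"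
  shows "x\<^sup>2 \<le> 2 / d\<^sup>2 * exp (d * x)"
proof -
  have "1 + d * x + (d * x)\<^sup>2 / 2 \<le> exp (d * x)"
    using assms by (intro exp_lower_Taylor_quadratic) auto
  then have "(d * x)\<^sup>2 \<le> 2 * exp (d * x)"
    using assms by (smt (verit) field_sum_of_halves mult_nonneg_nonneg)
  then show ?thesis
    using assms by (simp add: power_mult_distrib field_simps)
qed

text \<open>The two estimates are all that is used of ellipticity from here on. They hold for
  complex times w and on complex strips at once, with r - 1 the half-width of the strip.\<close>

locale sectorial_symbol =
  fixes m :: nat and c :: "'d::finite list \<Rightarrow> complex" and \<theta> \<mu> C :: real
  assumes m: "m \<ge> 2" and theta: "0 < \<theta>" "\<theta> \<le> pi / 2" and mu: "\<mu> > 0" and C: "C \<ge> 0"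
    and lower: "\<And>w z r. w \<in> sector \<theta> \<Longrightarrow> r \<ge> 1 \<Longrightarrow> z \<in> strip (r - 1) \<Longrightarrow>
      Re (w * csymbol m c z) \<ge> cmod w * (\<mu> * norm (re_vec z) ^ m - C * r ^ m)"
    and upper: "\<And>z r. r \<ge> 1 \<Longrightarrow> z \<in> strip (r - 1) \<Longrightarrow>
      cmod (csymbol m c z) \<le> C * (norm (re_vec z) + r) ^ m"
begin

definition heat :: "complex \<Rightarrow> complex ^ 'd \<Rightarrow> complex"
  where "heat w z = exp (- w * csymbol m c z)"

lemma heat_add: "heat (w + v) z = heat w z * heat v z"
  by (simp add: heat_def exp_add[symmetric] algebra_simps)

lemma of_real_in_sector: "t > 0 \<Longrightarrow> complex_of_real t \<in> sector \<theta>"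
  using theta by (simp add: sector_def)

lemma sector_nonzero: "w \<in> sector \<theta> \<Longrightarrow> cmod w > 0"
  by (simp add: sector_def)

lemma heat_bound:
  assumes "w \<in> sector \<theta>" "r \<ge> 1" "z \<in> strip (r - 1)"
  shows "cmod (heat w z) \<le> exp (cmod w * C * r ^ m) * exp (- (cmod w * \<mu> * norm (re_vec z) ^ m))"
proof -
  have "cmod (heat w z) \<le> exp (- (cmod w * (\<mu> * norm (re_vec z) ^ m - C * r ^ m)))"
    using lower[OF assms] by (simp add: heat_def)
  then show ?thesis
    by (simp add: exp_add[symmetric] algebra_simps)
qed

lemma line_holomorphic_heat: "line_holomorphic (heat w)"
  using tame_csymbol[of m c] unfolding heat_def[abs_def] tame_def
  by (intro line_holomorphic_exp line_holomorphic_mult line_holomorphic_const) simp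

lemma strip_mono: "R \<le> R' \<Longrightarrow> z \<in> strip R \<Longrightarrow> z \<in> strip R'"
  by (auto simp: strip_def intro: order_trans)

text \<open>The symbol has the same order as the decay exponent of \<open>heat w\<close>, so a small
  multiple of |h| is paid for by half of that decay. Of the factor 2 d, one d serves a perturbation
  exp(- v h), the other the square of h in Taylor's formula.\<close>

lemma heat_perturbation:
  assumes w: "w \<in> sector \<theta>"
  obtains d where "d > 0"
    "\<And>R. \<exists>A\<ge>0. \<forall>z\<in>strip R. exp (2 * d * cmod (csymbol m c z)) * cmod (heat w z)
      \<le> A * exp (- (cmod w * \<mu> / 2 * norm (re_vec z) ^ m))"
proof -
  define D where "D = (C + 1) * 2 ^ m"
  have D: "D > 0"
    using C by (simp add: D_def)
  \<comment> \<open>By \<open>upper\<close> and \<open>add_power_le\<close>, 2 d |h| is at most 2 d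
    D (s^m + r^m), and 2 d D is half of |w| \<mu>.\<close>
  define d where "d = cmod w * \<mu> / (4 * D)"
  have d: "d > 0"
    using sector_nonzero[OF w] mu D by (simp add: d_def)
  have d2: "2 * d * C * 2 ^ m \<le> cmod w * \<mu> / 2"
  proof -
    have "2 * d * C * 2 ^ m \<le> 2 * d * D"
      using d by (simp add: D_def)
    also have "\<dots> = cmod w * \<mu> / 2"
      using D by (simp add: d_def)
    finally show ?thesis .
  qed
  show thesis
  proof (rule that[OF d])
    fix R :: real
    define r where "r = \<bar>R\<bar> + 1"
    define A where "A = exp (cmod w * C * r ^ m + cmod w * \<mu> / 2 * r ^ m)"
    have r: "r \<ge> 1"
      by (simp add: r_def)
    have "exp (2 * d * cmod (csymbol m c z)) * cmod (heat w z)
        \<le> A * exp (- (cmod w * \<mu> / 2 * norm (re_vec z) ^ m))" if "z \<in> strip R" for z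
    proof -
      define s where "s = norm (re_vec z)"
      have z: "z \<in> strip (r - 1)"
        by (rule strip_mono[OF _ that]) (simp add: r_def)
      have "2 * d * cmod (csymbol m c z) \<le> 2 * d * (C * (2 ^ m * (s ^ m + r ^ m)))"
        using d C upper[OF r z] add_power_le[of s r m] r
        by (intro mult_left_mono) (auto simp: s_def intro: order_trans mult_left_mono)
      also have "\<dots> = (2 * d * C * 2 ^ m) * (s ^ m + r ^ m)"
        by (simp add: mult_ac)
      also have "\<dots> \<le> (cmod w * \<mu> / 2) * (s ^ m + r ^ m)"
        using d2 r by (intro mult_right_mono) (auto simp: s_def)
      finally have "exp (2 * d * cmod (csymbol m c z)) * cmod (heat w z)
          \<le> exp ((cmod w * \<mu> / 2) * (s ^ m + r ^ m))
            * (exp (cmod w * C * r ^ m) * exp (- (cmod w * \<mu> * s ^ m)))"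
        using heat_bound[OF w r z] by (intro mult_mono) (auto simp: s_def)
      also have "\<dots> = exp ((cmod w * C * r ^ m + cmod w * \<mu> / 2 * r ^ m) + - (cmod w * \<mu> / 2 * s ^ m))"
        unfolding exp_add[symmetric] by (simp add: algebra_simps)
      finally show ?thesis
        unfolding A_def s_def exp_add .
    qed
    moreover have "A \<ge> 0"
      by (simp add: A_def)
    ultimately show "\<exists>A\<ge>0. \<forall>z\<in>strip R. exp (2 * d * cmod (csymbol m c z)) * cmod (heat w z)
        \<le> A * exp (- (cmod w * \<mu> / 2 * norm (re_vec z) ^ m))"
      by blast
  qed
qed

text \<open>Both claims concern heat w times an entire function of v h, whose growth the decay of
  heat w absorbs for |v| \<le> d; whether w + v stays in the sector is not asked. The quadratic
  remainder will give the derivative of the semigroup, and v = 0 shows that heat w is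
  admissible.\<close>

lemma admissible_heat_near:
  assumes w: "w \<in> sector \<theta>"
  obtains d where "d > 0" "\<And>v. cmod v \<le> d \<Longrightarrow> admissible (heat (w + v))"
    "\<And>R. \<exists>A\<ge>0. \<forall>v. cmod v \<le> d \<longrightarrow> (\<forall>z\<in>strip R.
      cmod (heat (w + v) z - heat w z + v * csymbol m c z * heat w z) \<le> (cmod v)\<^sup>2 * A * exp (- rl1 z))"
proof -
  obtain d where d: "d > 0" "\<And>R. \<exists>A\<ge>0. \<forall>z\<in>strip R. exp (2 * d * cmod (csymbol m c z)) * cmod (heat w z)
      \<le> A * exp (- (cmod w * \<mu> / 2 * norm (re_vec z) ^ m))"
    using heat_perturbation[OF w] by metis
  define b where "b = cmod w * \<mu> / 2"
  have b: "b > 0"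
    using sector_nonzero[OF w] mu by (simp add: b_def)
  show thesis
  proof (rule that[OF d(1)])
    fix v
    assume v: "cmod v \<le> d"
    show "admissible (heat (w + v))"
    proof (rule admissibleI_power_decay[OF line_holomorphic_heat b m])
      fix R :: real
      obtain A where A: "A \<ge> 0" "\<And>z. z \<in> strip R \<Longrightarrow>
          exp (2 * d * cmod (csymbol m c z)) * cmod (heat w z) \<le> A * exp (- (b * norm (re_vec z) ^ m))"
        using d(2)[of R] by (auto simp: b_def)
      have "cmod (heat (w + v) z) \<le> A * exp (- (b * norm (re_vec z) ^ m))" if z: "z \<in> strip R" for z
      proof -
        have "Re (- v * csymbol m c z) \<le> cmod v * cmod (csymbol m c z)"
          by (metis complex_Re_le_cmod norm_mult norm_minus_cancel)
        also have "\<dots> \<le> 2 * d * cmod (csymbol m c z)"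
          using v d(1) by (intro mult_right_mono) auto
        finally have "cmod (heat (w + v) z) \<le> cmod (heat w z) * exp (2 * d * cmod (csymbol m c z))"
          unfolding heat_add norm_mult heat_def[of v] norm_exp_eq_Re by (intro mult_left_mono) auto
        then show ?thesis
          using A(2)[OF z] by (simp add: mult.commute)
      qed
      then show "\<exists>B. \<forall>z\<in>strip R. cmod (heat (w + v) z) \<le> B * exp (- (b * norm (re_vec z) ^ m))"
        by blast
    qed
  next
    fix R :: real
    obtain A where A: "A \<ge> 0" "\<And>z. z \<in> strip R \<Longrightarrow>
        exp (2 * d * cmod (csymbol m c z)) * cmod (heat w z) \<le> A * exp (- (b * norm (re_vec z) ^ m))"
      using d(2)[of R] by (auto simp: b_def)
    \<comment> \<open>The constant of \<open>linear_le_power\<close> for slope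
      \<open>CARD('d)\<close> and decay b, which converts exp(- b s^m) into exp(- rl1 z).\<close>
    define K where "K = CARD('d) + (real CARD('d))\<^sup>2 / (4 * b)"
    have "cmod (heat (w + v) z - heat w z + v * csymbol m c z * heat w z)
        \<le> (cmod v)\<^sup>2 * (2 / d\<^sup>2 * A * exp K) * exp (- rl1 z)"
      if v: "cmod v \<le> d" and z: "z \<in> strip R" for v z
    proof -
      define u where "u = - v * csymbol m c z"
      have "heat (w + v) z - heat w z + v * csymbol m c z * heat w z = heat w z * (exp u - 1 - u)"
        unfolding heat_add heat_def[of v] u_def by (simp add: algebra_simps)
      then have "cmod (heat (w + v) z - heat w z + v * csymbol m c z * heat w z)
          \<le> cmod (heat w z) * ((cmod u)\<^sup>2 * exp (cmod u))"
        using exp_taylor1[of u] by (simp add: norm_mult mult_left_mono)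
      also have "cmod (heat w z) * ((cmod u)\<^sup>2 * exp (cmod u))
          \<le> cmod (heat w z) * ((cmod v)\<^sup>2 * (2 / d\<^sup>2) * exp (2 * d * cmod (csymbol m c z)))"
      proof (rule mult_left_mono)
        have "(cmod u)\<^sup>2 * exp (cmod u)
          \<le> (cmod v)\<^sup>2 * (2 / d\<^sup>2 * exp (d * cmod (csymbol m c z))) * exp (d * cmod (csymbol m c z))"
        unfolding u_def norm_mult norm_minus_cancel power_mult_distrib
        using v d(1) power2_le_exp[of "cmod (csymbol m c z)" d]
        by (intro mult_mono) (auto intro!: mult_right_mono)
        also have "\<dots> = (cmod v)\<^sup>2 * (2 / d\<^sup>2) * exp (2 * d * cmod (csymbol m c z))"
          by (simp add: exp_add[symmetric] mult.assoc)
        finally show "(cmod u)\<^sup>2 * exp (cmod u) \<le> (cmod v)\<^sup>2 * (2 / d\<^sup>2) * exp (2 * d * cmod (csymbol m c z))" .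
      qed simp
      finally have "cmod (heat (w + v) z - heat w z + v * csymbol m c z * heat w z)
          \<le> (cmod v)\<^sup>2 * (2 / d\<^sup>2) * (exp (2 * d * cmod (csymbol m c z)) * cmod (heat w z))"
        by (simp only: mult_ac)
      also have "\<dots> \<le> (cmod v)\<^sup>2 * (2 / d\<^sup>2) * (A * exp (K + - rl1 z))"
      proof (intro mult_left_mono)
        have "rl1 z \<le> CARD('d) * norm (re_vec z)"
          by (rule rl1_le_re_vec)
        also have "\<dots> \<le> b * norm (re_vec z) ^ m + K"
          unfolding K_def by (rule linear_le_power) (use b m in auto)
        finally have "- (b * norm (re_vec z) ^ m) \<le> K + - rl1 z"
          by simp
        then have "A * exp (- (b * norm (re_vec z) ^ m)) \<le> A * exp (K + - rl1 z)"
          using A(1) by (intro mult_left_mono) auto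
        with A(2)[OF z] show "exp (2 * d * cmod (csymbol m c z)) * cmod (heat w z) \<le> A * exp (K + - rl1 z)"
          by (rule order_trans)
      qed auto
      finally show ?thesis
        unfolding exp_add by (simp only: mult.assoc)
    qed
    moreover have "2 / d\<^sup>2 * A * exp K \<ge> 0"
      using A(1) by simp
    ultimately show "\<exists>A\<ge>0. \<forall>v. cmod v \<le> d \<longrightarrow> (\<forall>z\<in>strip R.
      cmod (heat (w + v) z - heat w z + v * csymbol m c z * heat w z) \<le> (cmod v)\<^sup>2 * A * exp (- rl1 z))"
      by blast
  qed
qed

lemma admissible_heat:
  assumes "w \<in> sector \<theta>"
  shows "admissible (heat w)"
  using admissible_heat_near[OF assms] by (metis add_0_right norm_zero less_imp_le)

text \<open>The decay exp(- t \<mu> s^m), t = |w|, is split: one half pays for the monomial through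
  \<open>power_le_fact_exp\<close>, the other remains as decay of rate \<gamma> t^(1/m). With r = W
  + 2 + t^(-1/m) the terms in t r^m cost L (1 + (W + 2)^m t), which explains a and \<omega>. The
  strip exceeds W by 1 + t^(-1/m), which is the margin over the growth of U. All constants are
  independent of w and \<alpha>.\<close>

lemma monomial_heat_bound:
  assumes W: "W \<ge> 0"
  obtains a b \<omega> \<gamma> where "a > 0" "b > 0" "\<omega> \<ge> 0" "\<gamma> > 0"
    "\<And>w \<alpha> z. w \<in> sector \<theta> \<Longrightarrow> z \<in> strip (W + 1 + cmod w powr (- 1 / m)) \<Longrightarrow>
      cmod (monomial \<alpha> z * heat w z)
        \<le> (a * b ^ length \<alpha> * cmod w powr (- real (length \<alpha>) / m) * fact (length \<alpha>) powr (1 / m)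
            * exp (\<omega> * cmod w)) * exp (- (\<gamma> * cmod w powr (1 / m) * rl1 z))"
proof -
  define L where "L = (\<mu> / 2 + C) * 2 ^ m"
  define a where "a = exp (1 + L)"
  \<comment> \<open>Chosen so that the exponent t B (s + r)^m / m left by
    \<open>power_le_fact_exp\<close> is at most t (\<mu> / 2) (s^m + r^m).\<close>
  define B where "B = m * \<mu> / 2 ^ Suc m"
  define b where "b = B powr (- 1 / m)"
  define \<omega> where "\<omega> = L * (W + 2) ^ m"
  define \<gamma> where "\<gamma> = (\<mu> / 2) powr (1 / m) / CARD('d)"
  have B: "B > 0"
    using m mu by (simp add: B_def)
  have L: "L \<ge> 0"
    using mu C by (simp add: L_def)
  show thesis
  proof (rule that[of a b \<omega> \<gamma>])
    show "a > 0" "b > 0" "\<omega> \<ge> 0" "\<gamma> > 0"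
      using B L W mu by (auto simp: a_def b_def \<omega>_def \<gamma>_def)
    fix w and z :: "complex ^ 'd" and \<alpha> :: "'d list"
    assume w: "w \<in> sector \<theta>" and z: "z \<in> strip (W + 1 + cmod w powr (- 1 / m))"
    define k where "k = length \<alpha>"
    define t where "t = cmod w"
    define r where "r = (W + 2) + t powr (- 1 / m)"
    define s where "s = norm (re_vec z)"
    have t: "t > 0"
      using sector_nonzero[OF w] by (simp add: t_def)
    have r: "r \<ge> 1"
      using W by (simp add: r_def add_increasing2)
    have z': "z \<in> strip (r - 1)"
    proof -
      have "r - 1 = W + 1 + cmod w powr (- 1 / m)"
        by (simp add: r_def t_def)
      then show ?thesis
        using z by (simp only:)
    qed
    have s: "s \<ge> 0"
      by (simp add: s_def)
    have zk: "cmod (z $ j) \<le> s + r" for j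
      using strip_nth_le(1)[OF z', of j] by (simp add: s_def)
    have tr: "t * r ^ m \<le> 2 ^ m * ((W + 2) ^ m * t + 1)"
      unfolding r_def using t W m by (intro add_le_max_power) auto
    have "cmod (monomial \<alpha> z) \<le> (s + r) ^ k"
      unfolding k_def by (rule norm_monomial_le) (use zk s r in auto)
    also have "\<dots> \<le> fact k powr (1 / m) * (t * B) powr (- real k / m) * exp (t * B * (s + r) ^ m / m)"
      using s r t B m by (intro power_le_fact_exp) auto
    also have "\<dots> = (b ^ k * t powr (- real k / m) * fact k powr (1 / m)) * exp (t * B * (s + r) ^ m / m)"
    proof -
      have "b ^ k = B powr (- real k / m)"
        unfolding b_def using B by (simp add: powr_realpow[symmetric] powr_powr)
      then show ?thesis
        using t B by (simp add: powr_mult)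
    qed
    also have "\<dots> \<le> (b ^ k * t powr (- real k / m) * fact k powr (1 / m)) * exp (t * (\<mu> / 2) * (s ^ m + r ^ m))"
    proof (intro mult_left_mono exp_le_cancel_iff[THEN iffD2])
      have "t * B * (s + r) ^ m / m = t * \<mu> / 2 ^ Suc m * (s + r) ^ m"
        using m by (simp add: B_def)
      also have "\<dots> \<le> t * \<mu> / 2 ^ Suc m * (2 ^ m * (s ^ m + r ^ m))"
        using s r t mu by (intro mult_left_mono add_power_le) auto
      also have "\<dots> = t * (\<mu> / 2) * (s ^ m + r ^ m)"
        by simp
      finally show "t * B * (s + r) ^ m / m \<le> t * (\<mu> / 2) * (s ^ m + r ^ m)" .
    qed (simp add: b_def)
    finally have mono: "cmod (monomial \<alpha> z)
        \<le> (b ^ k * t powr (- real k / m) * fact k powr (1 / m)) * exp (t * (\<mu> / 2) * (s ^ m + r ^ m))" .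
    define Q where "Q = b ^ k * t powr (- real k / m) * fact k powr (1 / m)"
    have Q: "Q \<ge> 0"
      by (simp add: Q_def b_def)
    have "cmod (monomial \<alpha> z * heat w z)
        \<le> (Q * exp (t * (\<mu> / 2) * (s ^ m + r ^ m))) * (exp (t * C * r ^ m) * exp (- (t * \<mu> * s ^ m)))"
      unfolding norm_mult Q_def t_def s_def
      by (intro mult_mono mono[unfolded t_def s_def] heat_bound[OF w r z']) (auto simp: b_def)
    also have "\<dots> = Q * exp (t * (\<mu> / 2) * (s ^ m + r ^ m) + (t * C * r ^ m + - (t * \<mu> * s ^ m)))"
      unfolding exp_add by (simp only: mult.assoc)
    also have "t * (\<mu> / 2) * (s ^ m + r ^ m) + (t * C * r ^ m + - (t * \<mu> * s ^ m))
        = (\<mu> / 2 + C) * (t * r ^ m) + - (t * (\<mu> / 2) * s ^ m)"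
      by (simp add: algebra_simps)
    also have "Q * exp \<dots> \<le> Q * (exp (L + \<omega> * t) * (exp 1 * exp (- (\<gamma> * t powr (1 / m) * rl1 z))))"
      unfolding exp_add
    proof (intro mult_left_mono mult_mono)
      have "(\<mu> / 2 + C) * (t * r ^ m) \<le> (\<mu> / 2 + C) * (2 ^ m * ((W + 2) ^ m * t + 1))"
        using mu C by (intro mult_left_mono tr) auto
      then have "exp ((\<mu> / 2 + C) * (t * r ^ m)) \<le> exp (L + \<omega> * t)"
        by (simp add: L_def \<omega>_def algebra_simps)
      then show "exp ((\<mu> / 2 + C) * (t * r ^ m)) \<le> exp L * exp (\<omega> * t)"
        by (simp add: exp_add)
      have "exp (- (t * (\<mu> / 2) * s ^ m)) \<le> exp 1 * exp (- ((t * (\<mu> / 2)) powr (1 / m) / CARD('d) * rl1 z))"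
        unfolding s_def using t mu m by (intro exp_power_le) auto
      moreover have "(t * (\<mu> / 2)) powr (1 / m) / CARD('d) = \<gamma> * t powr (1 / m)"
        unfolding \<gamma>_def by (subst powr_mult) (use t mu in auto)
      ultimately show "exp (- (t * (\<mu> / 2) * s ^ m)) \<le> exp 1 * exp (- (\<gamma> * t powr (1 / m) * rl1 z))"
        by (simp only:)
    qed (use Q in auto)
    finally show "cmod (monomial \<alpha> z * heat w z)
        \<le> (a * b ^ length \<alpha> * cmod w powr (- real (length \<alpha>) / m) * fact (length \<alpha>) powr (1 / m)
            * exp (\<omega> * cmod w)) * exp (- (\<gamma> * cmod w powr (1 / m) * rl1 z))"
      unfolding Q_def t_def k_def a_def exp_add by (simp only: mult_ac)
  qed
qed

end

text \<open>The second-order remainder of the symbol of U in the k-th direction, prepared for the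
  difference quotient that defines X_k.\<close>

lemma modulation_taylor:
  assumes F: "admissible F"
  shows "\<exists>A\<ge>0. \<forall>t. \<bar>t\<bar> \<le> 1 \<longrightarrow> (\<forall>z\<in>strip R.
    cmod ((exp (- \<i> * complex_of_real t * z $ k) - 1 - - \<i> * complex_of_real t * z $ k) * F z)
      \<le> t\<^sup>2 * A * exp (- rl1 z))"
proof -
  \<comment> \<open>Rate 3, since the Taylor remainder of the exponential may grow like exp(2 rl1 z)
    and exp(- rl1 z) has to survive.\<close>
  obtain A where A: "A \<ge> 0" "\<And>z. z \<in> strip R \<Longrightarrow> cmod (F z) \<le> A * exp (- (3 * rl1 z))"
    using admissible_bound[OF F, of R 3] by metis
  have "cmod ((exp (- \<i> * complex_of_real t * z $ k) - 1 - - \<i> * complex_of_real t * z $ k) * F z)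
      \<le> t\<^sup>2 * (2 * exp (2 * \<bar>R\<bar>) * A) * exp (- rl1 z)"
    if t: "\<bar>t\<bar> \<le> 1" and z: "z \<in> strip R" for t z
  proof -
    define u where "u = - \<i> * complex_of_real t * z $ k"
    have u: "cmod u = \<bar>t\<bar> * cmod (z $ k)"
      by (simp add: u_def norm_mult)
    have "\<bar>Re (z $ k)\<bar> \<le> rl1 z"
      unfolding rl1_def by (rule member_le_sum) auto
    moreover have "\<bar>Im (z $ k)\<bar> \<le> \<bar>R\<bar>"
      using z unfolding strip_def by (auto intro: order_trans)
    ultimately have zk: "cmod (z $ k) \<le> rl1 z + \<bar>R\<bar>"
      using cmod_le[of "z $ k"] by linarith
    have "cmod (exp u - 1 - u) \<le> (cmod u)\<^sup>2 * exp (cmod u)"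
      by (rule exp_taylor1)
    also have "\<dots> \<le> (t\<^sup>2 * (2 / 1\<^sup>2 * exp (1 * cmod (z $ k)))) * exp (cmod (z $ k))"
      unfolding u power_mult_distrib power2_abs
      using t mult_right_mono[of "\<bar>t\<bar>" 1 "cmod (z $ k)"]
      by (intro mult_mono power2_le_exp) auto
    also have "\<dots> = t\<^sup>2 * (2 * exp (2 * cmod (z $ k)))"
      by (simp add: exp_add[symmetric])
    also have "\<dots> \<le> t\<^sup>2 * (2 * exp (2 * \<bar>R\<bar> + 2 * rl1 z))"
      using zk by (intro mult_left_mono) auto
    finally have "cmod (exp u - 1 - u) \<le> t\<^sup>2 * (2 * exp (2 * \<bar>R\<bar> + 2 * rl1 z))" .
    then have "cmod ((exp u - 1 - u) * F z)
        \<le> (t\<^sup>2 * (2 * exp (2 * \<bar>R\<bar> + 2 * rl1 z))) * (A * exp (- (3 * rl1 z)))"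
      unfolding norm_mult by (intro mult_mono A(2) z) auto
    also have "\<dots> = t\<^sup>2 * (2 * A * exp (2 * \<bar>R\<bar> + 2 * rl1 z + - (3 * rl1 z)))"
      unfolding exp_add by (simp add: mult_ac)
    also have "2 * \<bar>R\<bar> + 2 * rl1 z + - (3 * rl1 z) = 2 * \<bar>R\<bar> + - rl1 z"
      by simp
    finally show ?thesis
      unfolding exp_add u_def[symmetric] by (simp add: mult_ac)
  qed
  moreover have "2 * exp (2 * \<bar>R\<bar>) * A \<ge> 0"
    using A(1) by simp
  ultimately show ?thesis
    by blast
qed

section \<open>Functional calculus of a group representation\<close>

text \<open>Continuity makes integrals over boxes exist for vector-valued integrands; integrability
  against the weight makes the integral over the whole space converge absolutely despite the growth
  of U.\<close>

definition exp_integrable :: "real \<Rightarrow> (real ^ 'd \<Rightarrow> complex) \<Rightarrow> bool"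
  where "exp_integrable W G \<longleftrightarrow>
    continuous_on UNIV G \<and> integrable lborel (\<lambda>y. cmod (G y) * exp (W * l1norm y))"

lemma exp_integrable_fourier_inv: "admissible F \<Longrightarrow> exp_integrable W (fourier_inv F)"
  by (simp add: exp_integrable_def continuous_fourier_inv integrable_fourier_inv_weighted)

text \<open>
  Common frame of the two alternatives. \<open>T\<close> is the topology of uniform convergence on the sets of
  functionals in \<open>\<Lambda>\<close>: for the norm topology these are the balls of the dual, for the weak* topology
  the singletons of the predual. All identities are checked on functionals.
\<close>

locale functional_group =
  fixes U :: "real ^ 'd \<Rightarrow> 'a::complex_banach \<Rightarrow> 'a"
    and T :: "'a topology"
    and \<Lambda> :: "('a \<Rightarrow> complex) set set"
    and M W :: real
  assumes rep: "representation U"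
    and topspace: "topspace T = UNIV"
    and hausdorff: "Hausdorff_space T"
    and limitin_id: "\<And>l F. limitin T (\<lambda>x. x) l F \<longleftrightarrow>
      (\<forall>S\<in>\<Lambda>. \<forall>e>0. \<forall>\<^sub>F x in F. \<forall>f\<in>S. cmod (f (x - l)) \<le> e)"
    and functional: "\<And>f. f \<in> \<Union>\<Lambda> \<Longrightarrow> bounded_clinear f"
    and equibounded: "\<And>S. S \<in> \<Lambda> \<Longrightarrow> \<exists>K\<ge>0. \<forall>f\<in>S. \<forall>x. cmod (f x) \<le> K * norm x"
    and norming: "\<And>x r. (\<And>f. f \<in> \<Union>\<Lambda> \<Longrightarrow> (\<And>y. cmod (f y) \<le> norm y) \<Longrightarrow> cmod (f x) \<le> r) \<Longrightarrow> norm x \<le> r"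
    and invariant: "\<And>f x. f \<in> \<Union>\<Lambda> \<Longrightarrow> (\<lambda>\<phi>. f (U x \<phi>)) \<in> \<Union>\<Lambda>"
    and M: "M \<ge> 0" and W: "W \<ge> 0"
    and growth: "\<And>x \<phi>. norm (U x \<phi>) \<le> M * exp (W * l1norm x) * norm \<phi>"
    and continuous_at_0: "\<And>\<phi>. limitin T (\<lambda>x. U x \<phi>) \<phi> (at 0)"
begin

lemma U_linear: "bounded_clinear (U x)"
  and U_zero: "U 0 \<phi> = \<phi>"
  and U_add: "U (x + y) \<phi> = U x (U y \<phi>)"
  using rep by (simp_all add: representation_def)

lemma limitin_iff:
  "limitin T g l F \<longleftrightarrow> (\<forall>S\<in>\<Lambda>. \<forall>e>0. \<forall>\<^sub>F x in F. \<forall>f\<in>S. cmod (f (g x - l)) \<le> e)"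
proof -
  have "limitin T g l F \<longleftrightarrow> limitin T (\<lambda>x. x) l (filtermap g F)"
    by (simp add: limitin_def eventually_filtermap)
  then show ?thesis
    by (simp add: limitin_id eventually_filtermap)
qed

lemma limitinI_norm:
  assumes "((\<lambda>x. norm (g x - l)) \<longlongrightarrow> 0) F"
  shows "limitin T g l F"
  unfolding limitin_iff
proof (intro ballI allI impI)
  fix S and e :: real
  assume S: "S \<in> \<Lambda>" and e: "e > 0"
  obtain K where K: "K \<ge> 0" "\<And>f x. f \<in> S \<Longrightarrow> cmod (f x) \<le> K * norm x"
    using equibounded[OF S] by blast
  have "\<forall>\<^sub>F x in F. norm (g x - l) < e / (K + 1)"
    using assms by (rule order_tendstoD) (use e K in auto)
  then show "\<forall>\<^sub>F x in F. \<forall>f\<in>S. cmod (f (g x - l)) \<le> e"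
  proof eventually_elim
    case (elim x)
    have "K * norm (g x - l) \<le> K * (e / (K + 1))"
      using elim K by (intro mult_left_mono) auto
    also have "\<dots> \<le> (K + 1) * (e / (K + 1))"
      using e K by (intro mult_right_mono) auto
    also have "\<dots> = e"
      using K by simp
    finally show ?case
      using K(2) by (meson order_trans)
  qed
qed

lemma limitin_unique:
  "limitin T g l F \<Longrightarrow> limitin T g l' F \<Longrightarrow> F \<noteq> bot \<Longrightarrow> l = l'"
  by (rule limitin_Hausdorff_unique[OF _ _ _ hausdorff])

lemma separating:
  assumes "\<And>f. f \<in> \<Union>\<Lambda> \<Longrightarrow> f x = f y"
  shows "x = y"
proof -
  have "norm (x - y) \<le> 0"
    by (rule norming) (use assms in \<open>simp add: bounded_clinear_diff functional\<close>)
  then show ?thesis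
    by simp
qed

text \<open>Continuity at x is continuity at 0 for the functional
  \<open>\<lambda>\<phi>. f (U x \<phi>)\<close>, which is again in \<open>\<Union>\<Lambda>\<close>
  by \<open>invariant\<close>.\<close>

lemma continuous_functional_orbit:
  assumes f: "f \<in> \<Union>\<Lambda>"
  shows "continuous_on UNIV (\<lambda>x. f (U x \<phi>))"
  unfolding continuous_on_eq_continuous_at[OF open_UNIV] isCont_iff
proof
  fix x
  define f' where "f' \<phi> = f (U x \<phi>)" for \<phi>
  have f': "f' \<in> \<Union>\<Lambda>"
    unfolding f'_def using invariant[OF f] .
  then obtain S where S: "S \<in> \<Lambda>" "f' \<in> S"
    by blast
  have diff: "f (U (x + h) \<phi>) - f (U x \<phi>) = f' (U h \<phi> - \<phi>)" for h
    unfolding f'_def by (simp add: U_add bounded_clinear_diff[OF U_linear] bounded_clinear_diff[OF functional[OF f]])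
  show "(\<lambda>h. f (U (x + h) \<phi>)) \<midarrow>0\<rightarrow> f (U x \<phi>)"
    unfolding tendsto_iff dist_norm diff
  proof (intro allI impI)
    fix e :: real
    assume "e > 0"
    then have "\<forall>\<^sub>F h in at 0. \<forall>f\<in>S. cmod (f (U h \<phi> - \<phi>)) \<le> e / 2"
      using continuous_at_0[of \<phi>] S(1) unfolding limitin_iff by (meson half_gt_zero)
    then show "\<forall>\<^sub>F h in at 0. cmod (f' (U h \<phi> - \<phi>)) < e"
      by eventually_elim (use S(2) \<open>e > 0\<close> in force)
  qed
qed

lemma functional_orbit_bound:
  assumes "f \<in> \<Union>\<Lambda>" "\<And>y. cmod (f y) \<le> K * norm y" "K \<ge> 0"
  shows "cmod (f (U y \<phi>)) \<le> K * M * norm \<phi> * exp (W * l1norm y)"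
proof -
  have "cmod (f (U y \<phi>)) \<le> K * (M * exp (W * l1norm y) * norm \<phi>)"
    using assms(2)[of "U y \<phi>"] mult_left_mono[OF growth[of y \<phi>] assms(3)] by simp
  then show ?thesis
    by (simp add: mult_ac)
qed

lemma integrable_orbit:
  assumes G: "exp_integrable W G" and f: "f \<in> \<Union>\<Lambda>"
  shows "integrable lborel (\<lambda>y. G y * f (U y \<phi>))"
proof -
  obtain S where S: "S \<in> \<Lambda>" "f \<in> S"
    using f by blast
  obtain K' where K': "K' \<ge> 0" "\<And>y. cmod (f y) \<le> K' * norm y"
    using equibounded[OF S(1)] S(2) by blast
  have int: "integrable lborel (\<lambda>y. cmod (G y) * exp (W * l1norm y))" and cont: "continuous_on UNIV G"
    using G by (auto simp: exp_integrable_def)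
  have bound: "cmod (G y * f (U y \<phi>)) \<le> k * M * norm \<phi> * (cmod (G y) * exp (W * l1norm y))"
    if "\<And>y. cmod (f y) \<le> k * norm y" "k \<ge> 0" for k y
    using mult_left_mono[OF functional_orbit_bound[OF f that, of y \<phi>], of "cmod (G y)"]
    by (simp add: norm_mult mult_ac)
  show "integrable lborel (\<lambda>y. G y * f (U y \<phi>))"
  proof (rule Bochner_Integration.integrable_bound)
    show "integrable lborel (\<lambda>y. K' * M * norm \<phi> * (cmod (G y) * exp (W * l1norm y)))"
      by (intro integrable_mult_right int)
    have "continuous_on UNIV (\<lambda>y. G y * f (U y \<phi>))"
      by (intro continuous_intros cont continuous_functional_orbit f)
    then show "(\<lambda>y. G y * f (U y \<phi>)) \<in> borel_measurable lborel"
      using borel_measurable_continuous_onI by simp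
    show "AE y in lborel. norm (G y * f (U y \<phi>)) \<le> norm (K' * M * norm \<phi> * (cmod (G y) * exp (W * l1norm y)))"
      by (rule AE_I2) (use order_trans[OF bound[OF K'(2,1)] abs_ge_self] in simp)
  qed
qed

end

text \<open>Collects what differs between the two integrals: existence, compatibility with
  functionals, and continuity of the resulting operator for T. Continuity is listed separately
  because a norm bound does not give it in the weak* topology.\<close>

locale functional_calculus = functional_group U T \<Lambda> M W
  for U :: "real ^ 'd \<Rightarrow> 'a::complex_banach \<Rightarrow> 'a" and T \<Lambda> M W +
  fixes J :: "(real ^ 'd \<Rightarrow> 'a) \<Rightarrow> 'a \<Rightarrow> bool"
  assumes integral_exists: "\<And>G \<phi>. exp_integrable W G \<Longrightarrow> \<exists>\<psi>. J (\<lambda>y. G y *\<^sub>C U y \<phi>) \<psi>"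
    and integral_functional: "\<And>G \<phi> \<psi> f. exp_integrable W G \<Longrightarrow> J (\<lambda>y. G y *\<^sub>C U y \<phi>) \<psi> \<Longrightarrow>
      f \<in> \<Union>\<Lambda> \<Longrightarrow> has_bochner_integral lborel (\<lambda>y. G y * f (U y \<phi>)) (f \<psi>)"
    and integral_continuous: "\<And>G A. exp_integrable W G \<Longrightarrow>
      (\<And>\<phi>. J (\<lambda>y. G y *\<^sub>C U y \<phi>) (A \<phi>)) \<Longrightarrow> continuous_map T T A"
begin

definition \<Psi> :: "(complex ^ 'd \<Rightarrow> complex) \<Rightarrow> 'a \<Rightarrow> 'a"
  where "\<Psi> F \<phi> = (THE \<psi>. J (\<lambda>y. fourier_inv F y *\<^sub>C U y \<phi>) \<psi>)"

lemma integral_unique: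
  assumes "exp_integrable W G" "J (\<lambda>y. G y *\<^sub>C U y \<phi>) \<psi>" "J (\<lambda>y. G y *\<^sub>C U y \<phi>) \<psi>'"
  shows "\<psi> = \<psi>'"
proof (rule separating)
  fix f
  assume f: "f \<in> \<Union>\<Lambda>"
  from integral_functional[OF assms(1,2) f] integral_functional[OF assms(1,3) f]
  show "f \<psi> = f \<psi>'"
    by (rule has_bochner_integral_eq)
qed

lemma \<Psi>_integral:
  assumes "admissible F"
  shows "J (\<lambda>y. fourier_inv F y *\<^sub>C U y \<phi>) (\<Psi> F \<phi>)"
proof -
  obtain \<psi> where \<psi>: "J (\<lambda>y. fourier_inv F y *\<^sub>C U y \<phi>) \<psi>"
    using integral_exists[OF exp_integrable_fourier_inv[OF assms]] by blast
  show ?thesis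
    unfolding \<Psi>_def
    by (rule theI[where P = "J (\<lambda>y. fourier_inv F y *\<^sub>C U y \<phi>)"])
      (fact \<psi>, rule integral_unique[OF exp_integrable_fourier_inv[OF assms] _ \<psi>])
qed

lemma \<Psi>_functional:
  assumes "admissible F" "f \<in> \<Union>\<Lambda>"
  shows "has_bochner_integral lborel (\<lambda>y. fourier_inv F y * f (U y \<phi>)) (f (\<Psi> F \<phi>))"
  by (rule integral_functional[OF exp_integrable_fourier_inv \<Psi>_integral]) (use assms in auto)

lemma \<Psi>_functional_eq:
  assumes "admissible F" "f \<in> \<Union>\<Lambda>"
  shows "f (\<Psi> F \<phi>) = (\<integral>y. fourier_inv F y * f (U y \<phi>) \<partial>lborel)"
  using has_bochner_integral_integral_eq[OF \<Psi>_functional[OF assms]] by simp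

lemma \<Psi>_continuous: "admissible F \<Longrightarrow> continuous_map T T (\<Psi> F)"
  by (rule integral_continuous[OF exp_integrable_fourier_inv \<Psi>_integral])

text \<open>F enters only through its bound on one strip that is wider than the growth rate W. The
  operator bounds below are instances with suitable R and c.\<close>

lemma \<Psi>_bound:
  fixes F :: "complex ^ 'd \<Rightarrow> complex"
  assumes F: "admissible F" and c: "c > 0" and R: "R > W"
    and A: "\<And>z. z \<in> strip R \<Longrightarrow> cmod (F z) \<le> A * exp (- (c * rl1 z))"
  shows "norm (\<Psi> F \<phi>) \<le> M * (A / (pi * c) ^ CARD('d) * (2 / (R - W)) ^ CARD('d)) * norm \<phi>"
proof (rule norming)
  fix f
  assume f: "f \<in> \<Union>\<Lambda>" "\<And>y. cmod (f y) \<le> norm y"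
  have R0: "R \<ge> 0"
    using R W by simp
  have "cmod (f (\<Psi> F \<phi>)) \<le> (\<integral>y. (M * norm \<phi>) * (cmod (fourier_inv F y) * exp (W * l1norm y)) \<partial>lborel)"
    unfolding \<Psi>_functional_eq[OF F f(1)]
  proof (rule norm_integral_le)
    show "integrable lborel (\<lambda>y. (M * norm \<phi>) * (cmod (fourier_inv F y) * exp (W * l1norm y)))"
      by (intro integrable_mult_right integrable_fourier_inv_weighted F)
    fix y
    have "cmod (f (U y \<phi>)) \<le> M * norm \<phi> * exp (W * l1norm y)"
      using functional_orbit_bound[OF f(1), of 1 y \<phi>] f(2) by simp
    then have "cmod (fourier_inv F y) * cmod (f (U y \<phi>)) \<le> cmod (fourier_inv F y) * (M * norm \<phi> * exp (W * l1norm y))"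
      by (intro mult_left_mono) auto
    then show "cmod (fourier_inv F y * f (U y \<phi>)) \<le> (M * norm \<phi>) * (cmod (fourier_inv F y) * exp (W * l1norm y))"
      by (simp add: norm_mult mult_ac)
  qed
  also have "\<dots> = (M * norm \<phi>) * (\<integral>y. cmod (fourier_inv F y) * exp (W * l1norm y) \<partial>lborel)"
    by simp
  also have "\<dots> \<le> (M * norm \<phi>) * (A / (pi * c) ^ CARD('d) * (2 / (R - W)) ^ CARD('d))"
    using M by (intro mult_left_mono integral_fourier_inv_weighted[OF F c R0 R A]) auto
  finally show "cmod (f (\<Psi> F \<phi>)) \<le> M * (A / (pi * c) ^ CARD('d) * (2 / (R - W)) ^ CARD('d)) * norm \<phi>"
    by (simp add: mult_ac)
qed

lemma \<Psi>_linear: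
  assumes F: "admissible F"
  shows "bounded_clinear (\<Psi> F)"
proof -
  obtain A where A: "A \<ge> 0" "\<And>z. z \<in> strip (W + 1) \<Longrightarrow> cmod (F z) \<le> A * exp (- (1 * rl1 z))"
    using admissible_bound[OF F, of "W + 1" 1] by metis
  show ?thesis
  proof (rule bounded_clinearI)
    show "\<Psi> F (x + y) = \<Psi> F x + \<Psi> F y" for x y
    proof (rule separating)
      fix f
      assume f: "f \<in> \<Union>\<Lambda>"
      note lin = bounded_clinear_add[OF U_linear] bounded_clinear_add[OF functional[OF f]]
      have "has_bochner_integral lborel (\<lambda>z. fourier_inv F z * f (U z (x + y))) (f (\<Psi> F x) + f (\<Psi> F y))"
        unfolding lin distrib_left
        by (intro has_bochner_integral_add \<Psi>_functional F f)
      then show "f (\<Psi> F (x + y)) = f (\<Psi> F x + \<Psi> F y)"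
        unfolding lin using \<Psi>_functional[OF F f, of "x + y"] unfolding lin by (rule has_bochner_integral_eq[symmetric])
    qed
    show "\<Psi> F (a *\<^sub>C x) = a *\<^sub>C \<Psi> F x" for a x
    proof (rule separating)
      fix f
      assume f: "f \<in> \<Union>\<Lambda>"
      note lin = bounded_clinear_scaleC[OF U_linear] bounded_clinear_scaleC[OF functional[OF f]]
        scaleC_complex_def
      have "has_bochner_integral lborel (\<lambda>z. a * (fourier_inv F z * f (U z x))) (a * f (\<Psi> F x))"
        by (intro has_bochner_integral_mult_right \<Psi>_functional F f)
      then show "f (\<Psi> F (a *\<^sub>C x)) = f (a *\<^sub>C \<Psi> F x)"
        using \<Psi>_functional[OF F f, of "a *\<^sub>C x"] unfolding lin mult.left_commute[of _ a]
        by (rule has_bochner_integral_eq[symmetric])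
    qed
    show "norm (\<Psi> F x) \<le> norm x * (M * (A / (pi * 1) ^ CARD('d) * (2 / (W + 1 - W)) ^ CARD('d)))" for x
    proof -
      have "norm (\<Psi> F x) \<le> M * (A / (pi * 1) ^ CARD('d) * (2 / (W + 1 - W)) ^ CARD('d)) * norm x"
        by (rule \<Psi>_bound[OF F _ _ A(2)]) auto
      then show ?thesis
        by (simp only: mult.commute)
    qed
  qed
qed

lemma \<Psi>_add:
  assumes F: "admissible F" and G: "admissible G"
  shows "\<Psi> (\<lambda>z. F z + G z) \<phi> = \<Psi> F \<phi> + \<Psi> G \<phi>"
proof (rule separating)
  fix f
  assume f: "f \<in> \<Union>\<Lambda>"
  have "has_bochner_integral lborel (\<lambda>y. fourier_inv (\<lambda>z. F z + G z) y * f (U y \<phi>)) (f (\<Psi> F \<phi>) + f (\<Psi> G \<phi>))"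
    unfolding fourier_inv_add[OF F G] distrib_right
    by (intro has_bochner_integral_add \<Psi>_functional F G f)
  then show "f (\<Psi> (\<lambda>z. F z + G z) \<phi>) = f (\<Psi> F \<phi> + \<Psi> G \<phi>)"
    using \<Psi>_functional[OF admissible_add[OF F G] f]
    unfolding bounded_clinear_add[OF functional[OF f]] by (rule has_bochner_integral_eq[symmetric])
qed

lemma \<Psi>_cmult:
  assumes F: "admissible F"
  shows "\<Psi> (\<lambda>z. a * F z) \<phi> = a *\<^sub>C \<Psi> F \<phi>"
proof (rule separating)
  fix f
  assume f: "f \<in> \<Union>\<Lambda>"
  have "has_bochner_integral lborel (\<lambda>y. fourier_inv (\<lambda>z. a * F z) y * f (U y \<phi>)) (a * f (\<Psi> F \<phi>))"
    unfolding fourier_inv_cmult mult.assoc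
    by (intro has_bochner_integral_mult_right \<Psi>_functional F f)
  then show "f (\<Psi> (\<lambda>z. a * F z) \<phi>) = f (a *\<^sub>C \<Psi> F \<phi>)"
    using \<Psi>_functional[OF admissible_cmult[OF F] f]
    unfolding bounded_clinear_scaleC[OF functional[OF f]] scaleC_complex_def
    by (rule has_bochner_integral_eq[symmetric])
qed

lemma \<Psi>_diff:
  assumes F: "admissible F" and G: "admissible G"
  shows "\<Psi> (\<lambda>z. F z - G z) \<phi> = \<Psi> F \<phi> - \<Psi> G \<phi>"
  using \<Psi>_add[OF F admissible_uminus[OF G], of \<phi>] \<Psi>_cmult[OF G, of "-1" \<phi>]
  by (simp add: scaleC_minus_left)

lemma \<Psi>_sum:
  assumes "finite I" "\<And>i. i \<in> I \<Longrightarrow> admissible (F i)"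
  shows "\<Psi> (\<lambda>z. \<Sum>i\<in>I. F i z) \<phi> = (\<Sum>i\<in>I. \<Psi> (F i) \<phi>)"
  using assms
proof (induction I rule: finite_induct)
  case empty
  then show ?case
    using \<Psi>_cmult[OF admissible_zero, of 0 \<phi>] by simp
next
  case (insert i I)
  then show ?case
    by (simp add: \<Psi>_add admissible_sum)
qed

text \<open>On either side U x becomes the translation y to x + y under the integral; the two agree
  because the group is commutative.\<close>

lemma \<Psi>_modulate:
  assumes F: "admissible F"
  defines "F' \<equiv> \<lambda>x z. exp (- \<i> * cpair x z) * F z"
  shows U_\<Psi>: "U x (\<Psi> F \<phi>) = \<Psi> (F' x) \<phi>" and \<Psi>_U: "\<Psi> F (U x \<phi>) = \<Psi> (F' x) \<phi>"
proof -
  have F': "admissible (F' x)"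
    unfolding F'_def by (intro admissible_mult tame_exp_cpair F)
  have shift: "(\<integral>y. fourier_inv F y * f (U (x + y) \<phi>) \<partial>lborel) = f (\<Psi> (F' x) \<phi>)" if f: "f \<in> \<Union>\<Lambda>" for f
    using integral_lborel_translation[of "\<lambda>y. fourier_inv F (y - x) * f (U y \<phi>)" x]
      \<Psi>_functional_eq[OF F' f, of \<phi>]
    unfolding F'_def fourier_inv_modulate by simp
  show "U x (\<Psi> F \<phi>) = \<Psi> (F' x) \<phi>"
  proof (rule separating)
    fix f
    assume f: "f \<in> \<Union>\<Lambda>"
    show "f (U x (\<Psi> F \<phi>)) = f (\<Psi> (F' x) \<phi>)"
      using \<Psi>_functional_eq[OF F invariant[OF f, of x], of \<phi>] shift[OF f] by (simp add: U_add)
  qed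
  show "\<Psi> F (U x \<phi>) = \<Psi> (F' x) \<phi>"
  proof (rule separating)
    fix f
    assume f: "f \<in> \<Union>\<Lambda>"
    show "f (\<Psi> F (U x \<phi>)) = f (\<Psi> (F' x) \<phi>)"
      using \<Psi>_functional_eq[OF F f, of "U x \<phi>"] shift[OF f] by (simp add: U_add[symmetric] add.commute)
  qed
qed

text \<open>Composition becomes convolution of the kernels after Fubini, and
  \<open>fourier_inv_convolution\<close> turns this into the product of the multipliers.\<close>

lemma \<Psi>_mult:
  assumes F: "admissible F" and G: "admissible G"
  shows "\<Psi> F (\<Psi> G \<phi>) = \<Psi> (\<lambda>z. F z * G z) \<phi>"
proof (rule separating)
  fix f
  assume f: "f \<in> \<Union>\<Lambda>"
  then obtain S where "S \<in> \<Lambda>" "f \<in> S"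
    by blast
  then obtain K where K: "K \<ge> 0" "\<And>x. cmod (f x) \<le> K * norm x"
    using equibounded by blast
  \<comment> \<open>The weights move the growth of U into the kernels: p and q remain integrable,
    and the compensated factor k is bounded by \<open>growth\<close> and the triangle inequality, as
    \<open>fubini_convolution\<close> demands.\<close>
  define p where "p x = fourier_inv F x * complex_of_real (exp (W * l1norm x))" for x
  define q where "q x = fourier_inv G x * complex_of_real (exp (W * l1norm x))" for x
  define k where "k x y = f (U y \<phi>) * complex_of_real (exp (- (W * l1norm x)) * exp (- (W * l1norm (y - x))))" for x y
  have int: "integrable lborel (\<lambda>x. fourier_inv H x * complex_of_real (exp (W * l1norm x)))"
    if H: "admissible H" for H :: "complex ^ 'd \<Rightarrow> complex"
  proof (rule Bochner_Integration.integrable_bound[OF integrable_fourier_inv_weighted[OF H, of W]])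
    have "continuous_on UNIV (\<lambda>x. fourier_inv H x * complex_of_real (exp (W * l1norm x)))"
      by (intro continuous_intros continuous_fourier_inv H)
    then show "(\<lambda>x. fourier_inv H x * complex_of_real (exp (W * l1norm x))) \<in> borel_measurable lborel"
      using borel_measurable_continuous_onI by simp
  qed (simp add: norm_mult)
  have pq: "p x * q (y - x) * k x y = fourier_inv F x * (fourier_inv G (y - x) * f (U y \<phi>))" for x y
  proof -
    have "complex_of_real (exp (W * l1norm x)) * complex_of_real (exp (- (W * l1norm x))) = 1"
      "complex_of_real (exp (W * l1norm (y - x))) * complex_of_real (exp (- (W * l1norm (y - x)))) = 1"
      by (simp_all flip: of_real_mult exp_add)
    then show ?thesis
      by (simp add: p_def q_def k_def) (metis (no_types, lifting) mult.assoc mult.commute mult.left_neutral)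
  qed
  have "f (\<Psi> F (\<Psi> G \<phi>)) = (\<integral>x. fourier_inv F x * f (U x (\<Psi> G \<phi>)) \<partial>lborel)"
    by (rule \<Psi>_functional_eq[OF F f])
  also have "\<dots> = (\<integral>x. (\<integral>y. p x * q (y - x) * k x y \<partial>lborel) \<partial>lborel)"
  proof (rule Bochner_Integration.integral_cong[OF refl])
    fix x
    have "f (U x (\<Psi> G \<phi>)) = (\<integral>y. fourier_inv G (y - x) * f (U y \<phi>) \<partial>lborel)"
      unfolding U_\<Psi>[OF G] \<Psi>_functional_eq[OF admissible_mult[OF tame_exp_cpair G] f]
      unfolding fourier_inv_modulate ..
    then show "fourier_inv F x * f (U x (\<Psi> G \<phi>)) = (\<integral>y. p x * q (y - x) * k x y \<partial>lborel)"
      unfolding pq by simp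
  qed
  also have "\<dots> = (\<integral>y. (\<integral>x. p x * q (y - x) * k x y \<partial>lborel) \<partial>lborel)"
  proof (rule fubini_convolution)
    show "integrable lborel p" "integrable lborel q"
      unfolding p_def q_def by (intro int F G)+
    have "continuous_on UNIV (\<lambda>p :: (real ^ 'd) \<times> (real ^ 'd). f (U (snd p) \<phi>))"
      by (rule continuous_on_compose2[OF continuous_functional_orbit[OF f]]) (auto intro!: continuous_intros)
    then show "continuous_on UNIV (\<lambda>(x, y). k x y)"
      unfolding k_def case_prod_beta by (intro continuous_intros)
    show "cmod (k x y) \<le> K * M * norm \<phi>" for x y
    proof -
      have "cmod (f (U y \<phi>)) \<le> K * M * norm \<phi> * exp (W * l1norm y)"
        by (rule functional_orbit_bound[OF f K(2,1)])
      also have "\<dots> \<le> K * M * norm \<phi> * exp (W * (l1norm x + l1norm (y - x)))"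
        using K(1) M W l1norm_triangle[of x "y - x"] by (intro mult_left_mono) (auto intro: mult_left_mono)
      finally have "cmod (f (U y \<phi>)) * (exp (- (W * l1norm x)) * exp (- (W * l1norm (y - x))))
          \<le> K * M * norm \<phi> * exp (W * (l1norm x + l1norm (y - x)))
            * (exp (- (W * l1norm x)) * exp (- (W * l1norm (y - x))))"
        by (intro mult_right_mono) auto
      also have "\<dots> = K * M * norm \<phi>"
        unfolding mult.assoc exp_add[symmetric] by (simp add: algebra_simps)
      finally show ?thesis
        by (simp add: k_def norm_mult)
    qed
  qed
  also have "\<dots> = (\<integral>y. fourier_inv (\<lambda>z. F z * G z) y * f (U y \<phi>) \<partial>lborel)"
  proof (rule Bochner_Integration.integral_cong[OF refl])
    fix y
    have "(\<integral>x. p x * q (y - x) * k x y \<partial>lborel)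
        = (\<integral>x. (fourier_inv G (y - x) * fourier_inv F x) * f (U y \<phi>) \<partial>lborel)"
      unfolding pq by (simp add: mult_ac)
    also have "\<dots> = fourier_inv (\<lambda>z. G z * F z) y * f (U y \<phi>)"
      using fourier_inv_convolution[OF G F, of y] by simp
    finally show "(\<integral>x. p x * q (y - x) * k x y \<partial>lborel) = fourier_inv (\<lambda>z. F z * G z) y * f (U y \<phi>)"
      by (simp add: mult.commute)
  qed
  also have "\<dots> = f (\<Psi> (\<lambda>z. F z * G z) \<phi>)"
    by (rule \<Psi>_functional_eq[symmetric, OF _ f]) (intro admissible_mult admissible_imp_tame F G)
  finally show "f (\<Psi> F (\<Psi> G \<phi>)) = f (\<Psi> (\<lambda>z. F z * G z) \<phi>)" .
qed

end

section \<open>Infinitesimal generators in the functional calculus\<close>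

context functional_calculus
begin

text \<open>The symbol of the difference quotient differs from - i z_k F by a remainder of size |t|,
  so the quotient converges in norm, which implies convergence in T in either alternative.\<close>

lemma \<Psi>_inf_gen:
  assumes F: "admissible F"
  shows "(\<Psi> F \<phi>, \<Psi> (\<lambda>z. - \<i> * z $ k * F z) \<phi>) \<in> inf_gen T U k"
proof -
  have kF: "admissible (\<lambda>z. - \<i> * z $ k * F z)"
    by (intro admissible_mult tame_mult tame_const tame_nth F)
  obtain A where A: "A \<ge> 0" "\<And>t z. \<bar>t\<bar> \<le> 1 \<Longrightarrow> z \<in> strip (W + 1) \<Longrightarrow>
      cmod ((exp (- \<i> * complex_of_real t * z $ k) - 1 - - \<i> * complex_of_real t * z $ k) * F z)
        \<le> t\<^sup>2 * A * exp (- rl1 z)"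
    using modulation_taylor[OF F, of "W + 1" k] by blast
  define q where "q t = (1 / t) *\<^sub>R (U (t *\<^sub>R axis k 1) (\<Psi> F \<phi>) - \<Psi> F \<phi>)" for t
  define B where "B = M * (A / (pi * 1) ^ CARD('d) * (2 / (W + 1 - W)) ^ CARD('d)) * norm \<phi>"
  have B: "norm (q t - \<Psi> (\<lambda>z. - \<i> * z $ k * F z) \<phi>) \<le> \<bar>t\<bar> * B" if t: "t \<noteq> 0" "\<bar>t\<bar> \<le> 1" for t
  proof -
    define E where "E z = exp (- \<i> * cpair (t *\<^sub>R axis k 1) z) * F z" for z
    have E: "admissible E"
      unfolding E_def by (intro admissible_mult tame_exp_cpair F)
    define D where "D z = E z - F z - complex_of_real t * (- \<i> * z $ k * F z)" for z
    have D: "admissible D"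
      unfolding D_def by (intro admissible_diff admissible_cmult E F kF)
    have cp: "cpair (t *\<^sub>R axis k 1) z = complex_of_real t * z $ k" for z
    proof -
      have "cpair (t *\<^sub>R axis k 1) z = (\<Sum>j\<in>UNIV. if j = k then complex_of_real t * z $ j else 0)"
        unfolding cpair_def by (intro sum.cong) (auto simp: axis_def)
      then show ?thesis
        by simp
    qed
    have "D z = (exp (- \<i> * complex_of_real t * z $ k) - 1 - - \<i> * complex_of_real t * z $ k) * F z" for z
      by (simp add: D_def E_def cp algebra_simps)
    then have "cmod (D z) \<le> t\<^sup>2 * A * exp (- (1 * rl1 z))" if "z \<in> strip (W + 1)" for z
      using A(2)[OF t(2) that] by simp
    then have "norm (\<Psi> D \<phi>) \<le> M * (t\<^sup>2 * A / (pi * 1) ^ CARD('d) * (2 / (W + 1 - W)) ^ CARD('d)) * norm \<phi>"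
      by (intro \<Psi>_bound D) auto
    then have 1: "norm (\<Psi> D \<phi>) \<le> t\<^sup>2 * B"
      by (simp add: B_def mult_ac)
    have "\<Psi> D \<phi> = U (t *\<^sub>R axis k 1) (\<Psi> F \<phi>) - \<Psi> F \<phi> - t *\<^sub>R \<Psi> (\<lambda>z. - \<i> * z $ k * F z) \<phi>"
    proof -
      have "\<Psi> E \<phi> = U (t *\<^sub>R axis k 1) (\<Psi> F \<phi>)"
        unfolding E_def U_\<Psi>[OF F] ..
      moreover have "\<Psi> D \<phi> = \<Psi> E \<phi> - \<Psi> F \<phi> - t *\<^sub>R \<Psi> (\<lambda>z. - \<i> * z $ k * F z) \<phi>"
        unfolding D_def scaleR_scaleC
        by (simp only: \<Psi>_diff[OF admissible_diff[OF E F] admissible_cmult[OF kF]] \<Psi>_diff[OF E F]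
            \<Psi>_cmult[OF kF])
      ultimately show ?thesis
        by simp
    qed
    then have "q t - \<Psi> (\<lambda>z. - \<i> * z $ k * F z) \<phi> = (1 / t) *\<^sub>R \<Psi> D \<phi>"
      using t by (simp add: q_def scaleR_diff_right)
    then have "norm (q t - \<Psi> (\<lambda>z. - \<i> * z $ k * F z) \<phi>) = norm (\<Psi> D \<phi>) / \<bar>t\<bar>"
      by (simp add: divide_inverse mult.commute)
    also have "\<dots> \<le> t\<^sup>2 * B / \<bar>t\<bar>"
      by (intro divide_right_mono 1) auto
    also have "\<dots> = \<bar>t\<bar> * B"
      using t by (simp add: field_simps power2_eq_square abs_if)
    finally show ?thesis .
  qed
  have "limitin T q (\<Psi> (\<lambda>z. - \<i> * z $ k * F z) \<phi>) (at 0)"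
  proof (rule limitinI_norm, rule tendsto_sandwich[where f = "\<lambda>_. 0" and h = "\<lambda>t. \<bar>t\<bar> * B"])
    show "\<forall>\<^sub>F t in at 0. norm (q t - \<Psi> (\<lambda>z. - \<i> * z $ k * F z) \<phi>) \<le> \<bar>t\<bar> * B"
      unfolding eventually_at by (intro exI[of _ 1] conjI ballI impI B) auto
    have "((\<lambda>t. \<bar>t\<bar> * B) \<longlongrightarrow> \<bar>0\<bar> * B) (at (0::real))"
      by (intro tendsto_intros)
    then show "((\<lambda>t. \<bar>t\<bar> * B) \<longlongrightarrow> 0) (at (0::real))"
      by simp
  qed auto
  then show ?thesis
    unfolding inf_gen_def q_def[abs_def] by simp
qed

lemma \<Psi>_inf_gen_power:
  assumes F: "admissible F"
  shows "(\<Psi> F \<phi>, \<Psi> (\<lambda>z. monomial \<alpha> z * F z) \<phi>) \<in> inf_gen_power T U \<alpha>"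
proof (induction \<alpha>)
  case (Cons k \<alpha>)
  have "admissible (\<lambda>z. monomial \<alpha> z * F z)"
    by (intro admissible_mult tame_monomial F)
  from \<Psi>_inf_gen[OF this, of \<phi> k]
  have "(\<Psi> (\<lambda>z. monomial \<alpha> z * F z) \<phi>, \<Psi> (\<lambda>z. monomial (k # \<alpha>) z * F z) \<phi>) \<in> inf_gen T U k"
    by (simp add: mult.assoc)
  with Cons show ?case
    by auto
qed simp

lemma inf_gen_unique: "(\<phi>, \<psi>) \<in> inf_gen T U k \<Longrightarrow> (\<phi>, \<psi>') \<in> inf_gen T U k \<Longrightarrow> \<psi> = \<psi>'"
  unfolding inf_gen_def using limitin_unique[of _ \<psi> "at (0::real)" \<psi>'] by simp

lemma inf_gen_power_unique:
  "(\<phi>, \<psi>) \<in> inf_gen_power T U \<alpha> \<Longrightarrow> (\<phi>, \<psi>') \<in> inf_gen_power T U \<alpha> \<Longrightarrow> \<psi> = \<psi>'"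
proof (induction \<alpha> arbitrary: \<psi> \<psi>')
  case (Cons k \<alpha>)
  obtain \<eta> where \<eta>: "(\<phi>, \<eta>) \<in> inf_gen_power T U \<alpha>" "(\<eta>, \<psi>) \<in> inf_gen T U k"
    using Cons.prems(1) by auto
  obtain \<eta>' where \<eta>': "(\<phi>, \<eta>') \<in> inf_gen_power T U \<alpha>" "(\<eta>', \<psi>') \<in> inf_gen T U k"
    using Cons.prems(2) by auto
  have "\<eta> = \<eta>'"
    by (rule Cons.IH[OF \<eta>(1) \<eta>'(1)])
  then show ?case
    using inf_gen_unique \<eta>(2) \<eta>'(2) by simp
qed simp

lemma op_apply_inf_gen_power:
  "(\<phi>, \<psi>) \<in> inf_gen_power T U \<alpha> \<Longrightarrow> op_apply (inf_gen_power T U \<alpha>) \<phi> = \<psi>"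
  unfolding op_apply_def by (rule the_equality) (auto intro: inf_gen_power_unique)

text \<open>\<Psi> F is T-continuous and commutes with U, so it may be applied to the limit that
  defines X_k; \<open>\<Psi>_inf_gen\<close> identifies the result.\<close>

lemma \<Psi>_inf_gen_right:
  assumes F: "admissible F" and gen: "(\<phi>, \<psi>) \<in> inf_gen T U k"
  shows "\<Psi> F \<psi> = \<Psi> (\<lambda>z. - \<i> * z $ k * F z) \<phi>"
proof -
  define q where "q t = (1 / t) *\<^sub>R (U (t *\<^sub>R axis k 1) \<phi> - \<phi>)" for t
  have "limitin T q \<psi> (at 0)"
    using gen unfolding inf_gen_def q_def[abs_def] by simp
  then have "limitin T (\<Psi> F \<circ> q) (\<Psi> F \<psi>) (at 0)"
    by (rule continuous_map_limit[OF \<Psi>_continuous[OF F]])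
  moreover have "\<Psi> F \<circ> q = (\<lambda>t. (1 / t) *\<^sub>R (U (t *\<^sub>R axis k 1) (\<Psi> F \<phi>) - \<Psi> F \<phi>))"
  proof
    fix t
    note lin = \<Psi>_linear[OF F]
    show "(\<Psi> F \<circ> q) t = (1 / t) *\<^sub>R (U (t *\<^sub>R axis k 1) (\<Psi> F \<phi>) - \<Psi> F \<phi>)"
      by (simp add: q_def scaleR_scaleC bounded_clinear_scaleC[OF lin] bounded_clinear_diff[OF lin]
          \<Psi>_U[OF F] U_\<Psi>[OF F])
  qed
  ultimately have "(\<Psi> F \<phi>, \<Psi> F \<psi>) \<in> inf_gen T U k"
    by (simp add: inf_gen_def)
  then show ?thesis
    using \<Psi>_inf_gen[OF F, of \<phi> k] by (rule inf_gen_unique)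
qed

lemma \<Psi>_inf_gen_power_right:
  assumes "admissible F" "(\<phi>, \<psi>) \<in> inf_gen_power T U \<alpha>"
  shows "\<Psi> F \<psi> = \<Psi> (\<lambda>z. monomial \<alpha> z * F z) \<phi>"
  using assms
proof (induction \<alpha> arbitrary: F \<psi>)
  case (Cons k \<alpha>)
  obtain \<eta> where \<eta>: "(\<phi>, \<eta>) \<in> inf_gen_power T U \<alpha>" "(\<eta>, \<psi>) \<in> inf_gen T U k"
    using Cons.prems(2) by auto
  have kF: "admissible (\<lambda>z. - \<i> * z $ k * F z)"
    by (intro admissible_mult tame_mult tame_const tame_nth Cons.prems)
  have "\<Psi> F \<psi> = \<Psi> (\<lambda>z. - \<i> * z $ k * F z) \<eta>"
    by (rule \<Psi>_inf_gen_right[OF Cons.prems(1) \<eta>(2)])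
  also have "\<dots> = \<Psi> (\<lambda>z. monomial \<alpha> z * (- \<i> * z $ k * F z)) \<phi>"
    by (rule Cons.IH[OF kF \<eta>(1)])
  finally show ?case
    by (simp add: mult_ac)
qed simp

lemma diff_space_iff: "\<phi> \<in> diff_space T U n \<longleftrightarrow> (\<forall>\<alpha>. length \<alpha> = n \<longrightarrow> (\<exists>\<psi>. (\<phi>, \<psi>) \<in> inf_gen_power T U \<alpha>))"
  by (auto simp: diff_space_def)

text \<open>The last letter of a word acts first, so a vector in the domain of a long word is in the
  domain of each of its suffixes.\<close>

lemma diff_space_antimono:
  assumes "\<phi> \<in> diff_space T U m" "n \<le> m"
  shows "\<phi> \<in> diff_space T U n"
  unfolding diff_space_iff
proof (intro allI impI)
  have prefix: "\<exists>\<psi>. (\<phi>, \<psi>) \<in> inf_gen_power T U \<alpha>" if "(\<phi>, \<psi>) \<in> inf_gen_power T U (\<beta> @ \<alpha>)" for \<alpha> \<beta> \<psi>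
    using that by (induction \<beta> arbitrary: \<psi>) auto
  fix \<alpha> :: "'d list"
  assume "length \<alpha> = n"
  \<comment> \<open>\<open>undefined\<close> is an arbitrary letter: padding in front adds
    generators that act after those of \<alpha>.\<close>
  then have "length (replicate (m - n) undefined @ \<alpha>) = m"
    using assms(2) by simp
  then obtain \<psi> where "(\<phi>, \<psi>) \<in> inf_gen_power T U (replicate (m - n) undefined @ \<alpha>)"
    using assms(1) unfolding diff_space_iff by blast
  then show "\<exists>\<psi>. (\<phi>, \<psi>) \<in> inf_gen_power T U \<alpha>"
    by (rule prefix)
qed

lemma \<Psi>_rep_operator:
  assumes F: "admissible F"
  shows "(\<Psi> F \<phi>, \<Psi> (\<lambda>z. csymbol m c z * F z) \<phi>) \<in> rep_operator T U m c"
proof -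
  have mem: "\<Psi> F \<phi> \<in> diff_space T U m"
    unfolding diff_space_iff using \<Psi>_inf_gen_power[OF F] by blast
  have adm: "admissible (\<lambda>z. monomial \<alpha> z * F z)" for \<alpha>
    by (intro admissible_mult tame_monomial F)
  have "(\<Sum>\<alpha> | length \<alpha> \<le> m. c \<alpha> *\<^sub>C op_apply (inf_gen_power T U \<alpha>) (\<Psi> F \<phi>))
      = (\<Sum>\<alpha> | length \<alpha> \<le> m. \<Psi> (\<lambda>z. c \<alpha> * (monomial \<alpha> z * F z)) \<phi>)"
    by (intro sum.cong refl) (simp add: op_apply_inf_gen_power[OF \<Psi>_inf_gen_power[OF F]] \<Psi>_cmult[OF adm])
  also have "\<dots> = \<Psi> (\<lambda>z. \<Sum>\<alpha> | length \<alpha> \<le> m. c \<alpha> * (monomial \<alpha> z * F z)) \<phi>"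
    by (rule \<Psi>_sum[symmetric]) (auto intro: finite_lists_length_le_UNIV admissible_cmult adm)
  also have "\<dots> = \<Psi> (\<lambda>z. csymbol m c z * F z) \<phi>"
    by (simp add: csymbol_def sum_distrib_right mult.assoc)
  finally show ?thesis
    using mem unfolding rep_operator_def by auto
qed

text \<open>The intertwining relation on the whole domain of H^(U). It places the graph of H^(U) in
  the closed set to which its closure will be equal.\<close>

lemma \<Psi>_rep_operator_right:
  assumes F: "admissible F" and "(\<phi>, \<psi>) \<in> rep_operator T U m c"
  shows "\<Psi> F \<psi> = \<Psi> (\<lambda>z. csymbol m c z * F z) \<phi>"
proof -
  have \<phi>: "\<phi> \<in> diff_space T U m"
    and \<psi>: "\<psi> = (\<Sum>\<alpha> | length \<alpha> \<le> m. c \<alpha> *\<^sub>C op_apply (inf_gen_power T U \<alpha>) \<phi>)"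
    using assms(2) by (auto simp: rep_operator_def)
  have adm: "admissible (\<lambda>z. monomial \<alpha> z * F z)" for \<alpha>
    by (intro admissible_mult tame_monomial F)
  have lin: "linear (\<Psi> F)"
    using \<Psi>_linear[OF F] by (simp add: bounded_clinear_def bounded_linear.linear)
  have "\<Psi> F \<psi> = (\<Sum>\<alpha> | length \<alpha> \<le> m. c \<alpha> *\<^sub>C \<Psi> F (op_apply (inf_gen_power T U \<alpha>) \<phi>))"
    unfolding \<psi> linear_sum[OF lin] bounded_clinear_scaleC[OF \<Psi>_linear[OF F]] ..
  also have "\<dots> = (\<Sum>\<alpha> | length \<alpha> \<le> m. \<Psi> (\<lambda>z. c \<alpha> * (monomial \<alpha> z * F z)) \<phi>)"
  proof (intro sum.cong refl)
    fix \<alpha> :: "'d list"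
    assume "\<alpha> \<in> {\<alpha>. length \<alpha> \<le> m}"
    then have "\<phi> \<in> diff_space T U (length \<alpha>)"
      using diff_space_antimono[OF \<phi>] by simp
    then obtain \<eta> where \<eta>: "(\<phi>, \<eta>) \<in> inf_gen_power T U \<alpha>"
      unfolding diff_space_iff by blast
    then show "c \<alpha> *\<^sub>C \<Psi> F (op_apply (inf_gen_power T U \<alpha>) \<phi>) = \<Psi> (\<lambda>z. c \<alpha> * (monomial \<alpha> z * F z)) \<phi>"
      using \<Psi>_inf_gen_power_right[OF F \<eta>] \<Psi>_cmult[OF adm[of \<alpha>], of "c \<alpha>" \<phi>]
      by (simp add: op_apply_inf_gen_power)
  qed
  also have "\<dots> = \<Psi> (\<lambda>z. \<Sum>\<alpha> | length \<alpha> \<le> m. c \<alpha> * (monomial \<alpha> z * F z)) \<phi>"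
    by (rule \<Psi>_sum[symmetric]) (auto intro: finite_lists_length_le_UNIV admissible_cmult adm)
  also have "\<dots> = \<Psi> (\<lambda>z. csymbol m c z * F z) \<phi>"
    by (simp add: csymbol_def sum_distrib_right mult.assoc)
  finally show ?thesis .
qed

end

section \<open>The semigroup of an elliptic operator\<close>

context functional_calculus
begin

lemma limitin_compose_filterlim:
  assumes "limitin T g l F" "filterlim h F G"
  shows "limitin T (\<lambda>x. g (h x)) l G"
  unfolding limitin_iff
proof (intro ballI allI impI)
  fix S and e :: real
  assume "S \<in> \<Lambda>" "e > 0"
  then have "\<forall>\<^sub>F x in F. \<forall>f\<in>S. cmod (f (g x - l)) \<le> e"
    using assms(1) unfolding limitin_iff by blast
  with assms(2) show "\<forall>\<^sub>F x in G. \<forall>f\<in>S. cmod (f (g (h x) - l)) \<le> e"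
    unfolding filterlim_iff by blast
qed

lemma limitin_eventually_eq:
  assumes "limitin T g l F" "\<forall>\<^sub>F x in F. g x = h x"
  shows "limitin T h l F"
  unfolding limitin_iff
proof (intro ballI allI impI)
  fix S and e :: real
  assume "S \<in> \<Lambda>" "e > 0"
  then have "\<forall>\<^sub>F x in F. \<forall>f\<in>S. cmod (f (g x - l)) \<le> e"
    using assms(1) unfolding limitin_iff by blast
  with assms(2) show "\<forall>\<^sub>F x in F. \<forall>f\<in>S. cmod (f (h x - l)) \<le> e"
    by eventually_elim simp
qed

lemma limitin_functional:
  assumes "limitin T g l F" "f \<in> \<Union>\<Lambda>"
  shows "((\<lambda>x. f (g x)) \<longlongrightarrow> f l) F"
  unfolding tendsto_iff
proof (intro allI impI)
  fix e :: real
  assume e: "e > 0"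
  obtain S where S: "S \<in> \<Lambda>" "f \<in> S"
    using assms(2) by blast
  have "e / 2 > 0"
    using e by simp
  then have "\<forall>\<^sub>F x in F. \<forall>f\<in>S. cmod (f (g x - l)) \<le> e / 2"
    using assms(1) S(1) unfolding limitin_iff by blast
  then show "\<forall>\<^sub>F x in F. dist (f (g x)) (f l) < e"
  proof eventually_elim
    case (elim x)
    then have "cmod (f (g x - l)) \<le> e / 2"
      using S(2) by blast
    then show ?case
      using e by (simp add: dist_norm bounded_clinear_diff[OF functional[OF assms(2)]])
  qed
qed

lemma continuous_map_half_line:
  fixes g :: "real \<Rightarrow> 'a"
  assumes "\<And>x. x \<ge> 0 \<Longrightarrow> limitin T g (g x) (at x within {0..})"
  shows "continuous_map (top_of_set {0..}) T g"
  unfolding continuous_map_def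
proof (intro conjI allI impI)
  fix V
  assume V: "openin T V"
  show "openin (top_of_set {0..}) {x \<in> topspace (top_of_set {0..}). g x \<in> V}"
    unfolding openin_euclidean_subtopology_iff
  proof (intro conjI ballI)
    fix x
    assume x: "x \<in> {x \<in> topspace (top_of_set {0..}). g x \<in> V}"
    then have "\<forall>\<^sub>F y in at x within {0..}. g y \<in> V"
      using assms[of x] V unfolding limitin_def by simp
    then obtain d where d: "d > 0" "\<And>y. y \<in> {0..} \<Longrightarrow> y \<noteq> x \<Longrightarrow> dist y x < d \<Longrightarrow> g y \<in> V"
      unfolding eventually_at by blast
    then have "\<forall>y\<in>{0..}. dist y x < d \<longrightarrow> y \<in> {x \<in> topspace (top_of_set {0..}). g x \<in> V}"
      using x by (metis (mono_tags, lifting) mem_Collect_eq topspace_euclidean_subtopology)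
    then show "\<exists>e>0. \<forall>y\<in>{0..}. dist y x < e \<longrightarrow> y \<in> {x \<in> topspace (top_of_set {0..}). g x \<in> V}"
      using d(1) by blast
  qed auto
qed (simp add: topspace)

lemma limitin_in_closure_of:
  assumes "limitin X g l F" "F \<noteq> bot" "\<forall>\<^sub>F x in F. g x \<in> A"
  shows "l \<in> X closure_of A"
  unfolding in_closure_of
proof (intro conjI allI impI)
  show "l \<in> topspace X"
    using assms(1) by (simp add: limitin_def)
  fix V
  assume "l \<in> V \<and> openin X V"
  then have "\<forall>\<^sub>F x in F. g x \<in> V"
    using assms(1) by (simp add: limitin_def)
  with assms(3) have "\<forall>\<^sub>F x in F. g x \<in> A \<and> g x \<in> V"
    by eventually_elim simp
  with assms(2) show "\<exists>y. y \<in> A \<and> y \<in> V"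
    using eventually_happens' by blast
qed

end

locale elliptic_calculus =
  functional_calculus U T \<Lambda> M W J + sectorial_symbol m c \<theta> \<mu> C
  for U :: "real ^ 'd \<Rightarrow> 'a::complex_banach \<Rightarrow> 'a" and T \<Lambda> M W J m and c :: "'d list \<Rightarrow> complex"
    and \<theta> \<mu> C
begin

abbreviation Z :: "complex \<Rightarrow> 'a \<Rightarrow> 'a"
  where "Z w \<equiv> \<Psi> (heat w)"

text \<open>The product of H^(U) and Z w as a bounded operator given by its multiplier, so that no
  domain has to be mentioned.\<close>

abbreviation HZ :: "complex \<Rightarrow> 'a \<Rightarrow> 'a"
  where "HZ w \<equiv> \<Psi> (\<lambda>z. csymbol m c z * heat w z)"

lemma admissible_monomial_heat: "w \<in> sector \<theta> \<Longrightarrow> admissible (\<lambda>z. monomial \<alpha> z * heat w z)"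
  by (intro admissible_mult tame_monomial admissible_heat)

lemma admissible_symbol_heat: "w \<in> sector \<theta> \<Longrightarrow> admissible (\<lambda>z. csymbol m c z * heat w z)"
  by (intro admissible_mult tame_csymbol admissible_heat)

text \<open>Only the product of the frequency decay x and the surplus y of the strip counts. In the
  applications x = \<gamma> t^(1/m) and y contains a multiple of t^(-1/m), so the product is bounded
  below by some q independent of t.\<close>

lemma kernel_scaling:
  fixes x y p q :: real
  assumes "x > 0" "y > 0" "q > 0" "q \<le> x * y"
  shows "A \<ge> 0 \<Longrightarrow> A / (pi * x) ^ n * (2 / y) ^ n \<le> A * (2 / (pi * q)) ^ n"
proof -
  assume A: "A \<ge> 0"
  have "A / (pi * x) ^ n * (2 / y) ^ n = A * (2 / (pi * (x * y))) ^ n"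
    by (simp add: power_divide power_mult_distrib)
  also have "\<dots> \<le> A * (2 / (pi * q)) ^ n"
    using assms A by (intro mult_left_mono power_mono divide_left_mono) auto
  finally show ?thesis .
qed

text \<open>With R = W + 1 + t^(-1/m) the surplus R - W times t^(1/m) is at least 1, so the kernel
  constants are uniform in w and only the multiplier bound of \<open>monomial_heat_bound\<close>
  remains.\<close>

lemma monomial_heat_norm:
  obtains a b \<omega> where "a > 0" "b > 0" "\<omega> \<ge> 0"
    "\<And>w \<alpha> \<phi>. w \<in> sector \<theta> \<Longrightarrow> norm (\<Psi> (\<lambda>z. monomial \<alpha> z * heat w z) \<phi>)
      \<le> a * b ^ length \<alpha> * cmod w powr (- real (length \<alpha>) / m) * fact (length \<alpha>) powr (1 / m)
        * exp (\<omega> * cmod w) * norm \<phi>"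
proof -
  obtain a b \<omega> \<gamma> where ab: "a > 0" "b > 0" "\<omega> \<ge> 0" "\<gamma> > 0"
    and bound: "\<And>w \<alpha> z. w \<in> sector \<theta> \<Longrightarrow> z \<in> strip (W + 1 + cmod w powr (- 1 / m)) \<Longrightarrow>
      cmod (monomial \<alpha> z * heat w z)
        \<le> (a * b ^ length \<alpha> * cmod w powr (- real (length \<alpha>) / m) * fact (length \<alpha>) powr (1 / m)
            * exp (\<omega> * cmod w)) * exp (- (\<gamma> * cmod w powr (1 / m) * rl1 z))"
    using monomial_heat_bound[OF W] by metis
  define L where "L = (2 / (pi * \<gamma>)) ^ CARD('d)"
  have L: "L > 0"
    using ab by (simp add: L_def)
  show thesis
  \<comment> \<open>M + 1 in place of M, because a positive constant is required and M may be
    0.\<close>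
  proof (rule that[of "(M + 1) * (a * L)" b \<omega>])
    show "(M + 1) * (a * L) > 0"
      using M ab L by simp
    fix w and \<alpha> :: "'d list" and \<phi> :: 'a
    assume w: "w \<in> sector \<theta>"
    define t where "t = cmod w"
    define A where "A = a * b ^ length \<alpha> * t powr (- real (length \<alpha>) / m) * fact (length \<alpha>) powr (1 / m)
      * exp (\<omega> * t)"
    define R where "R = W + 1 + t powr (- 1 / m)"
    have t: "t > 0"
      using sector_nonzero[OF w] by (simp add: t_def)
    have A: "A \<ge> 0"
      using ab by (simp add: A_def)
    have g: "\<gamma> * t powr (1 / m) > 0"
      using ab t by simp
    have R: "R > W"
      using t by (simp add: R_def add_pos_nonneg)
    have "norm (\<Psi> (\<lambda>z. monomial \<alpha> z * heat w z) \<phi>)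
        \<le> M * (A / (pi * (\<gamma> * t powr (1 / m))) ^ CARD('d) * (2 / (R - W)) ^ CARD('d)) * norm \<phi>"
    proof (rule \<Psi>_bound[OF admissible_monomial_heat[OF w] g R])
      show "cmod (monomial \<alpha> z * heat w z) \<le> A * exp (- (\<gamma> * t powr (1 / m) * rl1 z))" if "z \<in> strip R" for z
        using bound[OF w, of z \<alpha>] that by (simp only: A_def R_def t_def)
    qed
    also have "\<dots> \<le> (M + 1) * (A * L) * norm \<phi>"
    proof -
      have "\<gamma> \<le> \<gamma> * (t powr (1 / m) * (1 + t powr (- 1 / m)))"
      proof -
        have "t powr (1 / m) * t powr (- 1 / m) = 1"
          using t by (simp add: powr_add[symmetric])
        then have "1 \<le> t powr (1 / m) * (1 + t powr (- 1 / m))"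
          by (simp add: distrib_left)
        then show ?thesis
          using ab by simp
      qed
      then have "\<gamma> \<le> (\<gamma> * t powr (1 / m)) * (R - W)"
        by (simp add: R_def mult.assoc)
      then have est: "A / (pi * (\<gamma> * t powr (1 / m))) ^ CARD('d) * (2 / (R - W)) ^ CARD('d) \<le> A * L"
        unfolding L_def using g R ab A by (intro kernel_scaling) auto
      have "0 \<le> A / (pi * (\<gamma> * t powr (1 / m))) ^ CARD('d) * (2 / (R - W)) ^ CARD('d)"
        using A g R by simp
      then have "M * (A / (pi * (\<gamma> * t powr (1 / m))) ^ CARD('d) * (2 / (R - W)) ^ CARD('d)) \<le> (M + 1) * (A * L)"
        by (intro mult_mono[OF _ est]) (use M in auto)
      then show ?thesis
        by (rule mult_right_mono) simp
    qed
    finally show "norm (\<Psi> (\<lambda>z. monomial \<alpha> z * heat w z) \<phi>)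
      \<le> (M + 1) * (a * L) * b ^ length \<alpha> * cmod w powr (- real (length \<alpha>) / m) * fact (length \<alpha>) powr (1 / m)
        * exp (\<omega> * cmod w) * norm \<phi>"
      unfolding A_def t_def by (simp only: mult_ac)
  qed (use ab in auto)
qed

text \<open>The quadratic remainder of \<open>admissible_heat_near\<close> on the strip of
  half-width W + 1 gives an error of norm at most |v| B, so the derivative exists in norm.\<close>

lemma Z_derivative:
  assumes w: "w \<in> sector \<theta>"
  shows "((\<lambda>v. norm ((1 / v) *\<^sub>C (Z (w + v) \<phi> - Z w \<phi>) - - HZ w \<phi>)) \<longlongrightarrow> 0) (at 0)"
proof -
  obtain d where d: "d > 0" "\<And>v. cmod v \<le> d \<Longrightarrow> admissible (heat (w + v))"
    and ex: "\<And>R. \<exists>A\<ge>0. \<forall>v. cmod v \<le> d \<longrightarrow> (\<forall>z\<in>strip R.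
      cmod (heat (w + v) z - heat w z + v * csymbol m c z * heat w z) \<le> (cmod v)\<^sup>2 * A * exp (- rl1 z))"
    using admissible_heat_near[OF w] by metis
  obtain A where A: "A \<ge> 0" "\<And>v z. cmod v \<le> d \<Longrightarrow> z \<in> strip (W + 1) \<Longrightarrow>
      cmod (heat (w + v) z - heat w z + v * csymbol m c z * heat w z) \<le> (cmod v)\<^sup>2 * A * exp (- rl1 z)"
    using ex[of "W + 1"] by blast
  define B where "B = M * (A / (pi * 1) ^ CARD('d) * (2 / (W + 1 - W)) ^ CARD('d)) * norm \<phi>"
  note hw = admissible_heat[OF w] and hh = admissible_symbol_heat[OF w]
  have B: "norm ((1 / v) *\<^sub>C (Z (w + v) \<phi> - Z w \<phi>) - - HZ w \<phi>) \<le> cmod v * B"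
    if v: "v \<noteq> 0" "cmod v \<le> d" for v
  proof -
    note hv = d(2)[OF v(2)]
    define D where "D z = (heat (w + v) z - heat w z) + v * (csymbol m c z * heat w z)" for z
    have D: "admissible D"
      unfolding D_def by (intro admissible_add admissible_diff admissible_cmult hw hh hv)
    have "cmod (D z) \<le> (cmod v)\<^sup>2 * A * exp (- (1 * rl1 z))" if "z \<in> strip (W + 1)" for z
      using A(2)[OF v(2) that] by (simp add: D_def mult.assoc)
    then have "norm (\<Psi> D \<phi>) \<le> M * ((cmod v)\<^sup>2 * A / (pi * 1) ^ CARD('d) * (2 / (W + 1 - W)) ^ CARD('d)) * norm \<phi>"
      by (intro \<Psi>_bound D) auto
    then have 1: "norm (\<Psi> D \<phi>) \<le> (cmod v)\<^sup>2 * B"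
      by (simp add: B_def mult_ac)
    have "\<Psi> D \<phi> = (Z (w + v) \<phi> - Z w \<phi>) + v *\<^sub>C HZ w \<phi>"
      unfolding D_def \<Psi>_add[OF admissible_diff[OF hv hw] admissible_cmult[OF hh]]
        \<Psi>_cmult[OF hh] \<Psi>_diff[OF hv hw] ..
    then have "(1 / v) *\<^sub>C (Z (w + v) \<phi> - Z w \<phi>) - - HZ w \<phi> = (1 / v) *\<^sub>C \<Psi> D \<phi>"
      using v(1) by (simp add: scaleC_add_right scaleC_scaleC)
    then have "norm ((1 / v) *\<^sub>C (Z (w + v) \<phi> - Z w \<phi>) - - HZ w \<phi>) = norm (\<Psi> D \<phi>) / cmod v"
      by (simp add: norm_scaleC norm_divide)
    also have "\<dots> \<le> (cmod v)\<^sup>2 * B / cmod v"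
      by (intro divide_right_mono 1) auto
    also have "\<dots> = cmod v * B"
      using v by (simp add: power2_eq_square)
    finally show ?thesis .
  qed
  show ?thesis
  proof (rule tendsto_sandwich[where f = "\<lambda>_. 0" and h = "\<lambda>v. cmod v * B"])
    show "\<forall>\<^sub>F v in at 0. norm ((1 / v) *\<^sub>C (Z (w + v) \<phi> - Z w \<phi>) - - HZ w \<phi>) \<le> cmod v * B"
      unfolding eventually_at by (intro exI[of _ d] conjI ballI impI B) (use d(1) in auto)
    have "((\<lambda>v. cmod v * B) \<longlongrightarrow> cmod 0 * B) (at 0)"
      by (intro tendsto_intros)
    then show "((\<lambda>v. cmod v * B) \<longlongrightarrow> 0) (at 0)"
      by simp
  qed auto
qed

lemma Z_functional_derivative:
  assumes w: "w \<in> sector \<theta>" and f: "f \<in> \<Union>\<Lambda>"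
  shows "((\<lambda>w. f (Z w \<phi>)) has_field_derivative - f (HZ w \<phi>)) (at w)"
proof -
  note lin = functional[OF f]
  have "((\<lambda>v. f ((1 / v) *\<^sub>C (Z (w + v) \<phi> - Z w \<phi>))) \<longlongrightarrow> f (- HZ w \<phi>)) (at 0)"
    by (rule limitin_functional[OF limitinI_norm[OF Z_derivative[OF w]] f])
  moreover have "f (- HZ w \<phi>) = - f (HZ w \<phi>)"
    using bounded_clinear_diff[OF lin, of 0 "HZ w \<phi>"] bounded_clinear_zero[OF lin] by simp
  ultimately show ?thesis
    unfolding DERIV_def
    by (simp add: bounded_clinear_scaleC[OF lin] bounded_clinear_diff[OF lin] scaleC_complex_def)
qed

lemma heat_zero_limit: "((\<lambda>w. heat w z) \<longlongrightarrow> 1) (at 0 within S)"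
proof -
  have "((\<lambda>w. exp (- w * csymbol m c z)) \<longlongrightarrow> exp (- 0 * csymbol m c z)) (at 0 within S)"
    by (intro tendsto_intros)
  then show ?thesis
    by (simp add: heat_def)
qed

end

section \<open>Behaviour of the kernels as time tends to zero\<close>

context elliptic_calculus
begin

text \<open>The second bound says that the kernel is concentrated at the scale |w|^(1/m) even
  against the growth of U: a weight of half the rate |w|^(-1/m) on top of W leaves the mass bounded,
  since the surplus 1 + |w|^(-1/m) / 2 of the strip still balances the rate \<gamma> |w|^(1/m). The
  factor 0 in the first bound makes it an instance of the same weighted estimate.\<close>

lemma heat_kernel_mass:
  obtains K1 K2 where "K1 \<ge> 0" "K2 \<ge> 0"
    "\<And>w. w \<in> sector \<theta> \<Longrightarrow> cmod w \<le> 1 \<Longrightarrow>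
      (\<integral>y. cmod (fourier_inv (heat w) y) * exp (0 * l1norm y) \<partial>lborel) \<le> K1"
    "\<And>w. w \<in> sector \<theta> \<Longrightarrow> cmod w \<le> 1 \<Longrightarrow>
      (\<integral>y. cmod (fourier_inv (heat w) y) * exp ((W + cmod w powr (- 1 / m) / 2) * l1norm y) \<partial>lborel) \<le> K2"
proof -
  obtain a b \<omega> \<gamma> where ab: "a > 0" "b > 0" "\<omega> \<ge> 0" "\<gamma> > 0"
    and bound: "\<And>w \<alpha> z. w \<in> sector \<theta> \<Longrightarrow> z \<in> strip (W + 1 + cmod w powr (- 1 / m)) \<Longrightarrow>
      cmod (monomial \<alpha> z * heat w z)
        \<le> (a * b ^ length \<alpha> * cmod w powr (- real (length \<alpha>) / m) * fact (length \<alpha>) powr (1 / m)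
            * exp (\<omega> * cmod w)) * exp (- (\<gamma> * cmod w powr (1 / m) * rl1 z))"
    using monomial_heat_bound[OF W] by metis
  \<comment> \<open>\<open>cmod w \<le> 1\<close> lets exp \<omega> replace exp(\<omega>
    |w|).\<close>
  define A where "A = a * exp \<omega>"
  have A: "A \<ge> 0"
    using ab by (simp add: A_def)
  have est: "(\<integral>y. cmod (fourier_inv (heat w) y) * exp (v * l1norm y) \<partial>lborel) \<le> A * (2 / (pi * q)) ^ CARD('d)"
    if w: "w \<in> sector \<theta>" "cmod w \<le> 1" and v: "v < W + 1 + cmod w powr (- 1 / m)"
      and q: "q > 0" "q \<le> (\<gamma> * cmod w powr (1 / m)) * (W + 1 + cmod w powr (- 1 / m) - v)" for w v q
  proof -
    define t where "t = cmod w"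
    define R where "R = W + 1 + t powr (- 1 / m)"
    have t: "t > 0" "t \<le> 1"
      using sector_nonzero[OF w(1)] w(2) by (simp_all add: t_def)
    have g: "\<gamma> * t powr (1 / m) > 0"
      using ab t by simp
    have R: "R \<ge> 0" "v < R"
      using W v by (simp_all add: R_def t_def)
    have heat: "cmod (heat w z) \<le> A * exp (- (\<gamma> * t powr (1 / m) * rl1 z))" if z: "z \<in> strip R" for z
    proof -
      have "cmod (heat w z) \<le> (a * exp (\<omega> * t)) * exp (- (\<gamma> * t powr (1 / m) * rl1 z))"
        using bound[OF w(1), of z "[]"] z t by (simp add: R_def t_def)
      also have "\<dots> \<le> A * exp (- (\<gamma> * t powr (1 / m) * rl1 z))"
        using ab t mult_left_mono[of t 1 \<omega>] unfolding A_def by (intro mult_right_mono mult_left_mono) auto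
      finally show ?thesis .
    qed
    have "(\<integral>y. cmod (fourier_inv (heat w) y) * exp (v * l1norm y) \<partial>lborel)
        \<le> A / (pi * (\<gamma> * t powr (1 / m))) ^ CARD('d) * (2 / (R - v)) ^ CARD('d)"
      by (rule integral_fourier_inv_weighted[OF admissible_heat[OF w(1)] g R heat])
    also have "\<dots> \<le> A * (2 / (pi * q)) ^ CARD('d)"
      using g R q A by (intro kernel_scaling) (auto simp: R_def t_def)
    finally show ?thesis .
  qed
  have st: "t powr (1 / m) * t powr (- 1 / m) = 1" if "t > 0" for t :: real
    using that by (simp add: powr_add[symmetric])
  show thesis
  proof (rule that[of "A * (2 / (pi * \<gamma>)) ^ CARD('d)" "A * (2 / (pi * (\<gamma> / 2))) ^ CARD('d)"])
    fix w
    assume w: "w \<in> sector \<theta>" "cmod w \<le> 1"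
    define s where "s = cmod w powr (1 / m)"
    define r where "r = cmod w powr (- 1 / m)"
    have s: "s > 0" "r > 0" "s * r = 1"
      using sector_nonzero[OF w(1)] st[of "cmod w"] by (simp_all add: s_def r_def)
    have "s * (W + 1 + r) \<ge> 1"
      using s W by (simp add: distrib_left)
    then have g1: "\<gamma> * 1 \<le> \<gamma> * (s * (W + 1 + r))"
      using ab by (intro mult_left_mono) auto
    show "(\<integral>y. cmod (fourier_inv (heat w) y) * exp (0 * l1norm y) \<partial>lborel)
        \<le> A * (2 / (pi * \<gamma>)) ^ CARD('d)"
      by (rule est[OF w], unfold s_def[symmetric] r_def[symmetric])
        (use W s ab g1 in \<open>auto simp: mult.assoc\<close>)
    have "s * (1 + r / 2) \<ge> 1 / 2"
      using s by (simp add: distrib_left)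
    then have "\<gamma> * (1 / 2) \<le> \<gamma> * (s * (1 + r / 2))"
      using ab by (intro mult_left_mono) auto
    moreover have "W + 1 + r - (W + r / 2) = 1 + r / 2"
      by simp
    ultimately have g2: "\<gamma> / 2 \<le> \<gamma> * s * (W + 1 + r - (W + r / 2))"
      by (simp only: mult.assoc)
    show "(\<integral>y. cmod (fourier_inv (heat w) y) * exp ((W + cmod w powr (- 1 / m) / 2) * l1norm y) \<partial>lborel)
        \<le> A * (2 / (pi * (\<gamma> / 2))) ^ CARD('d)"
      by (rule est[OF w], unfold s_def[symmetric] r_def[symmetric]) (use s ab g2 in auto)
  qed (use A ab in auto)
qed

text \<open>An approximate identity argument, uniform over f in S. Near 0 the orbit is within e' of
  \<phi> and the mass bound K1 applies; elsewhere concentration at the scale s = |w|^(1/m) produces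
  a factor s. The total mass is heat w 0, which tends to 1. The three parts are allotted e/4, e/4
  and e/2.\<close>

lemma Z_limit: "limitin T (\<lambda>w. Z w \<phi>) \<phi> (at 0 within sector \<theta>)"
  unfolding limitin_iff
proof (intro ballI allI impI)
  fix S and e :: real
  assume S: "S \<in> \<Lambda>" and e: "e > 0"
  obtain K where K: "K \<ge> 0" "\<And>f x. f \<in> S \<Longrightarrow> cmod (f x) \<le> K * norm x"
    using equibounded[OF S] by blast
  obtain K1 K2 where K1: "K1 \<ge> 0" and K2: "K2 \<ge> 0"
    and I1: "\<And>w. w \<in> sector \<theta> \<Longrightarrow> cmod w \<le> 1 \<Longrightarrow>
      (\<integral>y. cmod (fourier_inv (heat w) y) * exp (0 * l1norm y) \<partial>lborel) \<le> K1"
    and I2: "\<And>w. w \<in> sector \<theta> \<Longrightarrow> cmod w \<le> 1 \<Longrightarrow>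
      (\<integral>y. cmod (fourier_inv (heat w) y) * exp ((W + cmod w powr (- 1 / m) / 2) * l1norm y) \<partial>lborel) \<le> K2"
    by (rule heat_kernel_mass) (rule that)
  define e' where "e' = e / (4 * (K1 + 1))"
  have e': "e' > 0" "e' * K1 \<le> e / 4"
    using e K1 by (auto simp: e'_def field_simps)
  have "\<forall>\<^sub>F y in at 0. \<forall>f\<in>S. cmod (f (U y \<phi> - \<phi>)) \<le> e'"
    using continuous_at_0[of \<phi>] S e'(1) unfolding limitin_iff by blast
  then obtain \<delta> where \<delta>: "\<delta> > 0"
    "\<And>y f. y \<noteq> 0 \<Longrightarrow> dist y 0 < \<delta> \<Longrightarrow> f \<in> S \<Longrightarrow> cmod (f (U y \<phi> - \<phi>)) \<le> e'"
    unfolding eventually_at by blast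
  \<comment> \<open>Outside the ball of radius \<delta> the number l1norm y / \<delta> is at least
    1; inserting it into the growth bound supplies the factor l1norm y that will be traded for
    s.\<close>
  define Q where "Q = K * (M + 1) * norm \<phi> / \<delta>"
  have Q: "Q \<ge> 0"
    using K M \<delta> by (simp add: Q_def)
  have orbit: "cmod (f (U y \<phi> - \<phi>)) \<le> e' + Q * (l1norm y * exp (W * l1norm y))" if f: "f \<in> S" for f y
  proof (cases "y \<noteq> 0 \<and> dist y 0 < \<delta>")
    case True
    then show ?thesis
      using \<delta>(2)[of y f] f Q by (simp add: add_increasing2)
  next
    case False
    show ?thesis
    proof (cases "y = 0")
      case True
      have "f 0 = 0"
        using functional[of f] f S bounded_clinear_zero by blast
      then show ?thesis
        using True e' Q by (simp add: U_zero)
    next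
      case y: False
      then have "\<delta> \<le> l1norm y"
        using False norm_le_l1norm[of y] by simp
      have "norm (U y \<phi> - \<phi>) \<le> M * exp (W * l1norm y) * norm \<phi> + 1 * norm \<phi>"
        using norm_triangle_ineq4[of "U y \<phi>" \<phi>] growth[of y \<phi>] by simp
      also have "\<dots> \<le> M * exp (W * l1norm y) * norm \<phi> + exp (W * l1norm y) * norm \<phi>"
        using W by (intro add_left_mono mult_right_mono) auto
      finally have "K * norm (U y \<phi> - \<phi>) \<le> K * ((M + 1) * norm \<phi> * exp (W * l1norm y))"
        using K by (intro mult_left_mono) (auto simp: algebra_simps)
      also have "\<dots> = Q * (\<delta> * exp (W * l1norm y))"
        using \<delta> by (simp add: Q_def)
      also have "\<dots> \<le> Q * (l1norm y * exp (W * l1norm y))"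
        using \<open>\<delta> \<le> l1norm y\<close> Q by (intro mult_left_mono mult_right_mono) auto
      finally show ?thesis
        using K(2)[OF f, of "U y \<phi> - \<phi>"] e' by simp
    qed
  qed
  define P where "P = Q * K2 + 1"
  \<comment> \<open>\<eta> bounds the scale s = |w|^(1/m), and the distant part contributes 2 Q
    \<eta> K2. The summand 1 in P keeps the quotient defined.\<close>
  define \<eta> where "\<eta> = min 1 (e / (8 * P))"
  have \<eta>: "\<eta> > 0" "2 * Q * \<eta> * K2 \<le> e / 4"
  proof -
    have p: "P > 0"
      using Q K2 by (simp add: P_def add_nonneg_pos)
    then show "\<eta> > 0"
      using e by (simp add: \<eta>_def)
    have "2 * Q * \<eta> * K2 = 2 * (Q * K2) * \<eta>"
      by simp
    also have "\<dots> \<le> 2 * P * (e / (8 * P))"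
      using Q K2 \<open>\<eta> > 0\<close> by (intro mult_mono) (auto simp: \<eta>_def P_def)
    also have "\<dots> = e / 4"
      using p by simp
    finally show "2 * Q * \<eta> * K2 \<le> e / 4" .
  qed
  have main: "cmod (f (Z w \<phi> - \<phi>)) \<le> e / 2 + cmod (heat w 0 - 1) * (K * norm \<phi>)"
    if w: "w \<in> sector \<theta>" "cmod w \<le> 1" "cmod w \<le> \<eta> ^ m" and f: "f \<in> S" for w f
  proof -
    define s where "s = cmod w powr (1 / m)"
    define r where "r = cmod w powr (- 1 / m)"
    define k where "k = fourier_inv (heat w)"
    have fL: "f \<in> \<Union>\<Lambda>"
      using f S by blast
    note lin = functional[OF fL] and hw = admissible_heat[OF w(1)]
    have tau: "cmod w > 0"
      by (rule sector_nonzero[OF w(1)])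
    have sr: "s > 0" "r = 1 / s"
      using tau by (simp_all add: s_def r_def powr_minus_divide)
    have "s \<le> (\<eta> ^ m) powr (1 / m)"
      unfolding s_def using w by (intro powr_mono2) auto
    also have "\<dots> = \<eta>"
      using \<eta>(1) m by (simp add: powr_realpow[symmetric] powr_powr)
    finally have s_le: "s \<le> \<eta>" .
    have pt: "cmod (f (U y \<phi> - \<phi>)) \<le> e' + 2 * Q * s * exp ((W + r / 2) * l1norm y)" for y
    proof -
      \<comment> \<open>u \<le> exp u at u = l1norm y / (2 s) trades the factor l1norm y for 2 s and
        half of the rate r = 1 / s, which is the weight of the second mass bound.\<close>
      have "l1norm y / (2 * s) \<le> exp (l1norm y / (2 * s))"
        using exp_ge_add_one_self[of "l1norm y / (2 * s)"] by linarith
      then have "l1norm y \<le> 2 * s * exp (l1norm y / (2 * s))"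
        using sr(1) by (simp add: field_simps)
      then have "l1norm y * exp (W * l1norm y) \<le> 2 * s * exp (l1norm y / (2 * s)) * exp (W * l1norm y)"
        by (intro mult_right_mono) auto
      also have "\<dots> = 2 * s * exp ((W + r / 2) * l1norm y)"
        by (simp add: exp_add[symmetric] sr(2) algebra_simps)
      finally have "Q * (l1norm y * exp (W * l1norm y)) \<le> Q * (2 * s * exp ((W + r / 2) * l1norm y))"
        using Q by (intro mult_left_mono)
      then show ?thesis
        using orbit[OF f, of y] by (simp add: mult_ac)
    qed
    have i0: "integrable lborel k"
      unfolding k_def by (rule integrable_fourier_inv[OF hw])
    have i1: "integrable lborel (\<lambda>y. cmod (k y) * exp (v * l1norm y))" for v
      unfolding k_def by (rule integrable_fourier_inv_weighted[OF hw])
    \<comment> \<open>The integral of the kernel is its symbol at 0, so subtracting heat w 0 times f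
      \<phi> centres the orbit at \<phi> under the integral.\<close>
    have "f (Z w \<phi>) - heat w 0 * f \<phi> = (\<integral>y. k y * f (U y \<phi>) \<partial>lborel) - (\<integral>y. k y * f \<phi> \<partial>lborel)"
      using integral_fourier_inv[OF hw] i0
      by (simp add: \<Psi>_functional_eq[OF hw fL] k_def)
    also have "\<dots> = (\<integral>y. k y * f (U y \<phi> - \<phi>) \<partial>lborel)"
      using \<Psi>_functional[OF hw fL, of \<phi>] i0
      by (subst Bochner_Integration.integral_diff[symmetric])
        (auto simp: has_bochner_integral_iff k_def bounded_clinear_diff[OF lin] right_diff_distrib)
    also have "cmod \<dots> \<le> (\<integral>y. e' * (cmod (k y) * exp (0 * l1norm y))
        + 2 * Q * s * (cmod (k y) * exp ((W + r / 2) * l1norm y)) \<partial>lborel)"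
    proof (rule norm_integral_le)
      fix y
      have "cmod (k y) * cmod (f (U y \<phi> - \<phi>)) \<le> cmod (k y) * (e' + 2 * Q * s * exp ((W + r / 2) * l1norm y))"
        by (intro mult_left_mono pt) auto
      then show "cmod (k y * f (U y \<phi> - \<phi>)) \<le> e' * (cmod (k y) * exp (0 * l1norm y))
          + 2 * Q * s * (cmod (k y) * exp ((W + r / 2) * l1norm y))"
        by (simp add: norm_mult algebra_simps)
    qed (intro Bochner_Integration.integrable_add integrable_mult_right i1)
    also have "\<dots> = e' * (\<integral>y. cmod (k y) * exp (0 * l1norm y) \<partial>lborel)
        + 2 * Q * s * (\<integral>y. cmod (k y) * exp ((W + r / 2) * l1norm y) \<partial>lborel)"
      using i1[of 0] i1[of "W + r / 2"] by (subst Bochner_Integration.integral_add) auto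
    also have "\<dots> \<le> e' * K1 + 2 * Q * \<eta> * K2"
      using e' Q sr(1) s_le \<eta>(1) K2 I1[OF w(1,2)] I2[OF w(1,2)] unfolding k_def r_def
      by (intro add_mono mult_mono mult_left_mono) auto
    also have "\<dots> \<le> e / 2"
      using e'(2) \<eta>(2) by simp
    finally have 1: "cmod (f (Z w \<phi>) - heat w 0 * f \<phi>) \<le> e / 2" .
    have "f (Z w \<phi> - \<phi>) = (f (Z w \<phi>) - heat w 0 * f \<phi>) + (heat w 0 - 1) * f \<phi>"
      by (simp add: bounded_clinear_diff[OF lin] algebra_simps)
    also have "cmod \<dots> \<le> e / 2 + cmod (heat w 0 - 1) * (K * norm \<phi>)"
      using norm_triangle_ineq[of "f (Z w \<phi>) - heat w 0 * f \<phi>" "(heat w 0 - 1) * f \<phi>"] 1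
        mult_left_mono[OF K(2)[OF f, of \<phi>], of "cmod (heat w 0 - 1)"]
      by (simp add: norm_mult)
    finally show ?thesis .
  qed
  have "((\<lambda>w. cmod (heat w 0 - 1) * (K * norm \<phi>)) \<longlongrightarrow> cmod (1 - 1) * (K * norm \<phi>)) (at 0 within sector \<theta>)"
    by (intro tendsto_intros heat_zero_limit)
  then have "\<forall>\<^sub>F w in at 0 within sector \<theta>. cmod (heat w 0 - 1) * (K * norm \<phi>) < e / 2"
    by (rule order_tendstoD) (use e in auto)
  moreover have "\<forall>\<^sub>F w in at 0 within sector \<theta>. w \<in> sector \<theta> \<and> cmod w \<le> 1 \<and> cmod w \<le> \<eta> ^ m"
    unfolding eventually_at by (intro exI[of _ "min 1 (\<eta> ^ m)"]) (use \<eta> in auto)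
  ultimately show "\<forall>\<^sub>F w in at 0 within sector \<theta>. \<forall>f\<in>S. cmod (f (Z w \<phi> - \<phi>)) \<le> e"
  proof eventually_elim
    case (elim w)
    show ?case
    proof
      fix f
      assume "f \<in> S"
      then show "cmod (f (Z w \<phi> - \<phi>)) \<le> e"
        using main[of w f] elim by simp
    qed
  qed
qed

lemma Z_mult:
  assumes "w \<in> sector \<theta>" "v \<in> sector \<theta>"
  shows "Z w (Z v \<phi>) = Z (w + v) \<phi>"
  using \<Psi>_mult[OF admissible_heat[OF assms(1)] admissible_heat[OF assms(2)]]
  by (simp add: heat_add[abs_def])

lemma Z_limit_real: "limitin T (\<lambda>t. Z (complex_of_real t) \<phi>) \<phi> (at_right 0)"
proof (rule limitin_compose_filterlim[OF Z_limit])
  have "((\<lambda>t. complex_of_real t) \<longlongrightarrow> complex_of_real 0) (at_right 0)"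
    by (intro tendsto_intros)
  moreover have "\<forall>\<^sub>F t in at_right (0::real). complex_of_real t \<in> sector \<theta> \<and> complex_of_real t \<noteq> 0"
    unfolding eventually_at_right_field by (intro exI[of _ 1]) (auto simp: of_real_in_sector)
  ultimately show "filterlim complex_of_real (at 0 within sector \<theta>) (at_right 0)"
    by (simp add: filterlim_at)
qed

section \<open>The generator and the closure of the differential operator\<close>

definition heat_generator :: "('a \<times> 'a) set"
  where "heat_generator = {(\<phi>, \<psi>). \<forall>t>0. Z (complex_of_real t) \<psi> = HZ (complex_of_real t) \<phi>}"

text \<open>The equation d/ds Z s \<phi> = - Z s \<psi> is not integrated over [0, t]; the mean
  value inequality is applied to each functional instead, and its bound is uniform over S, as
  convergence in T requires.\<close>

lemma heat_generator_limit:
  assumes "(\<phi>, \<psi>) \<in> heat_generator"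
  shows "limitin T (\<lambda>t. (1 / t) *\<^sub>R (\<phi> - Z (complex_of_real t) \<phi>)) \<psi> (at_right 0)"
  unfolding limitin_iff
proof (intro ballI allI impI)
  fix S and e :: real
  assume S: "S \<in> \<Lambda>" and e: "e > 0"
  then have "\<forall>\<^sub>F t in at_right 0. \<forall>f\<in>S. cmod (f (Z (complex_of_real t) \<psi> - \<psi>)) \<le> e"
    using Z_limit_real[of \<psi>] unfolding limitin_iff by blast
  then obtain d where d: "d > 0"
    "\<And>t f. 0 < t \<Longrightarrow> t < d \<Longrightarrow> f \<in> S \<Longrightarrow> cmod (f (Z (complex_of_real t) \<psi> - \<psi>)) \<le> e"
    unfolding eventually_at_right_field by blast
  have "cmod (f ((1 / t) *\<^sub>R (\<phi> - Z (complex_of_real t) \<phi>) - \<psi>)) \<le> e"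
    if t: "0 < t" "t < d" and f: "f \<in> S" for t f
  proof -
    have fL: "f \<in> \<Union>\<Lambda>"
      using f S by blast
    note lin = functional[OF fL]
    \<comment> \<open>The value at 0 is the limit given by \<open>Z_limit_real\<close>: heat 0 = 1
      is not admissible, so Z 0 has no meaning. The derivative of g at s > 0 is f applied to \<psi>
      - Z s \<psi>.\<close>
    define g where "g s = (if s = 0 then f \<phi> else f (Z (complex_of_real s) \<phi>)) + s *\<^sub>R f \<psi>" for s
    have der: "(g has_vector_derivative f (\<psi> - Z (complex_of_real s) \<psi>)) (at s)" if s: "s > 0" for s
    proof -
      have "((\<lambda>s. f (Z (complex_of_real s) \<phi>)) has_vector_derivative - f (HZ (complex_of_real s) \<phi>)) (at s)"
        by (rule has_vector_derivative_real_field[OF Z_functional_derivative[OF of_real_in_sector[OF s] fL]])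
      then have "((\<lambda>s. f (Z (complex_of_real s) \<phi>) + s *\<^sub>R f \<psi>) has_vector_derivative
          - f (HZ (complex_of_real s) \<phi>) + 1 *\<^sub>R f \<psi>) (at s)"
        by (intro has_vector_derivative_add) (auto intro!: derivative_eq_intros)
      moreover have "- f (HZ (complex_of_real s) \<phi>) + 1 *\<^sub>R f \<psi> = f (\<psi> - Z (complex_of_real s) \<psi>)"
        using assms s by (simp add: heat_generator_def bounded_clinear_diff[OF lin])
      ultimately have *: "((\<lambda>s. f (Z (complex_of_real s) \<phi>) + s *\<^sub>R f \<psi>) has_vector_derivative
          f (\<psi> - Z (complex_of_real s) \<psi>)) (at s)"
        by simp
      show ?thesis
        by (rule has_vector_derivative_transform_within_open[OF *, of "{0<..}"]) (use s in \<open>auto simp: g_def\<close>)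
    qed
    have "continuous_on {0..t} g"
      unfolding continuous_on_eq_continuous_within
    proof
      fix s
      assume s: "s \<in> {0..t}"
      show "continuous (at s within {0..t}) g"
      proof (cases "s = 0")
        case True
        have "((\<lambda>s. f (Z (complex_of_real s) \<phi>) + s *\<^sub>R f \<psi>) \<longlongrightarrow> f \<phi> + 0 *\<^sub>R f \<psi>) (at_right 0)"
          by (intro tendsto_intros limitin_functional[OF Z_limit_real fL])
        moreover have "\<forall>\<^sub>F s in at_right 0. f (Z (complex_of_real s) \<phi>) + s *\<^sub>R f \<psi> = g s"
          by (auto simp: g_def eventually_at_filter)
        ultimately have "(g \<longlongrightarrow> f \<phi> + 0 *\<^sub>R f \<psi>) (at_right 0)"
          by (rule Lim_transform_eventually)
        then have "(g \<longlongrightarrow> g 0) (at_right 0)"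
          by (simp add: g_def)
        then have "(g \<longlongrightarrow> g 0) (at 0 within {0..t})"
          using t by (simp add: at_within_Icc_at_right)
        then show ?thesis
          by (simp add: continuous_within True)
      next
        case False
        then have "s > 0"
          using s by simp
        from has_vector_derivative_continuous[OF der[OF this]] show ?thesis
          by (rule continuous_at_imp_continuous_at_within)
      qed
    qed
    then obtain s where s: "s \<in> {0<..<t}" "norm (g t - g 0) \<le> norm ((t - 0) *\<^sub>R f (\<psi> - Z (complex_of_real s) \<psi>))"
      using mvt_general[of 0 t g "\<lambda>s h. h *\<^sub>R f (\<psi> - Z (complex_of_real s) \<psi>)"] t der
      unfolding has_vector_derivative_def by blast
    have "cmod (f (\<psi> - Z (complex_of_real s) \<psi>)) = cmod (f (Z (complex_of_real s) \<psi> - \<psi>))"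
      by (simp add: bounded_clinear_diff[OF lin] norm_minus_commute)
    also have "\<dots> \<le> e"
      using d(2)[of s f] s(1) t f by simp
    finally have le: "cmod (f (\<psi> - Z (complex_of_real s) \<psi>)) \<le> e" .
    have "norm (g t - g 0) \<le> t * cmod (f (\<psi> - Z (complex_of_real s) \<psi>))"
      using s(2) t by simp
    then have "norm (g t - g 0) \<le> t * e"
      by (rule order_trans) (use le t in \<open>intro mult_left_mono, auto\<close>)
    moreover have "f ((1 / t) *\<^sub>R (\<phi> - Z (complex_of_real t) \<phi>) - \<psi>) = - ((1 / t) *\<^sub>R (g t - g 0))"
      using t unfolding scaleR_scaleC
      by (simp add: g_def bounded_clinear_diff[OF lin] bounded_clinear_scaleC[OF lin] scaleC_complex_def
          scaleR_conv_of_real field_simps)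
    ultimately have "cmod (f ((1 / t) *\<^sub>R (\<phi> - Z (complex_of_real t) \<phi>) - \<psi>)) \<le> (1 / t) * (t * e)"
      using t by (simp only: norm_minus_cancel norm_scaleR) (intro mult_mono, auto)
    then show ?thesis
      using t by simp
  qed
  then show "\<forall>\<^sub>F t in at_right 0. \<forall>f\<in>S. cmod (f ((1 / t) *\<^sub>R (\<phi> - Z (complex_of_real t) \<phi>) - \<psi>)) \<le> e"
    unfolding eventually_at_right_field using d(1) by blast
qed

text \<open>The T-continuous operator Z s turns the difference quotient at 0 into the one at s,
  where Z is differentiable in norm with derivative - HZ s \<phi>; uniqueness of limits compares the
  two.\<close>

lemma heat_generator_of_limit:
  assumes lim: "limitin T (\<lambda>t. (1 / t) *\<^sub>R (\<phi> - Z (complex_of_real t) \<phi>)) \<psi> (at_right 0)"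
  shows "(\<phi>, \<psi>) \<in> heat_generator"
  unfolding heat_generator_def
proof (intro CollectI case_prodI allI impI)
  fix s :: real
  assume s: "s > 0"
  define w where "w = complex_of_real s"
  have w: "w \<in> sector \<theta>"
    using of_real_in_sector[OF s] by (simp add: w_def)
  note lin = \<Psi>_linear[OF admissible_heat[OF w]]
  define q where "q t = (1 / t) *\<^sub>R (Z w \<phi> - Z (w + complex_of_real t) \<phi>)" for t
  have "limitin T (Z w \<circ> (\<lambda>t. (1 / t) *\<^sub>R (\<phi> - Z (complex_of_real t) \<phi>))) (Z w \<psi>) (at_right 0)"
    by (rule continuous_map_limit[OF \<Psi>_continuous[OF admissible_heat[OF w]] lim])
  then have "limitin T q (Z w \<psi>) (at_right 0)"
  proof (rule limitin_eventually_eq)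
    show "\<forall>\<^sub>F t in at_right 0. (Z w \<circ> (\<lambda>t. (1 / t) *\<^sub>R (\<phi> - Z (complex_of_real t) \<phi>))) t = q t"
      unfolding eventually_at_right_field
      by (intro exI[of _ 1]) (auto simp: q_def scaleR_scaleC bounded_clinear_scaleC[OF lin]
          bounded_clinear_diff[OF lin] Z_mult[OF w of_real_in_sector])
  qed
  moreover have "limitin T q (HZ w \<phi>) (at_right 0)"
  proof (rule limitinI_norm)
    have "filterlim complex_of_real (at 0) (at_right 0)"
      by (auto simp: filterlim_at eventually_at_filter intro!: tendsto_eq_intros)
    from filterlim_compose[OF Z_derivative[OF w, of \<phi>] this]
    have "((\<lambda>t. norm ((1 / complex_of_real t) *\<^sub>C (Z (w + complex_of_real t) \<phi> - Z w \<phi>) - - HZ w \<phi>)) \<longlongrightarrow> 0) (at_right 0)"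
      by simp
    moreover have "norm ((1 / complex_of_real t) *\<^sub>C (Z (w + complex_of_real t) \<phi> - Z w \<phi>) - - HZ w \<phi>)
        = norm (q t - HZ w \<phi>)" for t
    proof -
      have "(1 / complex_of_real t) *\<^sub>C (Z (w + complex_of_real t) \<phi> - Z w \<phi>) - - HZ w \<phi> = - (q t - HZ w \<phi>)"
        by (simp add: q_def scaleR_scaleC scaleC_diff_right)
      then show ?thesis
        by (simp only: norm_minus_cancel)
    qed
    ultimately show "((\<lambda>t. norm (q t - HZ w \<phi>)) \<longlongrightarrow> 0) (at_right 0)"
      by simp
  qed
  ultimately show "Z (complex_of_real s) \<psi> = HZ (complex_of_real s) \<phi>"
    unfolding w_def[symmetric] by (rule limitin_unique) simp
qed

text \<open>The set is closed because Z t and HZ t are continuous into a Hausdorff space.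
  Conversely, if Z t \<psi> = HZ t \<phi>, the pair (Z t \<phi>, Z t \<psi>) lies in the graph of
  H^(U), and it converges to (\<phi>, \<psi>) as t tends to 0.\<close>

lemma heat_generator_closure: "prod_topology T T closure_of rep_operator T U m c = heat_generator"
proof
  have closed: "closedin (prod_topology T T) heat_generator"
  proof -
    have "heat_generator = (\<Inter>t\<in>{0<..}. {p \<in> topspace (prod_topology T T).
        Z (complex_of_real t) (snd p) = HZ (complex_of_real t) (fst p)})"
      by (auto simp: heat_generator_def topspace)
    moreover have "closedin (prod_topology T T) {p \<in> topspace (prod_topology T T).
        Z (complex_of_real t) (snd p) = HZ (complex_of_real t) (fst p)}" if "t > 0" for t
    proof (rule closedin_continuous_maps_eq[OF hausdorff])
      note w = of_real_in_sector[OF that]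
      show "continuous_map (prod_topology T T) T (\<lambda>p. Z (complex_of_real t) (snd p))"
        using continuous_map_compose[OF continuous_map_snd \<Psi>_continuous[OF admissible_heat[OF w]]]
        by (simp add: comp_def)
      show "continuous_map (prod_topology T T) T (\<lambda>p. HZ (complex_of_real t) (fst p))"
        using continuous_map_compose[OF continuous_map_fst \<Psi>_continuous[OF admissible_symbol_heat[OF w]]]
        by (simp add: comp_def)
    qed
    ultimately show ?thesis
      by (auto intro!: closedin_Inter)
  qed
  have "rep_operator T U m c \<subseteq> heat_generator"
    unfolding heat_generator_def
    using \<Psi>_rep_operator_right[OF admissible_heat[OF of_real_in_sector]] by auto
  then show "prod_topology T T closure_of rep_operator T U m c \<subseteq> heat_generator"
    using closed by (rule closure_of_minimal)
  show "heat_generator \<subseteq> prod_topology T T closure_of rep_operator T U m c"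
  proof
    fix p
    assume p: "p \<in> heat_generator"
    obtain \<phi> \<psi> where p_eq: "p = (\<phi>, \<psi>)"
      by (cases p)
    define q where "q t = (Z (complex_of_real t) \<phi>, Z (complex_of_real t) \<psi>)" for t
    show "p \<in> prod_topology T T closure_of rep_operator T U m c"
    proof (rule limitin_in_closure_of)
      show "limitin (prod_topology T T) q p (at_right 0)"
        unfolding limitin_pairwise q_def p_eq comp_def using Z_limit_real by simp
      have "q t \<in> rep_operator T U m c" if "t > 0" for t
        using p \<Psi>_rep_operator[OF admissible_heat[OF of_real_in_sector[OF that]], of \<phi> m c] that
        by (simp add: q_def heat_generator_def p_eq)
      then show "\<forall>\<^sub>F t in at_right 0. q t \<in> rep_operator T U m c"
        unfolding eventually_at_right_field by (intro exI[of _ 1]) auto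
    qed simp
  qed
qed

section \<open>The operators U(K_t) as a continuous and holomorphic semigroup\<close>

lemma fourier_inv_heat: "fourier_inv (heat (complex_of_real t)) = heat_kernel m c t"
  by (simp add: fun_eq_iff fourier_inv_def heat_kernel_def heat_def csymbol_cvec)

lemma rep_semigroup_eq: "rep_semigroup J U m c t \<phi> = (if t = 0 then \<phi> else Z (complex_of_real t) \<phi>)"
  by (simp add: rep_semigroup_def \<Psi>_def fourier_inv_heat)

lemma rep_semigroup_pos: "t > 0 \<Longrightarrow> rep_semigroup J U m c t = Z (complex_of_real t)"
  by (simp add: fun_eq_iff rep_semigroup_eq)

lemma rep_integral_ex1:
  assumes "t > 0"
  shows "\<exists>!\<psi>. J (\<lambda>y. heat_kernel m c t y *\<^sub>C U y \<phi>) \<psi>"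
proof -
  note adm = admissible_heat[OF of_real_in_sector[OF assms]]
  show ?thesis
    unfolding fourier_inv_heat[symmetric]
    by (rule ex1I[where P = "J (\<lambda>y. fourier_inv (heat (complex_of_real t)) y *\<^sub>C U y \<phi>)",
          OF \<Psi>_integral[OF adm]])
      (rule integral_unique[OF exp_integrable_fourier_inv[OF adm] _ \<Psi>_integral[OF adm]])
qed

lemma limitin_rep_semigroup_0: "limitin T (\<lambda>t. rep_semigroup J U m c t \<phi>) \<phi> (at_right 0)"
  by (rule limitin_eventually_eq[OF Z_limit_real]) (auto simp: rep_semigroup_eq eventually_at_filter)

lemma continuous_semigroup_rep: "continuous_semigroup T (rep_semigroup J U m c)"
  unfolding continuous_semigroup_def
proof (intro conjI allI impI)
  fix t :: real
  assume t: "0 \<le> t"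
  have S0: "rep_semigroup J U m c 0 = (\<lambda>\<phi>. \<phi>)"
    by (simp add: fun_eq_iff rep_semigroup_eq)
  show "bounded_clinear (rep_semigroup J U m c t)"
  proof (cases "t = 0")
    case True
    then show ?thesis
      by (simp add: S0 bounded_clinear_def bounded_linear_ident)
  next
    case False
    then show ?thesis
      using t by (simp add: rep_semigroup_pos \<Psi>_linear admissible_heat of_real_in_sector)
  qed
  show "continuous_map T T (rep_semigroup J U m c t)"
  proof (cases "t = 0")
    case True
    then show ?thesis
      using continuous_map_id[of T] by (simp add: S0 id_def)
  next
    case False
    then show ?thesis
      using t by (simp add: rep_semigroup_pos \<Psi>_continuous admissible_heat of_real_in_sector)
  qed
next
  show "rep_semigroup J U m c 0 = id"
    by (simp add: fun_eq_iff rep_semigroup_eq)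
next
  fix s t :: real
  assume s: "0 \<le> s" and t: "0 \<le> t"
  show "rep_semigroup J U m c (s + t) = rep_semigroup J U m c s \<circ> rep_semigroup J U m c t"
  proof (cases "s = 0 \<or> t = 0")
    case True
    then show ?thesis
      by (auto simp: fun_eq_iff rep_semigroup_eq)
  next
    case False
    then have "s > 0" "t > 0"
      using s t by auto
    then show ?thesis
      by (simp add: fun_eq_iff rep_semigroup_pos Z_mult of_real_in_sector)
  qed
next
  fix \<phi>
  show "continuous_map (top_of_set {0..}) T (\<lambda>t. rep_semigroup J U m c t \<phi>)"
  proof (rule continuous_map_half_line)
    fix x :: real
    assume x: "x \<ge> 0"
    show "limitin T (\<lambda>t. rep_semigroup J U m c t \<phi>) (rep_semigroup J U m c x \<phi>) (at x within {0..})"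
    proof (cases "x = 0")
      case True
      have "limitin T (\<lambda>t. rep_semigroup J U m c t \<phi>) \<phi> (at 0 within {0..})"
        using limitin_rep_semigroup_0 at_within_Ici_at_right[of "0::real"] by simp
      then show ?thesis
        by (simp add: True rep_semigroup_eq)
    next
      case False
      then have x: "x > 0"
        using x by simp
      define w where "w = complex_of_real x"
      have w: "w \<in> sector \<theta>"
        using of_real_in_sector[OF x] by (simp add: w_def)
      \<comment> \<open>At positive times continuity follows from differentiability: the increment
        of Z is v times the difference quotient.\<close>
      have "((\<lambda>v. cmod v * norm ((1 / v) *\<^sub>C (Z (w + v) \<phi> - Z w \<phi>) - - HZ w \<phi>) + cmod v * norm (HZ w \<phi>))
          \<longlongrightarrow> cmod 0 * 0 + cmod 0 * norm (HZ w \<phi>)) (at 0)"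
        by (intro tendsto_intros Z_derivative[OF w])
      then have lim: "((\<lambda>v. cmod v * norm ((1 / v) *\<^sub>C (Z (w + v) \<phi> - Z w \<phi>) - - HZ w \<phi>)
          + cmod v * norm (HZ w \<phi>)) \<longlongrightarrow> 0) (at 0)"
        by simp
      have "((\<lambda>v. norm (Z (w + v) \<phi> - Z w \<phi>)) \<longlongrightarrow> 0) (at 0)"
      proof (rule tendsto_sandwich[OF _ _ tendsto_const lim])
        show "\<forall>\<^sub>F v in at 0. norm (Z (w + v) \<phi> - Z w \<phi>)
            \<le> cmod v * norm ((1 / v) *\<^sub>C (Z (w + v) \<phi> - Z w \<phi>) - - HZ w \<phi>) + cmod v * norm (HZ w \<phi>)"
          unfolding eventually_at_filter
        proof (intro always_eventually allI impI)
          fix v :: complex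
          assume "v \<noteq> 0"
          then have eq: "Z (w + v) \<phi> - Z w \<phi>
              = v *\<^sub>C ((1 / v) *\<^sub>C (Z (w + v) \<phi> - Z w \<phi>) - - HZ w \<phi>) - v *\<^sub>C HZ w \<phi>"
            by (simp add: scaleC_add_right scaleC_scaleC)
          show "norm (Z (w + v) \<phi> - Z w \<phi>)
              \<le> cmod v * norm ((1 / v) *\<^sub>C (Z (w + v) \<phi> - Z w \<phi>) - - HZ w \<phi>) + cmod v * norm (HZ w \<phi>)"
            by (rule ord_eq_le_trans[OF arg_cong[OF eq, of norm]], rule order_trans[OF norm_triangle_ineq4],
                simp only: norm_scaleC)
        qed
      qed simp
      then have "limitin T (\<lambda>v. Z (w + v) \<phi>) (Z w \<phi>) (at 0)"
        by (rule limitinI_norm)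
      moreover have "filterlim (\<lambda>t. complex_of_real (t - x)) (at 0) (at x)"
        by (auto simp: filterlim_at eventually_at_filter intro!: tendsto_eq_intros)
      ultimately have "limitin T (\<lambda>t. Z (w + complex_of_real (t - x)) \<phi>) (Z w \<phi>) (at x)"
        by (rule limitin_compose_filterlim)
      moreover have "\<forall>\<^sub>F t in at x. Z (w + complex_of_real (t - x)) \<phi> = rep_semigroup J U m c t \<phi>"
        using eventually_at_in_open'[of "{0<..}" x] x
        by (auto elim!: eventually_mono simp: w_def rep_semigroup_pos)
      ultimately have "limitin T (\<lambda>t. rep_semigroup J U m c t \<phi>) (Z w \<phi>) (at x)"
        by (rule limitin_eventually_eq)
      moreover have "filterlim (\<lambda>t. t) (at x) (at x within {0..})"
        by (simp add: filterlim_def at_le)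
      ultimately have "limitin T (\<lambda>t. rep_semigroup J U m c t \<phi>) (Z w \<phi>) (at x within {0..})"
        by (rule limitin_compose_filterlim)
      then show ?thesis
        using x by (simp add: rep_semigroup_pos w_def)
    qed
  qed
qed

lemma holomorphic_semigroup_rep: "holomorphic_semigroup T (rep_semigroup J U m c)"
  unfolding holomorphic_semigroup_def
proof (intro exI[of _ \<theta>] exI[of _ "\<lambda>w. Z w"] conjI ballI allI impI)
  fix w v \<phi>
  assume w: "w \<in> sector \<theta>"
  show "bounded_clinear (Z w)" "continuous_map T T (Z w)"
    using w by (auto intro: \<Psi>_linear \<Psi>_continuous admissible_heat)
  show "Z (w + v) = Z w \<circ> Z v" if "v \<in> sector \<theta>"
    using Z_mult[OF w that] by (simp add: fun_eq_iff)
  show "\<exists>\<psi>. limitin T (\<lambda>v. (1 / v) *\<^sub>C (Z (w + v) \<phi> - Z w \<phi>)) \<psi> (at 0)"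
    using limitinI_norm[OF Z_derivative[OF w]] by blast
next
  fix \<theta>' \<phi>
  assume "0 < \<theta>' \<and> \<theta>' < \<theta>"
  then have "sector \<theta>' \<subseteq> sector \<theta>"
    by (auto simp: sector_def)
  then have "filterlim (\<lambda>w. w) (at 0 within sector \<theta>) (at 0 within sector \<theta>')"
    by (simp add: filterlim_def at_le)
  then show "limitin T (\<lambda>w. Z w \<phi>) \<phi> (at 0 within sector \<theta>')"
    by (rule limitin_compose_filterlim[OF Z_limit])
qed (use theta rep_semigroup_pos in auto)

lemma semigroup_generator_rep:
  "semigroup_generator T (rep_semigroup J U m c) = prod_topology T T closure_of rep_operator T U m c"
proof -
  have "limitin T (\<lambda>t. (1 / t) *\<^sub>R (\<phi> - rep_semigroup J U m c t \<phi>)) \<psi> (at_right 0)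
      \<longleftrightarrow> limitin T (\<lambda>t. (1 / t) *\<^sub>R (\<phi> - Z (complex_of_real t) \<phi>)) \<psi> (at_right 0)" for \<phi> \<psi>
    by (intro iffI; erule limitin_eventually_eq) (auto simp: rep_semigroup_eq eventually_at_filter)
  then show ?thesis
    unfolding heat_generator_closure semigroup_generator_def
    using heat_generator_limit heat_generator_of_limit by auto
qed

section \<open>Seminorm bounds and entire analytic vectors\<close>

lemma diff_seminorm_nonneg:
  "0 \<le> diff_seminorm T U k \<phi>"
proof -
  have "norm (op_apply (inf_gen_power T U (replicate k undefined)) \<phi>) \<le> diff_seminorm T U k \<phi>"
    unfolding diff_seminorm_def
    by (rule cSUP_upper) (auto intro!: bdd_above_finite finite_imageI finite_lists_length_eq_UNIV)
  then show ?thesis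
    by (rule order_trans[OF norm_ge_zero])
qed

lemma rep_semigroup_diff_space:
  assumes "t > 0"
  shows "rep_semigroup J U m c t \<phi> \<in> diff_space T U k"
  unfolding diff_space_iff rep_semigroup_pos[OF assms]
  using \<Psi>_inf_gen_power[OF admissible_heat[OF of_real_in_sector[OF assms]]] by blast

lemma rep_semigroup_bounds:
  obtains a b \<omega> where "a > 0" "b > 0" "\<omega> \<ge> 0"
    "\<And>k t \<phi>. t > 0 \<Longrightarrow> diff_seminorm T U k (rep_semigroup J U m c t \<phi>)
        \<le> a * b ^ k * t powr (- real k / real m) * fact k powr (1 / real m) * exp (\<omega> * t) * norm \<phi>"
proof -
  obtain a b \<omega> where ab: "a > 0" "b > 0" "\<omega> \<ge> 0"
    and bound: "\<And>w \<alpha> \<phi>. w \<in> sector \<theta> \<Longrightarrow> norm (\<Psi> (\<lambda>z. monomial \<alpha> z * heat w z) \<phi>)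
      \<le> a * b ^ length \<alpha> * cmod w powr (- real (length \<alpha>) / m) * fact (length \<alpha>) powr (1 / m)
        * exp (\<omega> * cmod w) * norm \<phi>"
    by (rule monomial_heat_norm) (rule that)
  have "diff_seminorm T U k (rep_semigroup J U m c t \<phi>)
      \<le> a * b ^ k * t powr (- real k / real m) * fact k powr (1 / real m) * exp (\<omega> * t) * norm \<phi>"
    if t: "t > 0" for k t \<phi>
    unfolding diff_seminorm_def
  proof (rule cSUP_least)
    have "replicate k undefined \<in> {\<alpha> :: 'd list. length \<alpha> = k}"
      by simp
    then show "{\<alpha> :: 'd list. length \<alpha> = k} \<noteq> {}"
      by blast
    fix \<alpha> :: "'d list"
    assume \<alpha>: "\<alpha> \<in> {\<alpha>. length \<alpha> = k}"
    note w = of_real_in_sector[OF t]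
    show "norm (op_apply (inf_gen_power T U \<alpha>) (rep_semigroup J U m c t \<phi>))
        \<le> a * b ^ k * t powr (- real k / real m) * fact k powr (1 / real m) * exp (\<omega> * t) * norm \<phi>"
      using bound[OF w, of \<alpha> \<phi>] \<alpha> t
      by (simp add: rep_semigroup_pos op_apply_inf_gen_power[OF \<Psi>_inf_gen_power[OF admissible_heat[OF w]]])
  qed
  with ab show thesis
    by (rule that)
qed

text \<open>By p q \<le> (p^2 + q^2) / 2 with p = |2 x|^k / sqrt(k!) and q = 2^(-k), the terms are
  dominated by those of the exponential series at 4 x^2 and of a geometric series.\<close>

lemma summable_power_sqrt_fact: "summable (\<lambda>k. x ^ k / sqrt (fact k))" for x :: real
proof (rule summable_comparison_test')
  show "summable (\<lambda>k. ((4 * x\<^sup>2) ^ k /\<^sub>R fact k + (1 / 4) ^ k) / 2)"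
    by (intro summable_divide summable_add summable_exp_generic summable_geometric) simp
  fix k :: nat
  define p q where "p = \<bar>2 * x\<bar> ^ k / sqrt (fact k)" and "q = (1 / 2 :: real) ^ k"
  have "0 \<le> (p - q)\<^sup>2"
    by simp
  then have "p * q \<le> (p\<^sup>2 + q\<^sup>2) / 2"
    by (simp add: power2_diff)
  moreover have "p * q = norm (x ^ k / sqrt (fact k))"
    by (simp add: p_def q_def abs_mult power_mult_distrib power_abs power_one_over)
  moreover have "p\<^sup>2 = (4 * x\<^sup>2) ^ k /\<^sub>R fact k"
  proof -
    have "(\<bar>2 * x\<bar> ^ k)\<^sup>2 = (\<bar>2 * x\<bar>\<^sup>2) ^ k"
      by (simp only: power_mult[symmetric] mult.commute)
    moreover have "\<bar>2 * x\<bar>\<^sup>2 = 4 * x\<^sup>2"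
      by (simp add: power_mult_distrib)
    moreover have "(sqrt (fact k))\<^sup>2 = (fact k :: real)"
      by (rule real_sqrt_pow2) simp
    ultimately have "p\<^sup>2 = (4 * x\<^sup>2) ^ k / fact k"
      unfolding p_def power_divide by (simp only:)
    then show ?thesis
      by (simp only: divide_inverse real_scaleR_def mult.commute)
  qed
  moreover have "q\<^sup>2 = (1 / 4) ^ k"
  proof -
    have "q\<^sup>2 = ((1 / 2)\<^sup>2) ^ k"
      unfolding q_def by (simp only: power_mult[symmetric] mult.commute)
    then show ?thesis
      by (simp add: power2_eq_square)
  qed
  ultimately show "norm (x ^ k / sqrt (fact k)) \<le> ((4 * x\<^sup>2) ^ k /\<^sub>R fact k + (1 / 4) ^ k) / 2"
    by simp
qed

text \<open>Since m \<ge> 2, the factor (k!)^(1/m) is at most sqrt(k!); dividing by k! leaves 1 /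
  sqrt(k!), against which every power x^k is summable.\<close>

lemma rep_semigroup_entire:
  assumes t: "t > 0"
  shows "rep_semigroup J U m c t \<phi> \<in> entire_analytic T U"
  unfolding entire_analytic_def
proof (intro CollectI conjI allI impI)
  show "rep_semigroup J U m c t \<phi> \<in> smooth_space T U"
    using rep_semigroup_diff_space[OF t] by (simp add: smooth_space_def)
  obtain a b \<omega> where ab: "a > 0" "b > 0" "\<omega> \<ge> 0"
    and bound: "\<And>k t \<phi>. t > 0 \<Longrightarrow> diff_seminorm T U k (rep_semigroup J U m c t \<phi>)
        \<le> a * b ^ k * t powr (- real k / real m) * fact k powr (1 / real m) * exp (\<omega> * t) * norm \<phi>"
    by (rule rep_semigroup_bounds) (rule that)
  fix s :: real
  assume s: "s > 0"
  define N where "N k = diff_seminorm T U k (rep_semigroup J U m c t \<phi>)" for k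
  define D where "D = a * exp (\<omega> * t) * norm \<phi>"
  define x where "x = s * b * t powr (- 1 / m)"
  have le: "norm (s ^ k / fact k * N k) \<le> D * (x ^ k / sqrt (fact k))" for k
  proof -
    have tk: "t powr (- real k / m) = (t powr (- 1 / m)) ^ k"
      using t by (simp add: powr_realpow[symmetric] powr_powr)
    have "(fact k :: real) powr (1 / m) \<le> fact k powr (1 / 2)"
      using m by (intro powr_mono) (auto simp: divide_simps)
    then have f: "(fact k :: real) powr (1 / m) \<le> sqrt (fact k)"
      by (simp add: powr_half_sqrt)
    have "norm (s ^ k / fact k * N k) = s ^ k / fact k * N k"
      using s diff_seminorm_nonneg[of k] by (simp add: N_def abs_mult)
    also have "\<dots> \<le> s ^ k / fact k * (a * b ^ k * t powr (- real k / real m) * fact k powr (1 / real m) * exp (\<omega> * t) * norm \<phi>)"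
      using bound[OF t, of k \<phi>] s by (intro mult_left_mono) (auto simp: N_def)
    also have "\<dots> = D * x ^ k * (fact k powr (1 / m) / fact k)"
      unfolding D_def x_def tk power_mult_distrib by simp
    also have "\<dots> \<le> D * x ^ k * (sqrt (fact k) / fact k)"
      using ab s t f by (intro mult_left_mono divide_right_mono) (auto simp: D_def x_def)
    also have "sqrt (fact k) / fact k = 1 / sqrt (fact k :: real)"
      by (simp add: real_div_sqrt field_simps)
    finally show ?thesis
      by simp
  qed
  have "summable (\<lambda>j. D * (x ^ Suc j / sqrt (fact (Suc j))))"
    by (intro summable_mult) (subst summable_Suc_iff, rule summable_power_sqrt_fact)
  then have "summable (\<lambda>j. s ^ Suc j / fact (Suc j) * N (Suc j))"
    by (rule summable_comparison_test') (rule le)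
  then show "summable (\<lambda>j. s ^ Suc j / fact (Suc j) * diff_seminorm T U (Suc j) (rep_semigroup J U m c t \<phi>))"
    unfolding N_def .
qed

lemma entire_analytic_dense: "T closure_of entire_analytic T U = UNIV"
proof -
  have "\<phi> \<in> T closure_of entire_analytic T U" for \<phi>
  proof (rule limitin_in_closure_of[OF limitin_rep_semigroup_0])
    show "\<forall>\<^sub>F t in at_right 0. rep_semigroup J U m c t \<phi> \<in> entire_analytic T U"
      unfolding eventually_at_right_field by (intro exI[of _ 1]) (auto intro: rep_semigroup_entire)
  qed simp
  then show ?thesis
    by blast
qed

theorem rep_semigroup_properties:
  shows "(\<forall>t>0. \<forall>\<phi>. \<exists>!\<psi>. J (\<lambda>y. heat_kernel m c t y *\<^sub>C U y \<phi>) \<psi>) \<and>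
    continuous_semigroup T (rep_semigroup J U m c) \<and>
    holomorphic_semigroup T (rep_semigroup J U m c) \<and>
    semigroup_generator T (rep_semigroup J U m c) = prod_topology T T closure_of rep_operator T U m c \<and>
    (\<exists>a>0. \<exists>b>0. \<exists>\<omega>\<ge>0. \<forall>k\<ge>1. \<forall>t>0. \<forall>\<phi>.
      rep_semigroup J U m c t \<phi> \<in> diff_space T U k \<and>
      diff_seminorm T U k (rep_semigroup J U m c t \<phi>)
        \<le> a * b ^ k * t powr (- real k / real m) * fact k powr (1 / real m)
            * exp (\<omega> * t) * norm \<phi>) \<and>
    (\<forall>t>0. \<forall>\<phi>. rep_semigroup J U m c t \<phi> \<in> entire_analytic T U) \<and>
    T closure_of entire_analytic T U = UNIV"
proof (intro conjI)
  obtain a b \<omega> where ab: "a > 0" "b > 0" "\<omega> \<ge> 0"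
    and bound: "\<And>k t \<phi>. t > 0 \<Longrightarrow> diff_seminorm T U k (rep_semigroup J U m c t \<phi>)
        \<le> a * b ^ k * t powr (- real k / real m) * fact k powr (1 / real m) * exp (\<omega> * t) * norm \<phi>"
    by (rule rep_semigroup_bounds) (rule that)
  show "\<exists>a>0. \<exists>b>0. \<exists>\<omega>\<ge>0. \<forall>k\<ge>1. \<forall>t>0. \<forall>\<phi>.
      rep_semigroup J U m c t \<phi> \<in> diff_space T U k \<and>
      diff_seminorm T U k (rep_semigroup J U m c t \<phi>)
        \<le> a * b ^ k * t powr (- real k / real m) * fact k powr (1 / real m) * exp (\<omega> * t) * norm \<phi>"
    using ab rep_semigroup_diff_space bound
    by (intro exI[of _ a] conjI exI[of _ b] exI[of _ \<omega>] allI impI)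
  show "\<forall>t>0. \<forall>\<phi>. \<exists>!\<psi>. J (\<lambda>y. heat_kernel m c t y *\<^sub>C U y \<phi>) \<psi>"
    by (intro allI impI rep_integral_ex1)
  show "\<forall>t>0. \<forall>\<phi>. rep_semigroup J U m c t \<phi> \<in> entire_analytic T U"
    by (intro allI impI rep_semigroup_entire)
qed (rule continuous_semigroup_rep holomorphic_semigroup_rep semigroup_generator_rep entire_analytic_dense)+

end

section \<open>Strongly and weak* continuous representations\<close>

lemma sectorial_symbol_elliptic:
  fixes c :: "'d::finite list \<Rightarrow> complex"
  assumes m: "even m" "m \<ge> 2" and elliptic: "strongly_elliptic m c"
  obtains \<theta> \<mu> C where "sectorial_symbol m c \<theta> \<mu> C"
proof -
  obtain \<theta> \<mu> C where *: "0 < \<theta>" "\<theta> \<le> pi / 2" "\<mu> > 0" "C \<ge> 0"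
    "\<And>w z r. w \<in> sector \<theta> \<Longrightarrow> r \<ge> 1 \<Longrightarrow> z \<in> strip (r - 1) \<Longrightarrow>
      Re (w * csymbol m c z) \<ge> cmod w * (\<mu> * norm (re_vec z) ^ m - C * r ^ m)"
    "\<And>z r. r \<ge> 1 \<Longrightarrow> z \<in> strip (r - 1) \<Longrightarrow> cmod (csymbol m c z) \<le> C * (norm (re_vec z) + r) ^ m"
    by (rule elliptic_sector_bound[OF m elliptic]) (rule that)
  show thesis
    by (rule that[of \<theta> \<mu> C], unfold_locales) (fact m(2) *)+
qed

lemma bounded_bilinear_scaleC: "bounded_bilinear (\<lambda>a (x::'a::complex_normed_vector). a *\<^sub>C x)"
proof
  show "(r *\<^sub>R a) *\<^sub>C x = r *\<^sub>R a *\<^sub>C x" for r a and x :: 'a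
    by (simp only: scaleR_conv_of_real[of r a] scaleR_scaleC[of r "a *\<^sub>C x"] scaleC_scaleC)
  show "a *\<^sub>C r *\<^sub>R x = r *\<^sub>R a *\<^sub>C x" for r a and x :: 'a
    by (simp add: scaleR_scaleC scaleC_scaleC mult.commute)
  show "\<exists>K. \<forall>a (x::'a). norm (a *\<^sub>C x) \<le> norm a * norm x * K"
    by (intro exI[of _ 1]) (simp add: norm_scaleC)
qed (simp_all add: scaleC_add_left scaleC_add_right)

section \<open>Exponential growth of representations\<close>

lemma representation_simps:
  assumes "representation U"
  shows "bounded_clinear (U x)" "U 0 \<phi> = \<phi>" "U (x + y) \<phi> = U x (U y \<phi>)"
  using assms by (simp_all add: representation_def)

lemma representation_power_bound:
  assumes rep: "representation U" and K: "K \<ge> 1"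
    and bound: "\<And>\<phi>. norm (U y \<phi>) \<le> K * norm \<phi>"
  shows "norm (U (real n *\<^sub>R y) \<phi>) \<le> K ^ n * norm \<phi>"
proof (induction n)
  case 0
  then show ?case
    by (simp add: representation_simps[OF rep])
next
  case (Suc n)
  have "U (real (Suc n) *\<^sub>R y) \<phi> = U y (U (real n *\<^sub>R y) \<phi>)"
    by (simp add: scaleR_add_left representation_simps[OF rep])
  also have "norm \<dots> \<le> K * (K ^ n * norm \<phi>)"
    by (rule order_trans[OF bound mult_left_mono[OF Suc]]) (use K in simp)
  finally show ?case
    by (simp add: mult.assoc)
qed

text \<open>If U were not bounded uniformly near 0, some null sequence X would have operator norms
  exceeding n + 1, against Banach-Steinhaus. Boundedness of orbits along null sequences is what both
  notions of continuity supply. The bound near 0 is then propagated by dividing x into short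
  steps.\<close>

lemma representation_growth:
  fixes U :: "real ^ 'd \<Rightarrow> 'a::complex_banach \<Rightarrow> 'a"
  assumes rep: "representation U"
    and bdd: "\<And>X \<phi>. X \<longlonglongrightarrow> 0 \<Longrightarrow> \<exists>C. \<forall>n. norm (U (X n) \<phi>) \<le> C"
  obtains M W where "M \<ge> 0" "W \<ge> 0" "\<And>x \<phi>. norm (U x \<phi>) \<le> M * exp (W * l1norm x) * norm \<phi>"
proof -
  have "\<exists>\<delta>>0. \<exists>K\<ge>1. \<forall>x \<phi>. norm x \<le> \<delta> \<longrightarrow> norm (U x \<phi>) \<le> K * norm \<phi>"
  proof (rule ccontr)
    assume not: "\<not> ?thesis"
    have "\<exists>x \<phi>. norm x \<le> inverse (real (Suc n)) \<and> norm (U x \<phi>) > real (Suc n) * norm \<phi>" for n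
    proof (rule ccontr)
      assume "\<not> ?thesis"
      then have "\<forall>x \<phi>. norm x \<le> inverse (real (Suc n)) \<longrightarrow> norm (U x \<phi>) \<le> real (Suc n) * norm \<phi>"
        by (simp add: not_less)
      moreover have "inverse (real (Suc n)) > 0" "real (Suc n) \<ge> 1"
        by simp_all
      ultimately show False
        using not by blast
    qed
    then obtain X \<Phi> where X: "\<And>n. norm (X n) \<le> inverse (real (Suc n))"
      "\<And>n. norm (U (X n) (\<Phi> n)) > real (Suc n) * norm (\<Phi> n)"
      by metis
    have "X \<longlonglongrightarrow> 0"
      by (rule Lim_null_comparison[OF _ LIMSEQ_inverse_real_of_nat]) (use X(1) in auto)
    then have pb: "\<exists>C. \<forall>n\<in>UNIV. norm (U (X n) \<phi>) \<le> C" for \<phi>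
      using bdd by simp
    have bl: "bounded_linear (U (X n))" for n
      using representation_simps(1)[OF rep] by (rule bounded_clinear_imp_bounded_linear)
    obtain C where "C \<ge> 0" and C: "\<And>n \<phi>. n \<in> UNIV \<Longrightarrow> norm (U (X n) \<phi>) \<le> C * norm \<phi>"
      by (rule uniform_boundedness[of UNIV "\<lambda>n. U (X n)", OF bl pb]) (rule that)
    obtain n where "C \<le> real n"
      using real_arch_simple by blast
    then have "C * norm (\<Phi> n) \<le> real (Suc n) * norm (\<Phi> n)"
      by (intro mult_right_mono) auto
    with C[OF UNIV_I, of n "\<Phi> n"] X(2)[of n] show False
      by linarith
  qed
  then obtain \<delta> K where \<delta>: "\<delta> > 0" and K: "K \<ge> 1"
    and loc: "\<And>x \<phi>. norm x \<le> \<delta> \<Longrightarrow> norm (U x \<phi>) \<le> K * norm \<phi>"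
    by blast
  \<comment> \<open>At most norm x / \<delta> + 1 steps of length at most \<delta> are taken, each
    costing a factor K; the extra step becomes the prefactor K.\<close>
  define W where "W = ln K / \<delta>"
  have W: "W \<ge> 0"
    using K \<delta> by (simp add: W_def)
  show thesis
  proof (rule that[of K W])
    fix x :: "real ^ 'd" and \<phi> :: 'a
    define n where "n = Suc (nat \<lfloor>norm x / \<delta>\<rfloor>)"
    have fl: "real (nat \<lfloor>norm x / \<delta>\<rfloor>) = of_int \<lfloor>norm x / \<delta>\<rfloor>"
      using \<delta> by simp
    have n: "norm x / \<delta> \<le> real n" "real n \<le> norm x / \<delta> + 1"
      unfolding n_def of_nat_Suc fl by linarith+
    have n0: "real n > 0"
      unfolding n_def of_nat_0_less_iff by (rule zero_less_Suc)
    define y where "y = (1 / real n) *\<^sub>R x"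
    have x: "x = real n *\<^sub>R y"
      using n0 by (simp add: y_def)
    have "norm y \<le> \<delta>"
      using n(1) n0 \<delta> by (simp add: y_def field_simps)
    then have "norm (U x \<phi>) \<le> K ^ n * norm \<phi>"
      unfolding x by (intro representation_power_bound[OF rep K] loc)
    also have "K ^ n \<le> K * exp (W * l1norm x)"
    proof -
      have "K ^ n = exp (ln K * real n)"
        using K by (simp add: exp_of_nat2_mult)
      also have "\<dots> \<le> exp (ln K * (norm x / \<delta> + 1))"
        using n(2) K by (simp add: mult_left_mono)
      also have "\<dots> = K * exp (W * norm x)"
        using K by (simp add: W_def exp_add distrib_left mult.commute)
      also have "\<dots> \<le> K * exp (W * l1norm x)"
        using K W norm_le_l1norm[of x] by (simp add: mult_left_mono)
      finally show ?thesis .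
    qed
    finally show "norm (U x \<phi>) \<le> K * exp (W * l1norm x) * norm \<phi>"
      by (simp add: mult_right_mono)
  qed (use K W in auto)
qed

text \<open>Continuity makes the integrand integrable on every box; domination by an integrable
  function extends this to the whole space, for the integrand and for its norm.\<close>

lemma strong_integral_exists:
  fixes G :: "real ^ 'd \<Rightarrow> complex" and V :: "real ^ 'd \<Rightarrow> 'b::complex_banach"
  assumes G: "exp_integrable W G" and V: "continuous_on UNIV V"
    and bound: "\<And>y. norm (V y) \<le> K * exp (W * l1norm y)"
  shows "\<exists>\<psi>. has_strong_integral (\<lambda>y. G y *\<^sub>C V y) \<psi>"
proof -
  have int: "(\<lambda>y. K * (cmod (G y) * exp (W * l1norm y))) integrable_on UNIV"
    using G unfolding exp_integrable_def by (intro integrable_on_lborel integrable_mult_right) simp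
  have cont: "continuous_on UNIV (\<lambda>y. G y *\<^sub>C V y)"
    using G V unfolding exp_integrable_def by (intro bounded_bilinear.continuous_on[OF bounded_bilinear_scaleC]) auto
  have le: "norm (G y *\<^sub>C V y) \<le> K * (cmod (G y) * exp (W * l1norm y))" for y
    using mult_left_mono[OF bound, of "cmod (G y)" y] by (simp add: norm_scaleC mult_ac)
  have 1: "(\<lambda>y. if y \<in> UNIV then G y *\<^sub>C V y else 0) integrable_on cbox a b" for a b
    using integrable_continuous[OF continuous_on_subset[OF cont]] by simp
  have 2: "(\<lambda>y. if y \<in> UNIV then norm (G y *\<^sub>C V y) else 0) integrable_on cbox a b" for a b
    using integrable_continuous[OF continuous_on_subset[OF continuous_on_norm[OF cont]]] by simp
  have "(\<lambda>y. G y *\<^sub>C V y) integrable_on UNIV"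
    by (rule integrable_on_all_intervals_integrable_bound[OF 1 le int])
  moreover have "(\<lambda>y. norm (G y *\<^sub>C V y)) integrable_on UNIV"
    by (rule integrable_on_all_intervals_integrable_bound[OF 2 _ int]) (use le in simp)
  ultimately show ?thesis
    unfolding has_strong_integral_def by blast
qed

text \<open>The gauge integral commutes with bounded linear maps, and for scalar functions it agrees
  with the Lebesgue integral whenever the latter exists.\<close>

lemma strong_integral_functional:
  assumes J: "has_strong_integral g \<psi>" and f: "bounded_linear f"
    and int: "integrable lborel (\<lambda>y. f (g y) :: complex)"
  shows "has_bochner_integral lborel (\<lambda>y. f (g y)) (f \<psi>)"
proof -
  have "((\<lambda>y. f (g y)) has_integral f \<psi>) UNIV"
    using has_integral_linear[OF _ f, of g \<psi> UNIV] J by (simp add: has_strong_integral_def comp_def)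
  then have "f \<psi> = (\<integral>y. f (g y) \<partial>lborel)"
    using has_integral_integral_lborel[OF int] by (rule has_integral_unique)
  then show ?thesis
    using int by (simp add: has_bochner_integral_iff)
qed

lemma continuous_orbit:
  fixes V :: "real ^ 'd \<Rightarrow> 'b::complex_banach \<Rightarrow> 'b"
  assumes lin: "\<And>x. bounded_clinear (V x)" and zero: "V 0 = id"
    and add: "\<And>x y f. V (x + y) f = V x (V y f)"
    and lim: "((\<lambda>x. V x f) \<longlongrightarrow> f) (at 0)"
  shows "continuous_on UNIV (\<lambda>x. V x f)"
  unfolding continuous_on_eq_continuous_at[OF open_UNIV] isCont_iff
proof
  fix x
  have "((\<lambda>h. V x (V h f)) \<longlongrightarrow> V x f) (at 0)"
    by (rule bounded_linear.tendsto[OF bounded_clinear_imp_bounded_linear[OF lin] lim])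
  then show "(\<lambda>h. V (x + h) f) \<midarrow>0\<rightarrow> V x f"
    by (simp add: add)
qed

text \<open>\<Lambda> consists of the balls of integer radius in the dual: each is equibounded,
  their union is the whole dual and hence invariant under U, and the unit ball recovers the norm
  through norming functionals.\<close>

lemma strong_functional_calculus:
  fixes U :: "real ^ 'd \<Rightarrow> 'a::complex_banach \<Rightarrow> 'a"
  assumes U: "strongly_continuous_rep U"
  obtains M W where "functional_calculus U euclidean
    (range (\<lambda>n::nat. {f. bounded_clinear f \<and> (\<forall>y. cmod (f y) \<le> real n * norm y)})) M W has_strong_integral"
proof -
  have rep: "representation U" and "((\<lambda>x. norm (U x \<phi> - \<phi>)) \<longlongrightarrow> 0) (at 0)" for \<phi>
    using U by (auto simp: strongly_continuous_rep_def)
  then have lim: "((\<lambda>x. U x \<phi>) \<longlongrightarrow> \<phi>) (at 0)" for \<phi>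
    using tendsto_norm_zero_iff LIM_zero_iff by blast
  note rs = representation_simps[OF rep]
  have "U 0 = id"
    by (simp add: fun_eq_iff rs)
  from continuous_orbit[OF rs(1) this rs(3) lim] have cont: "continuous_on UNIV (\<lambda>x. U x \<phi>)" for \<phi> .
  obtain M W where MW: "M \<ge> 0" "W \<ge> 0" and growth: "\<And>x \<phi>. norm (U x \<phi>) \<le> M * exp (W * l1norm x) * norm \<phi>"
  proof (rule representation_growth[OF rep])
    fix X :: "nat \<Rightarrow> real ^ 'd" and \<phi>
    assume "X \<longlonglongrightarrow> 0"
    then have "(\<lambda>n. U (X n) \<phi>) \<longlonglongrightarrow> U 0 \<phi>"
      by (rule continuous_on_tendsto_compose[OF cont]) auto
    then have "Bseq (\<lambda>n. U (X n) \<phi>)"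
      by (rule convergentI[THEN convergent_imp_Bseq])
    then show "\<exists>C. \<forall>n. norm (U (X n) \<phi>) \<le> C"
      unfolding Bseq_def by blast
  qed (rule that)
  define \<Lambda> where "\<Lambda> = range (\<lambda>n::nat. {f :: 'a \<Rightarrow> complex. bounded_clinear f \<and> (\<forall>y. cmod (f y) \<le> real n * norm y)})"
  have LamI: "f \<in> \<Union>\<Lambda>" if "bounded_clinear f" "\<And>y. cmod (f y) \<le> K * norm y" for f :: "'a \<Rightarrow> complex" and K
  proof -
    obtain n where "K \<le> real n"
      using real_arch_simple by blast
    then have "cmod (f y) \<le> real n * norm y" for y
      using that(2)[of y] mult_right_mono[of K "real n" "norm y"] by simp
    then show ?thesis
      using that(1) by (auto simp: \<Lambda>_def)
  qed
  have LamE: "bounded_clinear f \<and> (\<exists>n::nat. \<forall>y. cmod (f y) \<le> real n * norm y)" if "f \<in> \<Union>\<Lambda>" for f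
    using that by (auto simp: \<Lambda>_def)
  have group: "functional_group U euclidean \<Lambda> M W"
  proof
    show "limitin euclidean (\<lambda>x. x) l F \<longleftrightarrow> (\<forall>S\<in>\<Lambda>. \<forall>e>0. \<forall>\<^sub>F x in F. \<forall>f\<in>S. cmod (f (x - l)) \<le> e)"
      for l :: 'a and F
      unfolding limitin_canonical_iff
    proof (intro iffI ballI allI impI)
      fix S and e :: real
      assume tends: "((\<lambda>x. x) \<longlongrightarrow> l) F" and "S \<in> \<Lambda>" and e: "e > 0"
      then obtain n :: nat where n: "S = {f. bounded_clinear f \<and> (\<forall>y. cmod (f y) \<le> real n * norm y)}"
        by (auto simp: \<Lambda>_def)
      have "\<forall>\<^sub>F x in F. dist x l < e / (real n + 1)"
        using tends e by (simp add: tendsto_iff)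
      then show "\<forall>\<^sub>F x in F. \<forall>f\<in>S. cmod (f (x - l)) \<le> e"
      proof eventually_elim
        case (elim x)
        have "real n * norm (x - l) \<le> (real n + 1) * (e / (real n + 1))"
          using elim by (intro mult_mono) (auto simp: dist_norm)
        then have "real n * norm (x - l) \<le> e"
          by simp
        then show ?case
          unfolding n by (auto intro: order_trans)
      qed
    next
      assume *: "\<forall>S\<in>\<Lambda>. \<forall>e>0. \<forall>\<^sub>F x in F. \<forall>f\<in>S. cmod (f (x - l)) \<le> e"
      show "((\<lambda>x. x) \<longlongrightarrow> l) F"
        unfolding tendsto_iff
      proof (intro allI impI)
        fix e :: real
        assume e: "e > 0"
        define S where "S = {f :: 'a \<Rightarrow> complex. bounded_clinear f \<and> (\<forall>y. cmod (f y) \<le> real 1 * norm y)}"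
        have "S \<in> \<Lambda>"
          unfolding S_def \<Lambda>_def by blast
        then have "\<forall>\<^sub>F x in F. \<forall>f\<in>S. cmod (f (x - l)) \<le> e / 2"
          using * e half_gt_zero by blast
        then show "\<forall>\<^sub>F x in F. dist x l < e"
        proof eventually_elim
          case (elim x)
          obtain f :: "'a \<Rightarrow> complex"
            where "bounded_clinear f" "\<And>y. cmod (f y) \<le> norm y" and fx: "f (x - l) = norm (x - l)"
            using norming_functional[of "x - l"] by metis
          then have "f \<in> S"
            by (simp add: S_def)
          with elim have "cmod (f (x - l)) \<le> e / 2"
            by blast
          then show ?case
            using e by (simp add: fx dist_norm)
        qed
      qed
    qed
    show "\<exists>K\<ge>0. \<forall>f\<in>S. \<forall>x. cmod (f x) \<le> K * norm x" if "S \<in> \<Lambda>" for S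
      using that unfolding \<Lambda>_def by (metis (no_types, lifting) imageE mem_Collect_eq of_nat_0_le_iff)
    show "norm x \<le> r"
      if "\<And>f. f \<in> \<Union>\<Lambda> \<Longrightarrow> (\<And>y. cmod (f y) \<le> norm y) \<Longrightarrow> cmod (f x) \<le> r" for x :: 'a and r
    proof -
      obtain f :: "'a \<Rightarrow> complex"
        where f: "bounded_clinear f" "\<And>y. cmod (f y) \<le> norm y" and fx: "f x = norm x"
        using norming_functional[of x] by metis
      have "cmod (f x) \<le> r"
        by (rule that[OF LamI[of f 1]]) (use f in auto)
      then show ?thesis
        by (simp add: fx)
    qed
    show "(\<lambda>\<phi>. f (U x \<phi>)) \<in> \<Union>\<Lambda>" if fL: "f \<in> \<Union>\<Lambda>" for f x
    proof -
      obtain n :: nat where f: "bounded_clinear f" "\<And>y. cmod (f y) \<le> real n * norm y"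
        using LamE[OF fL] by blast
      show ?thesis
      proof (rule LamI)
        show "bounded_clinear (\<lambda>\<phi>. f (U x \<phi>))"
          by (rule bounded_clinear_compose[OF f(1) rs(1)])
        show "cmod (f (U x \<phi>)) \<le> (real n * (M * exp (W * l1norm x))) * norm \<phi>" for \<phi>
          using f(2)[of "U x \<phi>"] mult_left_mono[OF growth[of x \<phi>], of "real n"] by (simp add: mult.assoc)
      qed
    qed
    show "limitin euclidean (\<lambda>x. U x \<phi>) \<phi> (at 0)" for \<phi>
      using lim by simp
  qed (use rep MW growth LamE in \<open>auto simp: Hausdorff_space_euclidean\<close>)
  interpret functional_group U euclidean \<Lambda> M W
    by (rule group)
  have orbit_bound: "norm (U y \<phi>) \<le> (M * norm \<phi>) * exp (W * l1norm y)" for y \<phi>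
    using growth[of y \<phi>] by (simp add: mult_ac)
  have "functional_calculus U euclidean \<Lambda> M W has_strong_integral"
  proof
    show "\<exists>\<psi>. has_strong_integral (\<lambda>y. G y *\<^sub>C U y \<phi>) \<psi>" if "exp_integrable W G" for G \<phi>
      by (rule strong_integral_exists[OF that cont orbit_bound])
    show fn: "has_bochner_integral lborel (\<lambda>y. G y * f (U y \<phi>)) (f \<psi>)"
      if G: "exp_integrable W G" and J: "has_strong_integral (\<lambda>y. G y *\<^sub>C U y \<phi>) \<psi>" and f: "f \<in> \<Union>\<Lambda>" for G \<phi> \<psi> f
    proof -
      note lin = functional[OF f]
      have eq: "f (G y *\<^sub>C U y \<phi>) = G y * f (U y \<phi>)" for y
        by (simp add: bounded_clinear_scaleC[OF lin] scaleC_complex_def)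
      show ?thesis
        using strong_integral_functional[OF J bounded_clinear_imp_bounded_linear[OF lin]]
          integrable_orbit[OF G f, of \<phi>] unfolding eq by blast
    qed
    show "continuous_map euclidean euclidean A"
      if G: "exp_integrable W G" and J: "\<And>\<phi>. has_strong_integral (\<lambda>y. G y *\<^sub>C U y \<phi>) (A \<phi>)" for G A
    proof -
      define D where "D = integral UNIV (\<lambda>y. cmod (G y) * exp (W * l1norm y))"
      have int: "(\<lambda>y. cmod (G y) * exp (W * l1norm y)) integrable_on UNIV"
        using G unfolding exp_integrable_def by (intro integrable_on_lborel) simp
      have hi: "((\<lambda>y. G y *\<^sub>C U y \<phi>) has_integral A \<phi>) UNIV" for \<phi>
        using J by (simp add: has_strong_integral_def)
      have "bounded_linear A"
      proof (rule bounded_linear_intro)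
        show "A (x + y) = A x + A y" for x y
          using has_integral_unique[OF hi[of "x + y"], of "A x + A y"] has_integral_add[OF hi[of x] hi[of y]]
          by (simp add: bounded_clinear_add[OF rs(1)] scaleC_add_right)
        show "A (r *\<^sub>R x) = r *\<^sub>R A x" for r x
          using has_integral_unique[OF hi[of "r *\<^sub>R x"], of "r *\<^sub>R A x"] has_integral_cmul[OF hi[of x], of r]
          by (simp add: scaleR_scaleC bounded_clinear_scaleC[OF rs(1)] scaleC_scaleC mult.commute)
        show "norm (A x) \<le> norm x * (M * D)" for x
        proof -
          have "norm (A x) \<le> integral UNIV (\<lambda>y. (M * norm x) * (cmod (G y) * exp (W * l1norm y)))"
            unfolding integral_unique[OF hi[of x], symmetric]
          proof (rule Henstock_Kurzweil_Integration.integral_norm_bound_integral)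
            show "(\<lambda>y. G y *\<^sub>C U y x) integrable_on UNIV"
              using hi[of x] by blast
            show "(\<lambda>y. (M * norm x) * (cmod (G y) * exp (W * l1norm y))) integrable_on UNIV"
              using int by (rule integrable_on_mult_right)
            show "norm (G y *\<^sub>C U y x) \<le> (M * norm x) * (cmod (G y) * exp (W * l1norm y))" for y
              using mult_left_mono[OF orbit_bound[of y x], of "cmod (G y)"] by (simp add: norm_scaleC mult_ac)
          qed
          then show ?thesis
            by (simp add: D_def mult_ac)
        qed
      qed
      then show ?thesis
        by (simp add: bounded_linear.linear linear_continuous_on)
    qed
  qed
  then show thesis
    unfolding \<Lambda>_def by (rule that)
qed

text \<open>An operator with a pre-adjoint turns the evaluations that define the topology into
  evaluations of the same kind.\<close>

lemma continuous_map_weak_star: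
  assumes "\<And>f. \<exists>g. \<forall>\<phi>. B f (A \<phi>) = B g \<phi>"
  shows "continuous_map (weak_star_topology B) (weak_star_topology B) A"
proof -
  have eval: "continuous_map (weak_star_topology B) euclidean (B g)" for g
  proof -
    have "continuous_map (product_topology (\<lambda>_. euclidean) UNIV) euclidean (\<lambda>x. x g :: complex)"
      by (rule continuous_map_product_projection) simp
    from continuous_map_pullback[OF this, of UNIV "\<lambda>\<phi> f. B f \<phi>"] show ?thesis
      by (simp add: weak_star_topology_def comp_def)
  qed
  have "continuous_map (weak_star_topology B) euclidean (\<lambda>\<phi>. B f (A \<phi>))" for f
  proof -
    obtain g where "\<forall>\<phi>. B f (A \<phi>) = B g \<phi>"
      using assms[of f] by blast
    then have "(\<lambda>\<phi>. B f (A \<phi>)) = B g"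
      by (simp add: fun_eq_iff)
    then show ?thesis
      by (simp only: eval)
  qed
  then have "continuous_map (weak_star_topology B) (product_topology (\<lambda>_. euclidean) UNIV) (\<lambda>\<phi> f. B f (A \<phi>))"
    by (simp add: continuous_map_componentwise_UNIV)
  then show ?thesis
    by (subst (2) weak_star_topology_def) (auto intro!: continuous_map_pullback' simp: comp_def)
qed

lemma Hausdorff_weak_star:
  assumes "\<And>\<phi> \<psi>. (\<And>f. B f \<phi> = B f \<psi>) \<Longrightarrow> \<phi> = \<psi>"
  shows "Hausdorff_space (weak_star_topology B)"
proof -
  have "Hausdorff_space (product_topology (\<lambda>_. euclidean) UNIV :: ('b \<Rightarrow> complex) topology)"
    by (simp add: Hausdorff_space_product_topology Hausdorff_space_euclidean)
  moreover have "continuous_map (weak_star_topology B) (product_topology (\<lambda>_. euclidean) UNIV) (\<lambda>\<phi> f. B f \<phi>)"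
    unfolding weak_star_topology_def
    using continuous_map_pullback[OF continuous_map_id[of "product_topology (\<lambda>_. euclidean) UNIV"],
        of UNIV "\<lambda>\<phi> f. B f \<phi>"]
    by (simp add: comp_def id_def)
  moreover have "inj_on (\<lambda>\<phi> f. B f \<phi>) (topspace (weak_star_topology B))"
    using assms by (auto simp: inj_on_def fun_eq_iff)
  ultimately show ?thesis
    using Hausdorff_space_injective_preimage by blast
qed

section \<open>Dual pairings and the group on the predual\<close>

lemma dual_pairing_simps:
  fixes B :: "'p::complex_banach \<Rightarrow> 'a::complex_banach \<Rightarrow> complex"
  assumes B: "is_dual_pairing B"
  shows "bounded_clinear (\<lambda>f. B f \<phi>)" "bounded_clinear (B f)"
    and "cmod (B f \<phi>) \<le> norm f * norm \<phi>"
    and "(\<And>f. cmod (B f \<phi>) \<le> K * norm f) \<Longrightarrow> 0 \<le> K \<Longrightarrow> norm \<phi> \<le> K"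
    and "bounded_clinear L \<Longrightarrow> \<exists>\<phi>. \<forall>f. L f = B f \<phi>"
proof -
  show lin: "bounded_clinear (\<lambda>f. B f \<phi>)" "bounded_clinear (B f)"
    and "bounded_clinear L \<Longrightarrow> \<exists>\<phi>. \<forall>f. L f = B f \<phi>"
    using B unfolding is_dual_pairing_def by auto
  have norm: "norm \<phi> = onorm (\<lambda>f. B f \<phi>)"
    using B unfolding is_dual_pairing_def by auto
  show "cmod (B f \<phi>) \<le> norm f * norm \<phi>"
    using onorm[OF bounded_clinear_imp_bounded_linear[OF lin(1)], of f] by (simp add: norm mult.commute)
  show "(\<And>f. cmod (B f \<phi>) \<le> K * norm f) \<Longrightarrow> 0 \<le> K \<Longrightarrow> norm \<phi> \<le> K"
    unfolding norm by (rule onorm_bound)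
qed

text \<open>V x is the pre-adjoint of U x. Its linearity and group law are verified through B, which
  separates the predual; commutativity of the group removes the reversal of order. Every functional
  on the predual is an evaluation at some \<phi>, so weak continuity of V is the assumed continuity
  of the functions \<open>\<lambda>x. B f (U x \<phi>)\<close>.\<close>

lemma dual_group_exists:
  fixes B :: "'p::complex_banach \<Rightarrow> 'a::complex_banach \<Rightarrow> complex" and U :: "real ^ 'd \<Rightarrow> 'a \<Rightarrow> 'a"
  assumes B: "is_dual_pairing B" and rep: "representation U"
    and dual: "\<And>f x. \<exists>g. \<forall>\<phi>. B f (U x \<phi>) = B g \<phi>"
    and M: "M \<ge> 0" and W: "W \<ge> 0" and growth: "\<And>x \<phi>. norm (U x \<phi>) \<le> M * exp (W * l1norm x) * norm \<phi>"
    and cont: "\<And>f \<phi>. continuous_on UNIV (\<lambda>x. B f (U x \<phi>))"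
  obtains V where "\<And>x f \<phi>. B (V x f) \<phi> = B f (U x \<phi>)" "\<And>f. continuous_on UNIV (\<lambda>x. V x f)"
    "\<And>x f. norm (V x f) \<le> M * exp (W * l1norm x) * norm f"
proof -
  note Bs = dual_pairing_simps[OF B] and rs = representation_simps[OF rep]
  define V where "V x f = (SOME g. \<forall>\<phi>. B f (U x \<phi>) = B g \<phi>)" for x f
  have V: "B (V x f) \<phi> = B f (U x \<phi>)" for x f \<phi>
  proof -
    have "\<forall>\<phi>. B f (U x \<phi>) = B (V x f) \<phi>"
      unfolding V_def by (rule someI_ex[OF dual])
    from spec[OF this, of \<phi>] show ?thesis
      by (rule sym)
  qed
  \<comment> \<open>A norming functional of f is the evaluation at some \<phi> of norm at most 1,
    because \<chi> is the whole dual of the predual.\<close>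
  have repr: "\<exists>\<phi>. norm \<phi> \<le> 1 \<and> B f \<phi> = norm f" for f
  proof -
    obtain l :: "'p \<Rightarrow> complex" where l: "bounded_clinear l" "\<And>g. cmod (l g) \<le> norm g" "l f = norm f"
      using norming_functional[of f] by metis
    obtain \<phi> where \<phi>: "\<And>g. l g = B g \<phi>"
      using Bs(5)[OF l(1)] by blast
    have "norm \<phi> \<le> 1"
      by (rule Bs(4)) (use l(2) in \<open>simp_all add: \<phi>\<close>)
    then show ?thesis
      using l(3) \<phi> by metis
  qed
  have eqI: "f = g" if "\<And>\<phi>. B f \<phi> = B g \<phi>" for f g
  proof -
    obtain \<phi> where "B (f - g) \<phi> = norm (f - g)"
      using repr[of "f - g"] by blast
    then have "complex_of_real (norm (f - g)) = 0"
      using that[of \<phi>] by (simp add: bounded_clinear_diff[OF Bs(1)])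
    then show ?thesis
      by simp
  qed
  have bound: "norm (V x f) \<le> M * exp (W * l1norm x) * norm f" for x f
  proof -
    obtain \<phi> where \<phi>: "norm \<phi> \<le> 1" "B (V x f) \<phi> = norm (V x f)"
      using repr[of "V x f"] by blast
    have "norm (V x f) = cmod (B f (U x \<phi>))"
      using \<phi>(2) by (metis V norm_ge_zero norm_of_real abs_of_nonneg)
    also have "\<dots> \<le> norm f * norm (U x \<phi>)"
      by (rule Bs(3))
    also have "\<dots> \<le> norm f * (M * exp (W * l1norm x) * 1)"
    proof (rule mult_left_mono)
      have "M * exp (W * l1norm x) * norm \<phi> \<le> M * exp (W * l1norm x) * 1"
        using M \<phi>(1) by (intro mult_left_mono) auto
      with growth[of x \<phi>] show "norm (U x \<phi>) \<le> M * exp (W * l1norm x) * 1"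
        by (rule order_trans)
    qed simp
    finally show ?thesis
      by (simp add: mult.commute)
  qed
  have lin: "bounded_clinear (V x)" for x
  proof (rule bounded_clinearI)
    show "V x (f + g) = V x f + V x g" for f g
      by (rule eqI) (simp add: V bounded_clinear_add[OF Bs(1)])
    show "V x (a *\<^sub>C f) = a *\<^sub>C V x f" for a f
      by (rule eqI) (simp add: V bounded_clinear_scaleC[OF Bs(1)])
    show "norm (V x f) \<le> norm f * (M * exp (W * l1norm x))" for f
      using bound[of x f] by (simp add: mult.commute)
  qed
  have zero: "V 0 = id"
    by (rule ext, rule eqI) (simp add: V rs)
  have add: "V (x + y) f = V x (V y f)" for x y f
    by (rule eqI) (simp add: V rs(3)[symmetric] add.commute)
  have "((\<lambda>x. V x f) \<longlongrightarrow> f) (at 0)" for f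
  proof (rule weakly_continuous_group_imp_continuous[OF lin zero add])
    \<comment> \<open>On the unit ball \<open>l1norm\<close> is at most \<open>CARD('d)\<close>,
      which yields the uniform bound required of the group.\<close>
    show "M * exp (W * CARD('d)) \<ge> 0"
      using M by simp
    show "norm (V x f) \<le> M * exp (W * CARD('d)) * norm f" if "norm x \<le> 1" for x f
    proof -
      have "l1norm x \<le> CARD('d) * norm x"
        by (rule l1norm_le_norm)
      also have "\<dots> \<le> real CARD('d)"
        using that by (simp add: mult_left_le)
      finally have "M * exp (W * l1norm x) * norm f \<le> M * exp (W * CARD('d)) * norm f"
        using M W by (intro mult_right_mono mult_left_mono) (auto intro: mult_left_mono)
      with bound[of x f] show ?thesis
        by (rule order_trans)
    qed
    fix l :: "'p \<Rightarrow> complex"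
    assume "bounded_clinear l"
    then obtain \<phi> where "\<And>g. l g = B g \<phi>"
      using Bs(5) by blast
    then show "continuous_on UNIV (\<lambda>x. l (V x f))"
      using cont[of f \<phi>] by (simp add: V)
  qed
  from continuous_orbit[OF lin zero add this] show thesis
    using that V bound by blast
qed

text \<open>\<Lambda> consists of the singletons of evaluations, so uniformity over its members is
  pointwise convergence. Invariance under U is the assumption that the functional f composed with U
  x stays in the predual.\<close>

lemma weak_star_functional_calculus:
  fixes B :: "'p::complex_banach \<Rightarrow> 'a::complex_banach \<Rightarrow> complex" and U :: "real ^ 'd \<Rightarrow> 'a \<Rightarrow> 'a"
  assumes B: "is_dual_pairing B" and U: "weak_star_continuous_rep B U"
  obtains M W where "functional_calculus U (weak_star_topology B) (range (\<lambda>f. {B f})) M W (has_weak_star_integral B)"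
proof -
  note Bs = dual_pairing_simps[OF B]
  have rep: "representation U" and dual: "\<And>f x. \<exists>g. \<forall>\<phi>. B f (U x \<phi>) = B g \<phi>"
    and lim: "\<And>f \<phi>. ((\<lambda>x. B f (U x \<phi>)) \<longlongrightarrow> B f \<phi>) (at 0)"
    using U by (auto simp: weak_star_continuous_rep_def)
  note rs = representation_simps[OF rep]
  obtain M W where MW: "M \<ge> 0" "W \<ge> 0" and growth: "\<And>x \<phi>. norm (U x \<phi>) \<le> M * exp (W * l1norm x) * norm \<phi>"
  proof (rule representation_growth[OF rep])
    fix X :: "nat \<Rightarrow> real ^ 'd" and \<phi>
    assume X: "X \<longlonglongrightarrow> 0"
    \<comment> \<open>Uniform boundedness is needed twice: here on the predual, turning weak*
      bounded orbits into norm bounded ones, and again on \<chi> inside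
      \<open>representation_growth\<close>.\<close>
    have pb: "\<exists>C. \<forall>n\<in>UNIV. norm (B f (U (X n) \<phi>)) \<le> C" for f
    proof -
      have "isCont (\<lambda>x. B f (U x \<phi>)) 0"
        unfolding isCont_def rs(2) by (rule lim)
      from isCont_tendsto_compose[OF this X] have "Bseq (\<lambda>n. B f (U (X n) \<phi>))"
        by (rule convergentI[THEN convergent_imp_Bseq])
      then show ?thesis
        unfolding Bseq_def by blast
    qed
    obtain C where "C \<ge> 0" and C: "\<And>n f. n \<in> UNIV \<Longrightarrow> norm (B f (U (X n) \<phi>)) \<le> C * norm f"
      by (rule uniform_boundedness[of UNIV "\<lambda>n f. B f (U (X n) \<phi>)",
            OF bounded_clinear_imp_bounded_linear[OF Bs(1)] pb]) (rule that)
    have "norm (U (X n) \<phi>) \<le> C" for n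
      by (rule Bs(4)[OF C[OF UNIV_I] \<open>C \<ge> 0\<close>])
    then show "\<exists>C. \<forall>n. norm (U (X n) \<phi>) \<le> C"
      by blast
  qed (rule that)
  define \<Lambda> where "\<Lambda> = range (\<lambda>f. {B f})"
  have BL: "B f \<in> \<Union>\<Lambda>" for f
    by (auto simp: \<Lambda>_def)
  have group: "functional_group U (weak_star_topology B) \<Lambda> M W"
  proof
    show "Hausdorff_space (weak_star_topology B)"
    proof (rule Hausdorff_weak_star)
      fix \<phi> \<psi>
      assume eq: "\<And>f. B f \<phi> = B f \<psi>"
      have "norm (\<phi> - \<psi>) \<le> 0"
        by (rule Bs(4)) (simp_all add: bounded_clinear_diff[OF Bs(2)] eq)
      then show "\<phi> = \<psi>"
        by simp
    qed
    show "limitin (weak_star_topology B) (\<lambda>x. x) l F \<longleftrightarrow>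
        (\<forall>S\<in>\<Lambda>. \<forall>e>0. \<forall>\<^sub>F x in F. \<forall>f\<in>S. cmod (f (x - l)) \<le> e)" for l F
    proof -
      have "((\<lambda>x. B f x) \<longlongrightarrow> B f l) F \<longleftrightarrow> (\<forall>e>0. \<forall>\<^sub>F x in F. cmod (B f (x - l)) \<le> e)" for f
        unfolding tendsto_iff dist_norm bounded_clinear_diff[OF Bs(2)]
      proof (intro iffI allI impI)
        fix e :: real
        assume *: "\<forall>e>0. \<forall>\<^sub>F x in F. cmod (B f x - B f l) \<le> e" and e: "e > 0"
        have "\<forall>\<^sub>F x in F. cmod (B f x - B f l) \<le> e / 2"
          using * half_gt_zero[OF e] by blast
        then show "\<forall>\<^sub>F x in F. cmod (B f x - B f l) < e"
          by eventually_elim (use e in simp)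
      next
        fix e :: real
        assume *: "\<forall>e>0. \<forall>\<^sub>F x in F. cmod (B f x - B f l) < e" and "e > 0"
        then have "\<forall>\<^sub>F x in F. cmod (B f x - B f l) < e"
          by simp
        then show "\<forall>\<^sub>F x in F. cmod (B f x - B f l) \<le> e"
          by eventually_elim simp
      qed
      then show ?thesis
        by (simp add: limitin_weak_star_topology \<Lambda>_def)
    qed
    show "\<exists>K\<ge>0. \<forall>f\<in>S. \<forall>x. cmod (f x) \<le> K * norm x" if "S \<in> \<Lambda>" for S
      using that Bs(3) norm_ge_zero unfolding \<Lambda>_def by blast
    show "norm x \<le> r"
      if le: "\<And>f. f \<in> \<Union>\<Lambda> \<Longrightarrow> (\<And>y. cmod (f y) \<le> norm y) \<Longrightarrow> cmod (f x) \<le> r" for x r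
    proof (rule Bs(4))
      have B0: "B 0 y = 0" for y
        by (rule bounded_clinear_zero[OF Bs(1)])
      have "cmod (B 0 x) \<le> r"
        by (rule le[OF BL]) (simp add: B0)
      then show r: "0 \<le> r"
        by (simp add: B0)
      fix f
      show "cmod (B f x) \<le> r * norm f"
      proof (cases "f = 0")
        case False
        \<comment> \<open>Normalising f makes \<open>B g\<close> contractive, as the hypothesis on
          the functionals demands.\<close>
        define g where "g = complex_of_real (1 / norm f) *\<^sub>C f"
        have Bg: "B g y = complex_of_real (1 / norm f) * B f y" for y
          by (simp add: g_def bounded_clinear_scaleC[OF Bs(1)] scaleC_complex_def)
        have "norm g = 1"
          using False by (simp add: g_def norm_scaleC norm_divide)
        then have "cmod (B g y) \<le> norm y" for y
          using Bs(3)[of g y] by simp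
        then have "cmod (B g x) \<le> r"
          by (intro le) (auto simp: \<Lambda>_def)
        then show ?thesis
          using False by (simp add: Bg norm_mult norm_divide field_simps)
      qed (simp add: B0)
    qed
    show "(\<lambda>\<phi>. f (U x \<phi>)) \<in> \<Union>\<Lambda>" if "f \<in> \<Union>\<Lambda>" for f x
    proof -
      obtain g where f: "f = B g"
        using \<open>f \<in> \<Union>\<Lambda>\<close> by (auto simp: \<Lambda>_def)
      obtain g' where "\<And>\<phi>. B g (U x \<phi>) = B g' \<phi>"
        using dual by blast
      then have "(\<lambda>\<phi>. f (U x \<phi>)) = B g'"
        by (simp add: f fun_eq_iff)
      then show ?thesis
        by (auto simp: \<Lambda>_def)
    qed
    show "limitin (weak_star_topology B) (\<lambda>x. U x \<phi>) \<phi> (at 0)" for \<phi>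
      by (simp add: limitin_weak_star_topology lim)
  qed (use rep MW growth Bs(2) in \<open>auto simp: \<Lambda>_def\<close>)
  interpret functional_group U "weak_star_topology B" \<Lambda> M W
    by (rule group)
  have scale: "B f (G y *\<^sub>C U y \<phi>) = G y * B f (U y \<phi>)" for f G y \<phi>
    by (simp add: bounded_clinear_scaleC[OF Bs(2)] scaleC_complex_def)
  obtain V where V: "\<And>x f \<phi>. B (V x f) \<phi> = B f (U x \<phi>)" and V_cont: "\<And>f. continuous_on UNIV (\<lambda>x. V x f)"
    and V_bound: "\<And>x f. norm (V x f) \<le> M * exp (W * l1norm x) * norm f"
    by (rule dual_group_exists[OF B rep dual MW growth continuous_functional_orbit[OF BL]]) (rule that)
  have "functional_calculus U (weak_star_topology B) \<Lambda> M W (has_weak_star_integral B)"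
  proof
    show "\<exists>\<psi>. has_weak_star_integral B (\<lambda>y. G y *\<^sub>C U y \<phi>) \<psi>" if G: "exp_integrable W G" for G \<phi>
    proof -
      \<comment> \<open>The scalar integrals form a bounded functional on the predual, and duality
        represents it by a vector, the weak* integral.\<close>
      define L where "L f = (\<integral>y. G y * B f (U y \<phi>) \<partial>lborel)" for f
      define D where "D = (\<integral>y. cmod (G y) * exp (W * l1norm y) \<partial>lborel)"
      note int = integrable_orbit[OF G BL, of _ \<phi>]
      have "bounded_clinear L"
      proof (rule bounded_clinearI)
        show "L (f + g) = L f + L g" for f g
          unfolding L_def bounded_clinear_add[OF Bs(1)] distrib_left
          by (rule Bochner_Integration.integral_add[OF int int])
        show "L (a *\<^sub>C f) = a *\<^sub>C L f" for a f
          unfolding L_def bounded_clinear_scaleC[OF Bs(1)] scaleC_complex_def mult.left_commute[of _ a]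
          by (rule integral_mult_right_zero)
        show "norm (L f) \<le> norm f * (M * norm \<phi> * D)" for f
        proof -
          have "norm (L f) \<le> (\<integral>y. norm f * (M * norm \<phi>) * (cmod (G y) * exp (W * l1norm y)) \<partial>lborel)"
            unfolding L_def
          proof (rule norm_integral_le)
            show "integrable lborel (\<lambda>y. norm f * (M * norm \<phi>) * (cmod (G y) * exp (W * l1norm y)))"
              using G unfolding exp_integrable_def by (intro integrable_mult_right) simp
            fix y
            have "cmod (B f (U y \<phi>)) \<le> norm f * (M * exp (W * l1norm y) * norm \<phi>)"
              by (rule order_trans[OF Bs(3) mult_left_mono[OF growth]]) simp
            from mult_left_mono[OF this, of "cmod (G y)"]
            show "cmod (G y * B f (U y \<phi>)) \<le> norm f * (M * norm \<phi>) * (cmod (G y) * exp (W * l1norm y))"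
              by (simp add: norm_mult mult_ac)
          qed
          then show ?thesis
            by (simp add: D_def mult.assoc)
        qed
      qed
      then obtain \<psi> where "\<And>f. L f = B f \<psi>"
        using Bs(5) by blast
      then show ?thesis
        unfolding has_weak_star_integral_def scale has_bochner_integral_iff
        using int by (intro exI[of _ \<psi>]) (simp add: L_def)
    qed
    show fn: "has_bochner_integral lborel (\<lambda>y. G y * f (U y \<phi>)) (f \<psi>)"
      if "exp_integrable W G" and J: "has_weak_star_integral B (\<lambda>y. G y *\<^sub>C U y \<phi>) \<psi>" and f: "f \<in> \<Union>\<Lambda>" for G \<phi> \<psi> f
    proof -
      obtain g where "f = B g"
        using f by (auto simp: \<Lambda>_def)
      then show ?thesis
        using J unfolding has_weak_star_integral_def scale by simp
    qed
    show "continuous_map (weak_star_topology B) (weak_star_topology B) A"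
      if G: "exp_integrable W G" and J: "\<And>\<phi>. has_weak_star_integral B (\<lambda>y. G y *\<^sub>C U y \<phi>) (A \<phi>)" for G A
    proof (rule continuous_map_weak_star)
      fix f
      have "norm (V y f) \<le> (M * norm f) * exp (W * l1norm y)" for y
        using V_bound[of y f] by (simp add: mult_ac)
      \<comment> \<open>The strong integral g of the kernel against the orbit of f in the predual is
        the value at f of the pre-adjoint of A.\<close>
      from strong_integral_exists[OF G V_cont this]
      obtain g where g: "has_strong_integral (\<lambda>y. G y *\<^sub>C V y f) g"
        by blast
      have "B f (A \<phi>) = B g \<phi>" for \<phi>
      proof -
        have eq: "B (G y *\<^sub>C V y f) \<phi> = G y * B f (U y \<phi>)" for y
          by (simp add: bounded_clinear_scaleC[OF Bs(1)] scaleC_complex_def V)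
        have "has_bochner_integral lborel (\<lambda>y. G y * B f (U y \<phi>)) (B g \<phi>)"
          using strong_integral_functional[OF g bounded_clinear_imp_bounded_linear[OF Bs(1)], of \<phi>]
            integrable_orbit[OF G BL, of f \<phi>] unfolding eq by blast
        then show ?thesis
          using fn[OF G J BL] by (rule has_bochner_integral_eq[symmetric])
      qed
      then show "\<exists>g. \<forall>\<phi>. B f (A \<phi>) = B g \<phi>"
        by blast
    qed
  qed
  then show thesis
    unfolding \<Lambda>_def by (rule that)
qed

theorem proposition2p4:
  fixes U :: "real ^ 'd \<Rightarrow> 'a::complex_banach \<Rightarrow> 'a"
    and B :: "'p::complex_banach \<Rightarrow> 'a \<Rightarrow> complex"
    and c :: "'d list \<Rightarrow> complex"
    and m :: nat
    and T :: "'a topology"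
    and J :: "(real ^ 'd \<Rightarrow> 'a) \<Rightarrow> 'a \<Rightarrow> bool"
    and S :: "real \<Rightarrow> 'a \<Rightarrow> 'a"
  assumes alternatives:
      "(strongly_continuous_rep U \<and> T = euclidean \<and> J = has_strong_integral) \<or>
       (is_dual_pairing B \<and> weak_star_continuous_rep B U \<and>
        T = weak_star_topology B \<and> J = has_weak_star_integral B)"
    and m: "even m" "m \<ge> 2"
    and elliptic: "strongly_elliptic m c"
    and S_def: "S = rep_semigroup J U m c"
  shows "(\<forall>t>0. \<forall>\<phi>. \<exists>!\<psi>. J (\<lambda>y. heat_kernel m c t y *\<^sub>C U y \<phi>) \<psi>) \<and>
    continuous_semigroup T S \<and>
    holomorphic_semigroup T S \<and>
    semigroup_generator T S = prod_topology T T closure_of rep_operator T U m c \<and>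
    (\<exists>a>0. \<exists>b>0. \<exists>\<omega>\<ge>0. \<forall>k\<ge>1. \<forall>t>0. \<forall>\<phi>.
      S t \<phi> \<in> diff_space T U k \<and>
      diff_seminorm T U k (S t \<phi>)
        \<le> a * b ^ k * t powr (- real k / real m) * fact k powr (1 / real m)
            * exp (\<omega> * t) * norm \<phi>) \<and>
    (\<forall>t>0. \<forall>\<phi>. S t \<phi> \<in> entire_analytic T U) \<and>
    T closure_of entire_analytic T U = UNIV"
proof -
  obtain \<theta> \<mu> C where symbol: "sectorial_symbol m c \<theta> \<mu> C"
    by (rule sectorial_symbol_elliptic[OF m elliptic])
  obtain \<Lambda> M W where calculus: "functional_calculus U T \<Lambda> M W J"
    using alternatives
  proof (elim disjE conjE)
    assume "strongly_continuous_rep U" "T = euclidean" "J = has_strong_integral"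
    then show thesis
      using strong_functional_calculus[of U thesis] that by blast
  next
    assume "is_dual_pairing B" "weak_star_continuous_rep B U" "T = weak_star_topology B"
      "J = has_weak_star_integral B"
    then show thesis
      using weak_star_functional_calculus[of B U thesis] that by blast
  qed
  interpret elliptic_calculus U T \<Lambda> M W J m c \<theta> \<mu> C
    using calculus symbol by (rule elliptic_calculus.intro)
  show ?thesis
    unfolding S_def by (rule rep_semigroup_properties)
qed

end
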